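(* Let $u$ be the solution of $u''+\beta Au'+\alpha u'+Au=0$ in $\Omega\times(0,\infty)$, $u=0$ on $\partial\Omega\times[0,\infty)$, $u(0)=u_0$, $u'(0)=u_1$. For $k\in\{1,2,3,\dots\}$ let $u^{(k)}$ denote the $k$-th time derivative of $u$ ($u^{(0)}=u$) and let $E^{(k)}(u)(t)=\frac12\left(\|u^{(k)}(t)\|^2+|u^{(k-1)}(t)|_1^2\right)$. Let $0<\delta\le\min\left(\frac{\alpha+\beta\lambda_1}{2},\frac{\lambda_1}{\alpha+\beta\lambda_1}\right)$ and $k\in\{1,2,3,\dots\}$. Then the following hold for all $t\ge0$. (i) If $0<\delta<\min\left(\frac{\alpha+\beta\lambda_1}{2},\frac{\lambda_1}{\alpha+\beta\lambda_1}\right)$ or $0<\delta=\frac{\alpha+\beta\lambda_1}{2}$, then there is a constant $C=C(\alpha,\beta,\lambda_1)>0$, independent of $t$ and of the initial data, such that $$E^{(k)}(u)(t)\le C\,e^{-2\delta t}E^{(k)}(u)(0).$$ (ii) If $0<\delta=\frac{\lambda_1}{\alpha+\beta\lambda_1}$, then there is a constant $C>0$, independent of $t$ and of the initial data, such that $$\|u^{(k)}(t)\|^2\le C\,e^{-2\delta t}E^{(k)}(u)(0).$$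
   Context: $\Omega\subset\mathbb{R}^d$ is a bounded domain, $\|\cdot\|$ and $(\cdot,\cdot)$ are the norm and inner product of $L^2(\Omega)$, and $A=-\Delta$ with domain $D(A)=H^2(\Omega)\cap H_0^1(\Omega)$ is self-adjoint and positive definite on $L^2(\Omega)$; $\lambda_1>0$ is its smallest eigenvalue, so $\|v\|^2\le\lambda_1^{-1}\|A^{1/2}v\|^2$ for $v\in H_0^1(\Omega)$. For $s\ge 0$, $|v|_s=\|A^{s/2}v\|$. Set $a(w,v)=(A^{1/2}w,A^{1/2}v)$. Primes denote time derivatives. The damping parameters are constants with ($\alpha>0$, $\beta\ge0$) or ($\alpha\ge0$, $\beta>0$). The solution is understood in the variational sense: $u(t)\in H_0^1(\Omega)$ with $(u'',v)+\beta a(u',v)+\alpha(u',v)+a(u,v)=0$ for all $v\in H_0^1(\Omega)$, $t>0$, and $u(0)=u_0$, $u'(0)=u_1$. It is assumed regular enough that all quantities appearing are well defined and finite and that the time-differentiated equations $(u^{(k+1)},v)+\beta a(u^{(k)},v)+\alpha(u^{(k)},v)+a(u^{(k-1)},v)=0$ hold for all $v\in H_0^1(\Omega)$; the values $u^{(k)}(0)$ are those determined by the equation. *)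

theory Defs
  imports "HOL-Analysis.Analysis"
begin

section \<open>The Hilbert space of square-integrable functions\<close>

definition square_integrable :: "('a::euclidean_space \<Rightarrow> real) \<Rightarrow> bool" where
  "square_integrable f \<longleftrightarrow>
     f \<in> borel_measurable lborel \<and> integrable lborel (\<lambda>x. (f x)\<^sup>2)"

lemma square_integrable_zero: "square_integrable (\<lambda>_. 0)"
  by (simp add: square_integrable_def)

lemma square_integrable_mult:
  assumes "square_integrable f" "square_integrable g"
  shows "integrable lborel (\<lambda>x. f x * g x)"
proof (rule Bochner_Integration.integrable_bound)
  show "integrable lborel (\<lambda>x. (f x)\<^sup>2 + (g x)\<^sup>2)"
    using assms by (simp add: square_integrable_def)
  show "(\<lambda>x. f x * g x) \<in> borel_measurable lborel"
    using assms by (auto simp: square_integrable_def)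
  have "\<bar>a * b\<bar> \<le> a\<^sup>2 + b\<^sup>2" for a b :: real
  proof -
    have "2 * (\<bar>a\<bar> * \<bar>b\<bar>) \<le> a\<^sup>2 + b\<^sup>2" "0 \<le> \<bar>a\<bar> * \<bar>b\<bar>"
      using sum_squares_bound[of "\<bar>a\<bar>" "\<bar>b\<bar>"] by (simp_all add: mult.assoc)
    then show ?thesis
      unfolding abs_mult by linarith
  qed
  then show "AE x in lborel. norm (f x * g x) \<le> norm ((f x)\<^sup>2 + (g x)\<^sup>2)"
    by simp
qed

lemma square_integrable_add:
  assumes "square_integrable f" "square_integrable g"
  shows "square_integrable (\<lambda>x. f x + g x)"
  using assms square_integrable_mult[OF assms]
  by (auto simp: square_integrable_def power2_sum mult.assoc)

lemma square_integrable_scale: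
  "square_integrable f \<Longrightarrow> square_integrable (\<lambda>x. c * f x)"
  by (auto simp: square_integrable_def power_mult_distrib)

lemma square_integrable_minus:
  "square_integrable f \<Longrightarrow> square_integrable (\<lambda>x. - f x)"
  using square_integrable_scale[of f "-1"] by simp

quotient_type (overloaded) 'a L2 = "'a::euclidean_space \<Rightarrow> real" / partial:
  "\<lambda>f g. square_integrable f \<and> square_integrable g \<and> (AE x in lborel. f x = g x)"
proof (rule part_equivpI)
  show "\<exists>f. square_integrable f \<and> square_integrable f \<and> (AE x in lborel. f x = f x)"
    using square_integrable_zero by auto
  show "symp (\<lambda>f g. square_integrable f \<and> square_integrable g \<and> (AE x in lborel. f x = g x))"
    by (rule sympI) (simp add: eq_commute)
  show "transp (\<lambda>f g. square_integrable f \<and> square_integrable g \<and> (AE x in lborel. f x = g x))"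
    by (rule transpI) (auto elim: eventually_elim2)
qed

instantiation L2 :: (euclidean_space) real_vector
begin

lift_definition zero_L2 :: "'a L2" is "\<lambda>_. 0"
  by (simp add: square_integrable_zero)

lift_definition plus_L2 :: "'a L2 \<Rightarrow> 'a L2 \<Rightarrow> 'a L2" is "\<lambda>f g x. f x + g x"
  by (auto intro: square_integrable_add)

lift_definition uminus_L2 :: "'a L2 \<Rightarrow> 'a L2" is "\<lambda>f x. - f x"
  by (auto intro: square_integrable_minus)

definition minus_L2 :: "'a L2 \<Rightarrow> 'a L2 \<Rightarrow> 'a L2" where
  "minus_L2 f g = f + - g"

lift_definition scaleR_L2 :: "real \<Rightarrow> 'a L2 \<Rightarrow> 'a L2" is "\<lambda>c f x. c * f x"
  by (auto intro: square_integrable_scale)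

instance
proof
  fix f g h :: "'a L2" and a b :: real
  show "f + g + h = f + (g + h)"
    by transfer (auto intro: square_integrable_add simp: algebra_simps)
  show "f + g = g + f"
    by transfer (auto intro: square_integrable_add simp: algebra_simps)
  show "0 + f = f"
    by transfer auto
  show "- f + f = 0"
    by transfer (auto simp: square_integrable_zero)
  show "f - g = f + - g"
    by (rule minus_L2_def)
  show "a *\<^sub>R (f + g) = a *\<^sub>R f + a *\<^sub>R g"
    by transfer
      (auto intro!: square_integrable_add square_integrable_scale simp: distrib_left)
  show "(a + b) *\<^sub>R f = a *\<^sub>R f + b *\<^sub>R f"
    by transfer
      (auto intro!: square_integrable_add square_integrable_scale simp: distrib_right)
  show "a *\<^sub>R b *\<^sub>R f = (a * b) *\<^sub>R f"
    by transfer (auto intro!: square_integrable_scale simp: mult.assoc)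
  show "1 *\<^sub>R f = f"
    by transfer auto
qed

end

instantiation L2 :: (euclidean_space) real_inner
begin

lift_definition inner_L2 :: "'a L2 \<Rightarrow> 'a L2 \<Rightarrow> real" is
  "\<lambda>f g. \<integral>x. f x * g x \<partial>lborel"
  by (rule integral_cong_AE) (auto simp: square_integrable_def)

definition norm_L2 :: "'a L2 \<Rightarrow> real" where
  "norm_L2 f = sqrt (inner f f)"

definition dist_L2 :: "'a L2 \<Rightarrow> 'a L2 \<Rightarrow> real" where
  "dist_L2 f g = norm (f - g)"

definition sgn_L2 :: "'a L2 \<Rightarrow> 'a L2" where
  "sgn_L2 f = f /\<^sub>R norm f"

definition uniformity_L2 :: "('a L2 \<times> 'a L2) filter" where
  "uniformity_L2 = (INF e\<in>{0<..}. principal {(f, g). dist f g < e})"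

definition open_L2 :: "'a L2 set \<Rightarrow> bool" where
  "open_L2 U \<longleftrightarrow> (\<forall>f\<in>U. eventually (\<lambda>(f', g). f' = f \<longrightarrow> g \<in> U) uniformity)"

instance
proof
  fix f g h :: "'a L2" and c :: real and U :: "'a L2 set"
  show "dist f g = norm (f - g)"
    by (rule dist_L2_def)
  show "sgn f = f /\<^sub>R norm f"
    by (rule sgn_L2_def)
  show "uniformity = (INF e\<in>{0<..}. principal {(f::'a L2, g). dist f g < e})"
    by (rule uniformity_L2_def)
  show "open U \<longleftrightarrow> (\<forall>f\<in>U. \<forall>\<^sub>F (f', g) in uniformity. f' = f \<longrightarrow> g \<in> U)"
    by (rule open_L2_def)
  show "inner f g = inner g f"
    by transfer (simp add: mult.commute)
  show "inner (f + g) h = inner f h + inner g h"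
    by transfer (simp add: distrib_right square_integrable_mult)
  show "inner (c *\<^sub>R f) g = c * inner f g"
    by transfer (simp add: mult.assoc)
  show "0 \<le> inner f f"
    by transfer simp
  show "inner f f = 0 \<longleftrightarrow> f = 0"
  proof transfer
    fix f :: "'a \<Rightarrow> real"
    assume "square_integrable f \<and> square_integrable f \<and> (AE x in lborel. f x = f x)"
    then have f: "square_integrable f" by simp
    then have "(\<integral>x. f x * f x \<partial>lborel) = 0 \<longleftrightarrow> (AE x in lborel. f x * f x = 0)"
      by (intro integral_nonneg_eq_0_iff_AE square_integrable_mult) auto
    then show "(\<integral>x. f x * f x \<partial>lborel) = 0 \<longleftrightarrow>
        square_integrable f \<and> square_integrable (\<lambda>_::'a. 0) \<and> (AE x in lborel. f x = 0)"
      using f by (simp add: square_integrable_zero)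
  qed
  show "norm f = sqrt (inner f f)"
    by (rule norm_L2_def)
qed

end

text \<open>A function on \<Omega> is identified with its extension by zero.\<close>

lift_definition vanishes_outside :: "'a::euclidean_space set \<Rightarrow> 'a L2 \<Rightarrow> bool" is
  "\<lambda>\<Omega> f. AE x in lborel. x \<notin> \<Omega> \<longrightarrow> f x = 0"
  by auto

definition L2_on :: "'a::euclidean_space set \<Rightarrow> 'a L2 set" where
  "L2_on \<Omega> = {f. vanishes_outside \<Omega> f}"

text \<open>The class of a square-integrable function; the fallback value 0 is not used below.\<close>

lift_definition L2_of :: "('a::euclidean_space \<Rightarrow> real) \<Rightarrow> 'a L2" is
  "\<lambda>f. if square_integrable f then f else (\<lambda>_. 0)"
  by (auto simp: square_integrable_zero)


section \<open>Sobolev spaces and the Dirichlet Laplacian\<close>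

definition partial_deriv :: "'a::euclidean_space \<Rightarrow> ('a \<Rightarrow> real) \<Rightarrow> 'a \<Rightarrow> real" where
  "partial_deriv b \<phi> = (\<lambda>x. frechet_derivative \<phi> (at x) b)"

fun Ck :: "nat \<Rightarrow> ('a::euclidean_space \<Rightarrow> real) \<Rightarrow> bool" where
  "Ck 0 \<phi> \<longleftrightarrow> continuous_on UNIV \<phi>"
| "Ck (Suc n) \<phi> \<longleftrightarrow> \<phi> differentiable_on UNIV \<and> (\<forall>b\<in>Basis. Ck n (partial_deriv b \<phi>))"

text \<open>The space of smooth functions with compact support contained in \<Omega>.\<close>

definition test_functions :: "'a::euclidean_space set \<Rightarrow> ('a \<Rightarrow> real) set" where
  "test_functions \<Omega> =
     {\<phi>. (\<forall>n. Ck n \<phi>) \<and> compact (closure {x. \<phi> x \<noteq> 0}) \<and> closure {x. \<phi> x \<noteq> 0} \<subseteq> \<Omega>}"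

definition is_weak_deriv ::
  "'a::euclidean_space set \<Rightarrow> 'a \<Rightarrow> 'a L2 \<Rightarrow> 'a L2 \<Rightarrow> bool" where
  "is_weak_deriv \<Omega> b f g \<longleftrightarrow> f \<in> L2_on \<Omega> \<and> g \<in> L2_on \<Omega> \<and>
     (\<forall>\<phi>\<in>test_functions \<Omega>. inner f (L2_of (partial_deriv b \<phi>)) = - inner g (L2_of \<phi>))"

definition weak_deriv :: "'a::euclidean_space set \<Rightarrow> 'a \<Rightarrow> 'a L2 \<Rightarrow> 'a L2" where
  "weak_deriv \<Omega> b f = (THE g. is_weak_deriv \<Omega> b f g)"

definition H1 :: "'a::euclidean_space set \<Rightarrow> 'a L2 set" where
  "H1 \<Omega> = {f \<in> L2_on \<Omega>. \<forall>b\<in>Basis. \<exists>g. is_weak_deriv \<Omega> b f g}"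

definition H2 :: "'a::euclidean_space set \<Rightarrow> 'a L2 set" where
  "H2 \<Omega> = {f \<in> H1 \<Omega>. \<forall>b\<in>Basis. weak_deriv \<Omega> b f \<in> H1 \<Omega>}"

definition H1_norm :: "'a::euclidean_space set \<Rightarrow> 'a L2 \<Rightarrow> real" where
  "H1_norm \<Omega> f = sqrt ((norm f)\<^sup>2 + (\<Sum>b\<in>Basis. (norm (weak_deriv \<Omega> b f))\<^sup>2))"

definition H10 :: "'a::euclidean_space set \<Rightarrow> 'a L2 set" where
  "H10 \<Omega> = {f \<in> H1 \<Omega>. \<forall>e>0. \<exists>\<phi>\<in>test_functions \<Omega>. H1_norm \<Omega> (f - L2_of \<phi>) < e}"

definition neg_laplacian :: "'a::euclidean_space set \<Rightarrow> 'a L2 \<Rightarrow> 'a L2" where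
  "neg_laplacian \<Omega> f = - (\<Sum>b\<in>Basis. weak_deriv \<Omega> b (weak_deriv \<Omega> b f))"

definition bounded_domain :: "'a::euclidean_space set \<Rightarrow> bool" where
  "bounded_domain \<Omega> \<longleftrightarrow> open \<Omega> \<and> connected \<Omega> \<and> bounded \<Omega> \<and> \<Omega> \<noteq> {}"


section \<open>Unbounded operators\<close>

text \<open>
  An operator on the closed subspace \<open>H\<close> is given by its domain \<open>D\<close> and a function \<open>T\<close>, of
  which only the values on \<open>D\<close> matter. The last clause below says that the graph of the
  adjoint is the graph of the operator.
\<close>

definition self_adjoint_op :: "'h::real_inner set \<Rightarrow> 'h set \<Rightarrow> ('h \<Rightarrow> 'h) \<Rightarrow> bool" where
  "self_adjoint_op H D T \<longleftrightarrow>
     subspace D \<and> D \<subseteq> H \<and> H \<subseteq> closure D \<and> T ` D \<subseteq> H \<and>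
     (\<forall>x\<in>D. \<forall>y\<in>D. T (x + y) = T x + T y) \<and> (\<forall>x\<in>D. \<forall>c. T (c *\<^sub>R x) = c *\<^sub>R T x) \<and>
     (\<forall>v\<in>H. \<forall>w\<in>H. (\<forall>x\<in>D. inner (T x) v = inner x w) \<longleftrightarrow> v \<in> D \<and> w = T v)"

definition positive_definite_op :: "'h::real_inner set \<Rightarrow> ('h \<Rightarrow> 'h) \<Rightarrow> bool" where
  "positive_definite_op D T \<longleftrightarrow> (\<forall>v\<in>D. v \<noteq> 0 \<longrightarrow> 0 < inner (T v) v)"

definition eigenvalue_op :: "'h::real_inner set \<Rightarrow> ('h \<Rightarrow> 'h) \<Rightarrow> real \<Rightarrow> bool" where
  "eigenvalue_op D T \<mu> \<longleftrightarrow> (\<exists>v\<in>D. v \<noteq> 0 \<and> T v = \<mu> *\<^sub>R v)"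

definition smallest_eigenvalue_op :: "'h::real_inner set \<Rightarrow> ('h \<Rightarrow> 'h) \<Rightarrow> real \<Rightarrow> bool" where
  "smallest_eigenvalue_op D T \<mu> \<longleftrightarrow>
     eigenvalue_op D T \<mu> \<and> (\<forall>\<nu>. eigenvalue_op D T \<nu> \<longrightarrow> \<mu> \<le> \<nu>)"

text \<open>
  \<open>(DS, S)\<close> is the nonnegative self-adjoint square root of \<open>(D, T)\<close>, which determines
  \<open>S\<close> on \<open>DS\<close> uniquely; the domain of the composition \<open>S \<circ> S\<close> has to be exactly \<open>D\<close>.
\<close>

definition sqrt_op ::
  "'h::real_inner set \<Rightarrow> 'h set \<Rightarrow> ('h \<Rightarrow> 'h) \<Rightarrow> 'h set \<Rightarrow> ('h \<Rightarrow> 'h) \<Rightarrow> bool" where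
  "sqrt_op H D T DS S \<longleftrightarrow>
     self_adjoint_op H DS S \<and> (\<forall>v\<in>DS. 0 \<le> inner (S v) v) \<and>
     D = {v \<in> DS. S v \<in> DS} \<and> (\<forall>v\<in>D. S (S v) = T v)"

text \<open>The standing assumptions; \<open>(DS, S)\<close> is the square root of the Dirichlet Laplacian.\<close>

definition dirichlet_setting ::
  "'a::euclidean_space set \<Rightarrow> 'a L2 set \<Rightarrow> ('a L2 \<Rightarrow> 'a L2) \<Rightarrow> real \<Rightarrow> bool" where
  "dirichlet_setting \<Omega> DS S lam1 \<longleftrightarrow>
     bounded_domain \<Omega> \<and>
     self_adjoint_op (L2_on \<Omega>) (H2 \<Omega> \<inter> H10 \<Omega>) (neg_laplacian \<Omega>) \<and>
     positive_definite_op (H2 \<Omega> \<inter> H10 \<Omega>) (neg_laplacian \<Omega>) \<and>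
     smallest_eigenvalue_op (H2 \<Omega> \<inter> H10 \<Omega>) (neg_laplacian \<Omega>) lam1 \<and>
     sqrt_op (L2_on \<Omega>) (H2 \<Omega> \<inter> H10 \<Omega>) (neg_laplacian \<Omega>) DS S"


section \<open>The damped wave equation\<close>

text \<open>The \<open>k\<close>-th time derivative in the \<open>L2\<close> norm, one-sided at \<open>t = 0\<close>.\<close>

definition tderiv :: "nat \<Rightarrow> (real \<Rightarrow> 'h::real_normed_vector) \<Rightarrow> real \<Rightarrow> 'h" where
  "tderiv k = ((\<lambda>f t. vector_derivative f (at t within {0..})) ^^ k)"

definition H1_continuous_at ::
  "'a::euclidean_space set \<Rightarrow> (real \<Rightarrow> 'a L2) \<Rightarrow> real \<Rightarrow> bool" where
  "H1_continuous_at \<Omega> f t \<longleftrightarrow> ((\<lambda>s. H1_norm \<Omega> (f s - f t)) \<longlongrightarrow> 0) (at t within {0..})"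

definition has_H1_deriv_at ::
  "'a::euclidean_space set \<Rightarrow> (real \<Rightarrow> 'a L2) \<Rightarrow> 'a L2 \<Rightarrow> real \<Rightarrow> bool" where
  "has_H1_deriv_at \<Omega> f f' t \<longleftrightarrow>
     ((\<lambda>s. H1_norm \<Omega> ((f s - f t) /\<^sub>R (s - t) - f')) \<longlongrightarrow> 0) (at t within {0..})"

text \<open>
  Regularity in time needed for the energy of order \<open>k\<close> and for the equation differentiated
  up to the order that contains the time derivative of order \<open>k + 1\<close>. Derivatives of order
  \<open>j < k\<close> are continuous up to \<open>t = 0\<close> with values in \<open>H10\<close>, the one of order \<open>k\<close> is
  continuous up to \<open>t = 0\<close> only with values in \<open>L2\<close>.
\<close>

definition time_regular ::
  "'a::euclidean_space set \<Rightarrow> nat \<Rightarrow> (real \<Rightarrow> 'a L2) \<Rightarrow> bool" where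
  "time_regular \<Omega> k u \<longleftrightarrow>
     (\<forall>j<k. \<forall>t\<ge>0. tderiv j u t \<in> H10 \<Omega> \<and> H1_continuous_at \<Omega> (tderiv j u) t \<and>
        (tderiv j u has_vector_derivative tderiv (Suc j) u t) (at t within {0..})) \<and>
     (\<forall>j<k. \<forall>t>0. has_H1_deriv_at \<Omega> (tderiv j u) (tderiv (Suc j) u t) t) \<and>
     continuous_on {0..} (tderiv k u) \<and>
     (\<forall>t>0. tderiv k u t \<in> H10 \<Omega> \<and>
        (tderiv k u has_vector_derivative tderiv (Suc k) u t) (at t within {0..}))"

text \<open>
  The conjunct \<open>j = 1\<close> is the variational equation itself, the others are its time
  derivatives. For \<open>k \<ge> 2\<close> the values \<open>tderiv j u 0\<close> with \<open>2 \<le> j \<le> k\<close> satisfy the equation at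
  \<open>t = 0\<close> by continuity.
\<close>

definition variational_solution ::
  "'a::euclidean_space set \<Rightarrow> ('a L2 \<Rightarrow> 'a L2) \<Rightarrow> real \<Rightarrow> real \<Rightarrow> nat \<Rightarrow>
   'a L2 \<Rightarrow> 'a L2 \<Rightarrow> (real \<Rightarrow> 'a L2) \<Rightarrow> bool" where
  "variational_solution \<Omega> S \<alpha> \<beta> k u0 u1 u \<longleftrightarrow>
     time_regular \<Omega> k u \<and> u 0 = u0 \<and> tderiv 1 u 0 = u1 \<and>
     (\<forall>j\<in>{1..k}. \<forall>t>0. \<forall>v\<in>H10 \<Omega>.
        inner (tderiv (j + 1) u t) v + \<beta> * inner (S (tderiv j u t)) (S v)
        + \<alpha> * inner (tderiv j u t) v + inner (S (tderiv (j - 1) u t)) (S v) = 0)"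

definition energy :: "('h::real_normed_vector \<Rightarrow> 'h) \<Rightarrow> nat \<Rightarrow> (real \<Rightarrow> 'h) \<Rightarrow> real \<Rightarrow> real" where
  "energy S k u t = ((norm (tderiv k u t))\<^sup>2 + (norm (S (tderiv (k - 1) u t)))\<^sup>2) / 2"

end

theory Submission
  imports Defs
begin

text \<open>
  The function \<open>w t = exp (\<delta> * t) *\<^sub>R u t\<close> solves a damped wave equation whose natural energy does not
  increase as long as \<open>\<delta> \<le> (\<alpha> + \<beta> * lam1) / 2\<close>, by the Poincare inequality with constant
  \<open>lam1\<close>. This energy controls that of \<open>u\<close> when \<open>\<delta> \<le> lam1 / (\<alpha> + \<beta> * lam1)\<close> and
  \<open>\<beta> * \<delta> < 1\<close>. In the degenerate case \<open>\<alpha> = 0\<close>, \<open>\<beta> * \<delta> = 1\<close> the gradient term drops out and is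
  recovered from a correction built with the operator \<open>1 - lam1 * J\<close>, where \<open>J\<close> is the inverse
  of the Dirichlet Laplacian. So the whole energy decays at the largest admissible rate,
  and this gives (i) with a constant that is uniform in \<open>\<delta>\<close>, and (ii).

  That the smallest eigenvalue is the Poincare constant needs compactness of the embedding of
  \<open>H10\<close>, proved by averaging over small cubes. The same inequality, first on the domain of the
  Laplacian, lets one approximate each element of \<open>H10\<close> by elements of that domain with bounded
  Dirichlet energy, which places \<open>H10\<close> inside the domain of the square root.
\<close>

section \<open>Self-adjoint operators in a Hilbert space\<close>

text \<open>On a mode with eigenvalue \<open>\<mu> \<ge> lam1\<close> the equation of
  \<open>w\<close> has the potential \<open>(1 - \<beta> * \<delta>) * \<mu> - \<delta> * (\<alpha>
  - \<delta>)\<close>. At \<open>\<mu> = lam1\<close> the bound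
  \<open>\<delta> * (\<alpha> + \<beta> * lam1) \<le> lam1\<close> says exactly that this is at
  least \<open>\<delta>\<^sup>2\<close>, so something positive is left even at equality. For large
  \<mu> a gradient term survives only if \<open>\<beta> * \<delta> < 1\<close>, which the same bound
  forces unless \<open>\<alpha> = 0\<close> and \<open>\<beta> * \<delta> = 1\<close>. There one
  would recover the gradient by testing with \<open>w\<close>, but this creates a growth term in
  \<open>w'\<close> that the damping cannot absorb on the lowest mode when
  \<open>\<delta> = \<beta> * lam1 / 2\<close>. Testing with \<open>(1 - lam1 * J) w\<close> removes
  that mode from the growth term. Smaller rates only change the exponential, so one constant serves
  every \<delta>, domain and order \<open>k\<close>. The square root \<open>S\<close> is given
  abstractly; that it is defined and bounded on \<open>H10\<close> has to be proved before
  \<open>S u\<close> can be differentiated.\<close>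

lemma square_le_if_quadratic_nonneg:
  fixes a b c :: real
  assumes "a \<ge> 0" "\<And>t. 0 \<le> a * t\<^sup>2 + 2 * b * t + c"
  shows "b\<^sup>2 \<le> a * c"
proof (cases "a = 0")
  case True
  have "b = 0"
  proof (rule ccontr)
    assume "b \<noteq> 0"
    \<comment> \<open>Without the square term the expression is affine in \<open>t\<close>, and at
      this point it equals -1.\<close>
    then show False
      using assms(2)[of "- (c + 1) / (2 * b)"] True by simp
  qed
  then show ?thesis using True by simp
next
  case False
  then show ?thesis
    using assms(1) assms(2)[of "- b / a"] by (simp add: field_simps power2_eq_square)
qed

lemma self_adjoint_opD:
  assumes "self_adjoint_op H D T"
  shows "subspace D" "D \<subseteq> H" "H \<subseteq> closure D"
    and "\<And>x. x \<in> D \<Longrightarrow> T x \<in> H"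
    and "\<And>x y. x \<in> D \<Longrightarrow> y \<in> D \<Longrightarrow> T (x + y) = T x + T y"
    and "\<And>x c. x \<in> D \<Longrightarrow> T (c *\<^sub>R x) = c *\<^sub>R T x"
  using assms unfolding self_adjoint_op_def by auto

lemma self_adjoint_op_diff:
  assumes T: "self_adjoint_op H D T" and "x \<in> D" "y \<in> D"
  shows "T (x - y) = T x - T y"
proof -
  have "T (x + (-1) *\<^sub>R y) = T x + (-1) *\<^sub>R T y"
    using self_adjoint_opD[OF T] assms(2,3) by (metis subspace_scale)
  then show ?thesis by simp
qed

lemma self_adjoint_op_sym:
  assumes T: "self_adjoint_op H D T" and "x \<in> D" "y \<in> D"
  shows "inner (T x) y = inner x (T y)"
  using assms self_adjoint_opD(2,4)[OF T] unfolding self_adjoint_op_def by blast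

text \<open>The nontrivial half of self-adjointness, used like elliptic regularity: a vector that
  solves \<open>T v = w\<close> only weakly, against all \<open>x\<close> in \<open>D\<close>, lies
  in the domain and solves it strongly.\<close>

lemma self_adjoint_op_domI:
  assumes "self_adjoint_op H D T" "v \<in> H" "w \<in> H"
    and "\<And>x. x \<in> D \<Longrightarrow> inner (T x) v = inner x w"
  shows "v \<in> D" "T v = w"
proof -
  have "\<forall>v\<in>H. \<forall>w\<in>H. (\<forall>x\<in>D. inner (T x) v = inner x w) \<longleftrightarrow> v \<in> D \<and> w = T v"
    using assms(1) unfolding self_adjoint_op_def by (elim conjE)
  with assms(2-4) have "v \<in> D \<and> w = T v" by metis
  then show "v \<in> D" "T v = w" by auto
qed

lemma self_adjoint_op_dense:
  assumes "self_adjoint_op H D T" "v \<in> H" "\<And>x. x \<in> D \<Longrightarrow> inner x v = 0"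
  shows "v = 0"
proof -
  have "v \<in> closure D" using self_adjoint_opD(3)[OF assms(1)] assms(2) by auto
  moreover have "closure D \<subseteq> {x. inner x v = 0}"
    using assms(3) by (intro closure_minimal closed_Collect_eq) (auto intro: continuous_intros)
  ultimately show ?thesis by auto
qed

lemma one_over_Suc_tendsto: "(\<lambda>n. c / real (Suc n)) \<longlonglongrightarrow> 0"
  using tendsto_mult[OF tendsto_const[of c] LIMSEQ_Suc[OF lim_1_over_n]]
  by (simp add: divide_inverse del: of_nat_Suc)

text \<open>The Rayleigh-Ritz argument: minimising \<open>inner (T x) x - 2 * l x\<close> solves
  \<open>inner (T x) y = l y\<close> weakly, with no completeness of \<open>D\<close> in the form norm required.\<close>

lemma weak_solution_sequence:
  assumes T: "self_adjoint_op H D T" and H: "complete H"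
    and lam: "lam > 0" and coercive: "\<And>x. x \<in> D \<Longrightarrow> lam * (norm x)\<^sup>2 \<le> inner (T x) x"
    and add: "\<And>x y. x \<in> D \<Longrightarrow> y \<in> D \<Longrightarrow> l (x + y) = l x + l y"
    and scale: "\<And>x r. x \<in> D \<Longrightarrow> l (r *\<^sub>R x) = r * l x"
    and bound: "\<And>x. x \<in> D \<Longrightarrow> (l x)\<^sup>2 \<le> c * inner (T x) x" and c: "c \<ge> 0"
  obtains X x where "\<And>n. X n \<in> D" "x \<in> H" "X \<longlonglongrightarrow> x"
    "\<And>y. y \<in> D \<Longrightarrow> inner x (T y) = l y"
    "\<And>m n. inner (T (X m - X n)) (X m - X n) \<le> 2 / Suc m + 2 / Suc n"
    "\<And>n. sqrt (inner (T (X n)) (X n)) \<le> sqrt c + 1 / sqrt (Suc n)"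
proof -
  note sD = self_adjoint_opD[OF T]
  define B where "B x y = inner (T x) y" for x y
  have B_add: "B (x + y) z = B x z + B y z" "B z (x + y) = B z x + B z y"
    and B_sc: "B (r *\<^sub>R x) z = r * B x z" "B z (r *\<^sub>R x) = r * B z x"
    if "x \<in> D" "y \<in> D" for x y z r
    using that sD by (auto simp: B_def inner_add)
  have B_sym: "B x y = B y x" if "x \<in> D" "y \<in> D" for x y
    using self_adjoint_op_sym[OF T that] by (simp add: B_def inner_commute)
  have B_nn: "B x x \<ge> 0" if "x \<in> D" for x
    using coercive[OF that] lam unfolding B_def
    by (meson less_eq_real_def mult_nonneg_nonneg order_trans zero_le_power2)
  define J where "J x = B x x - 2 * l x" for x
  have J_ge: "J x \<ge> - c" if x: "x \<in> D" for x
  proof -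
    have "\<bar>l x\<bar> \<le> sqrt (c * B x x)"
      using bound[OF x] by (metis B_def real_sqrt_abs real_sqrt_le_mono)
    also have "2 * \<dots> \<le> c + B x x"
      using arith_geo_mean_sqrt[OF c B_nn[OF x]] by simp
    finally show ?thesis unfolding J_def by (simp add: abs_le_iff)
  qed
  have "0 \<in> D" using sD(1) by (rule subspace_0)
  define m where "m = Inf (J ` D)"
  have m_le: "m \<le> J x" if "x \<in> D" for x
    unfolding m_def using that J_ge by (intro cInf_lower bdd_belowI[of _ "- c"]) auto
  have "\<exists>x\<in>D. J x < m + 1 / Suc n" for n
  proof -
    have "Inf (J ` D) < m + 1 / Suc n" unfolding m_def by simp
    from cInf_lessD[OF _ this] \<open>0 \<in> D\<close> show ?thesis by auto
  qed
  then obtain X where X: "\<And>n. X n \<in> D" "\<And>n. J (X n) < m + 1 / Suc n" by metis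
  \<comment> \<open>Parallelogram identity at the midpoint \<open>h\<close>: the linear parts cancel
    and \<open>J h \<ge> m\<close>, so two near-minimisers are close in the form norm.\<close>
  have cauchy: "B (X i - X j) (X i - X j) \<le> 2 / Suc i + 2 / Suc j" for i j
  proof -
    define h where "h = (1/2) *\<^sub>R (X i + X j)"
    have hD: "h \<in> D" unfolding h_def using X sD(1) by (simp add: subspace_add subspace_scale)
    have s: "X i + X j \<in> D" using X sD(1) by (simp add: subspace_add)
    have "B h h = (1/4) * B (X i + X j) (X i + X j)"
      unfolding h_def using B_sc[OF s s] hD
      by (simp add: B_def sD(6)[OF s])
    also have "B (X i + X j) (X i + X j) = B (X i) (X i) + 2 * B (X i) (X j) + B (X j) (X j)"
      using X s by (simp add: B_add B_sym[of "X j" "X i"])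
    finally have Bh: "4 * B h h = B (X i) (X i) + 2 * B (X i) (X j) + B (X j) (X j)" by simp
    have lh: "2 * l h = l (X i) + l (X j)" unfolding h_def using X s by (simp add: scale add)
    have "B (X i - X j) (X i - X j) = B (X i) (X i) - 2 * B (X i) (X j) + B (X j) (X j)"
      using X B_sym[of "X j" "X i"]
      by (simp add: B_def self_adjoint_op_diff[OF T] inner_diff)
    also have "\<dots> = 2 * J (X i) + 2 * J (X j) - 4 * J h"
      unfolding J_def using Bh lh by (simp add: algebra_simps)
    also have "\<dots> \<le> 2 / Suc i + 2 / Suc j"
      using X(2)[of i] X(2)[of j] m_le[OF hD] by simp
    finally show ?thesis .
  qed
  \<comment> \<open>\<open>X n\<close> minimises up to \<open>1 / Suc n\<close>, so a quadratic in
    \<open>t\<close> with this constant term is nonnegative; its discriminant bounds the first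
    variation.\<close>
  have near: "(B (X n) y - l y)\<^sup>2 \<le> B y y * (1 / Suc n)" if y: "y \<in> D" for n y
  proof (rule square_le_if_quadratic_nonneg)
    show "B y y \<ge> 0" using y by (rule B_nn)
    fix t :: real
    have ty: "t *\<^sub>R y \<in> D" using y sD(1) by (simp add: subspace_scale)
    then have "X n + t *\<^sub>R y \<in> D" using X sD(1) by (simp add: subspace_add)
    from m_le[OF this]
    have "m \<le> J (X n + t *\<^sub>R y)" .
    also have "\<dots> = J (X n) + 2 * (B (X n) y - l y) * t + B y y * t\<^sup>2"
      unfolding J_def using X(1)[of n] y ty \<open>X n + t *\<^sub>R y \<in> D\<close> B_sym[of "X n" y]
      by (simp add: B_add B_sc scale add algebra_simps power2_eq_square)
    finally show "0 \<le> B y y * t\<^sup>2 + 2 * (B (X n) y - l y) * t + 1 / Suc n"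
      using X(2)[of n] by simp
  qed
  have "Cauchy X"
  proof (rule CauchyI)
    fix e :: real assume "e > 0"
    have pos: "lam * e\<^sup>2 > 0" using lam \<open>e > 0\<close> by simp
    have "(\<lambda>n. 4 / real (Suc n)) \<longlonglongrightarrow> 0" by (rule one_over_Suc_tendsto)
    from order_tendstoD(2)[OF this pos] obtain N where N: "\<And>n. n \<ge> N \<Longrightarrow> 4 / Suc n < lam * e\<^sup>2"
      unfolding eventually_sequentially by blast
    show "\<exists>M. \<forall>m\<ge>M. \<forall>n\<ge>M. norm (X m - X n) < e"
    proof (intro exI allI impI)
      fix i j assume ij: "i \<ge> N" "j \<ge> N"
      have "lam * (norm (X i - X j))\<^sup>2 \<le> B (X i - X j) (X i - X j)"
        unfolding B_def using X sD(1) by (intro coercive) (simp add: subspace_diff)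
      also have "\<dots> < lam * e\<^sup>2" using cauchy[of i j] N[OF ij(1)] N[OF ij(2)] by simp
      finally have "(norm (X i - X j))\<^sup>2 < e\<^sup>2" using lam by simp
      then show "norm (X i - X j) < e" using \<open>e > 0\<close> by (simp add: power2_less_imp_less)
    qed
  qed
  then obtain x where x: "x \<in> H" "X \<longlonglongrightarrow> x"
    using H X(1) sD(2) unfolding complete_def by (meson subsetD)
  \<comment> \<open>By symmetry \<open>T\<close> sits on \<open>y\<close> before the limit is taken,
    so convergence in norm is enough.\<close>
  have "inner x (T y) = l y" if y: "y \<in> D" for y
  proof (rule LIMSEQ_unique)
    show "(\<lambda>n. inner (X n) (T y)) \<longlonglongrightarrow> inner x (T y)" using x by (intro tendsto_intros)
    have "(\<lambda>n. (B (X n) y - l y)\<^sup>2) \<longlonglongrightarrow> 0"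
    proof (rule tendsto_sandwich[OF _ _ tendsto_const])
      show "(\<lambda>n. B y y * (1 / Suc n)) \<longlonglongrightarrow> 0"
        using one_over_Suc_tendsto[of "B y y"] by simp
    qed (use near[OF y] in auto)
    then have "(\<lambda>n. sqrt ((B (X n) y - l y)\<^sup>2)) \<longlonglongrightarrow> sqrt 0" by (rule tendsto_real_sqrt)
    then have "(\<lambda>n. B (X n) y - l y) \<longlonglongrightarrow> 0" by (simp add: tendsto_rabs_zero_iff)
    then have "(\<lambda>n. B (X n) y) \<longlonglongrightarrow> l y" by (rule LIM_zero_cancel)
    then show "(\<lambda>n. inner (X n) (T y)) \<longlonglongrightarrow> l y"
      using self_adjoint_op_sym[OF T X(1) y] by (simp add: B_def)
  qed
  \<comment> \<open>With \<open>y = X n\<close> in \<open>near\<close>, \<open>b\<^sup>2\<close> is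
    at most \<open>b * (sqrt c + 1 / sqrt (Suc n))\<close>, and one factor \<open>b\<close>
    cancels.\<close>
  moreover have "sqrt (B (X n) (X n)) \<le> sqrt c + 1 / sqrt (Suc n)" for n
  proof -
    define b where "b = sqrt (B (X n) (X n))"
    have b: "b \<ge> 0" "b\<^sup>2 = B (X n) (X n)" using B_nn[OF X(1)[of n]] by (auto simp: b_def)
    have "\<bar>b\<^sup>2 - l (X n)\<bar> \<le> sqrt (B (X n) (X n) * (1 / Suc n))"
      using near[OF X(1)[of n], of n] b by (metis real_sqrt_abs real_sqrt_le_mono)
    also have "\<dots> = b * (1 / sqrt (Suc n))" by (simp add: b_def real_sqrt_mult real_sqrt_divide)
    finally have 1: "b\<^sup>2 - l (X n) \<le> b * (1 / sqrt (Suc n))" by simp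
    have "\<bar>l (X n)\<bar> \<le> sqrt (c * B (X n) (X n))"
      using bound[OF X(1)[of n]] by (metis B_def real_sqrt_abs real_sqrt_le_mono)
    also have "\<dots> = b * sqrt c" by (simp add: b_def real_sqrt_mult)
    finally have "b * b \<le> b * (sqrt c + 1 / sqrt (Suc n))"
      using 1 by (simp add: power2_eq_square distrib_left)
    then show ?thesis
      using b(1) c unfolding b_def[symmetric]
      by (cases "b = 0") (auto simp del: of_nat_Suc)
  qed
  ultimately show thesis using that[OF X(1) x] cauchy unfolding B_def by blast
qed

text \<open>The finitely many numbers \<open>inner v g\<close> determine \<open>v\<close> up to a
  small error. They are bounded, so rounding them to a grid of mesh \<eta> leaves finitely many
  cells; one representative of each nonempty cell is the centre of a ball.\<close>

lemma form_bounded_totally_bounded: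
  fixes W :: "'h::real_inner set"
  assumes comp: "\<And>e. e > 0 \<Longrightarrow> \<exists>G. finite G \<and>
      (\<forall>v\<in>W. \<forall>w\<in>W. (norm (v - w))\<^sup>2 \<le> e + (\<Sum>g\<in>G. (inner (v - w) g)\<^sup>2))"
    and bdd: "\<And>v. v \<in> W \<Longrightarrow> norm v \<le> 1" and e: "e > 0"
  shows "\<exists>k. finite k \<and> W \<subseteq> (\<Union>x\<in>k. ball x e)"
proof -
  obtain G where G: "finite G"
    "\<And>v w. v \<in> W \<Longrightarrow> w \<in> W \<Longrightarrow> (norm (v - w))\<^sup>2 \<le> e\<^sup>2 / 2 + (\<Sum>g\<in>G. (inner (v - w) g)\<^sup>2)"
    using comp[of "e\<^sup>2 / 2"] e by auto
  \<comment> \<open>Mesh with \<open>card G * \<eta>\<^sup>2 < e\<^sup>2 / 2\<close>, the other half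
    being spent in the choice of \<open>G\<close>; the \<open>+ 1\<close> covers empty
    \<open>G\<close>.\<close>
  define \<eta> where "\<eta> = e / (2 * (card G + 1))"
  have \<eta>: "\<eta> > 0" using e by (simp add: \<eta>_def)
  define cell where "cell v = (\<lambda>g\<in>G. \<lfloor>inner v g / \<eta>\<rfloor>)" for v
  have "finite (cell ` W)"
  proof (rule finite_subset)
    show "cell ` W \<subseteq> PiE G (\<lambda>g. {\<lfloor>- norm g / \<eta>\<rfloor> .. \<lfloor>norm g / \<eta>\<rfloor>})"
    proof (clarsimp simp: cell_def)
      fix v g assume "v \<in> W" "g \<in> G"
      have "\<bar>inner v g\<bar> \<le> norm v * norm g" by (rule Cauchy_Schwarz_ineq2)
      also have "\<dots> \<le> norm g" using bdd[OF \<open>v \<in> W\<close>] by (simp add: mult_left_le_one_le)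
      finally have "\<bar>inner v g\<bar> \<le> norm g" .
      then show "\<lfloor>- (norm g / \<eta>)\<rfloor> \<le> \<lfloor>inner v g / \<eta>\<rfloor> \<and> \<lfloor>inner v g / \<eta>\<rfloor> \<le> \<lfloor>norm g / \<eta>\<rfloor>"
        using \<eta> by (auto intro!: floor_mono simp: field_simps abs_le_iff)
    qed
    show "finite (PiE G (\<lambda>g. {\<lfloor>- norm g / \<eta>\<rfloor> .. \<lfloor>norm g / \<eta>\<rfloor>}))"
      using G(1) by (intro finite_PiE) auto
  qed
  define rep where "rep c = (SOME v. v \<in> W \<and> cell v = c)" for c
  have rep: "rep (cell v) \<in> W \<and> cell (rep (cell v)) = cell v" if "v \<in> W" for v
    unfolding rep_def using that by (intro someI_ex[of "\<lambda>w. w \<in> W \<and> cell w = cell v"]) auto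
  have "v \<in> ball (rep (cell v)) e" if v: "v \<in> W" for v
  proof -
    let ?w = "rep (cell v)"
    have "(inner (?w - v) g)\<^sup>2 \<le> \<eta>\<^sup>2" if g: "g \<in> G" for g
    proof -
      have "\<lfloor>inner ?w g / \<eta>\<rfloor> = \<lfloor>inner v g / \<eta>\<rfloor>"
        using rep[OF v] g by (metis (mono_tags, lifting) cell_def restrict_apply')
      then have "\<bar>inner ?w g / \<eta> - inner v g / \<eta>\<bar> < 1" by linarith
      then have "\<bar>inner ?w g - inner v g\<bar> < \<eta>"
        using \<eta> by (simp add: diff_divide_distrib[symmetric])
      then show ?thesis using \<eta> by (simp add: inner_diff abs_le_square_iff[symmetric])
    qed
    then have "(\<Sum>g\<in>G. (inner (?w - v) g)\<^sup>2) \<le> card G * \<eta>\<^sup>2"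
      by (rule sum_bounded_above)
    also have "\<dots> < e\<^sup>2 / 2"
    proof -
      have "real (card G) * 2 < (2 * (real (card G) + 1))\<^sup>2"
        by (simp add: power2_eq_square algebra_simps add_pos_nonneg)
      moreover have "(2 * (real (card G) + 1))\<^sup>2 > 0" by simp
      ultimately have "real (card G) / (2 * (real (card G) + 1))\<^sup>2 < 1 / 2"
        by (simp add: field_simps)
      then have "e\<^sup>2 * (real (card G) / (2 * (real (card G) + 1))\<^sup>2) < e\<^sup>2 * (1 / 2)"
        using e by (intro mult_strict_left_mono) auto
      then show ?thesis by (simp add: \<eta>_def power_divide mult_ac add.commute)
    qed
    finally have "(norm (?w - v))\<^sup>2 < e\<^sup>2" using G(2)[of ?w v] rep[OF v] v by simp
    then show ?thesis using e by (simp add: dist_norm power2_less_imp_less)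
  qed
  then show ?thesis using \<open>finite (cell ` W)\<close>
    by (intro exI[of _ "rep ` cell ` W"]) fastforce
qed

text \<open>The hypothesis \<open>comp\<close> is a quantitative form of the compactness of the embedding of the
  form domain. It makes a minimising sequence of the Rayleigh quotient totally bounded, so
  that the infimum is attained at an eigenvector.\<close>

lemma rayleigh_lower_bound:
  assumes T: "self_adjoint_op H D T" and H: "complete H"
    and nonneg: "\<And>v. v \<in> D \<Longrightarrow> 0 \<le> inner (T v) v"
    and comp: "\<And>e. e > 0 \<Longrightarrow> \<exists>G. finite G \<and>
      (\<forall>v\<in>D. (norm v)\<^sup>2 \<le> e * inner (T v) v + (\<Sum>g\<in>G. (inner v g)\<^sup>2))"
    and eig: "\<And>\<nu>. eigenvalue_op D T \<nu> \<Longrightarrow> lam \<le> \<nu>"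
    and v: "v \<in> D"
  shows "lam * (norm v)\<^sup>2 \<le> inner (T v) v"
proof (cases "v = 0")
  case True
  then show ?thesis using nonneg[OF v] by simp
next
  case False
  note sD = self_adjoint_opD[OF T]
  define U where "U = {x \<in> D. norm x = 1}"
  define \<mu> where "\<mu> = Inf ((\<lambda>x. inner (T x) x) ` U)"
  have \<mu>_le1: "\<mu> \<le> inner (T x) x" if "x \<in> U" for x
    unfolding \<mu>_def using that nonneg
    by (intro cInf_lower bdd_belowI[of _ 0]) (auto simp: U_def)
  have \<mu>_le: "\<mu> * (norm x)\<^sup>2 \<le> inner (T x) x" if x: "x \<in> D" for x
  proof (cases "x = 0")
    case True
    then show ?thesis using nonneg[OF x] by simp
  next
    case False
    have "(1 / norm x) *\<^sub>R x \<in> U" unfolding U_def using False x sD(1) by (simp add: subspace_scale)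
    from \<mu>_le1[OF this] have "\<mu> \<le> inner (T x) x / (norm x)\<^sup>2"
      using x sD(6) by (simp add: power2_eq_square)
    then show ?thesis using False by (simp add: field_simps)
  qed
  have "(1 / norm v) *\<^sub>R v \<in> U" unfolding U_def using False v sD(1) by (simp add: subspace_scale)
  then have "U \<noteq> {}" by auto
  have "\<exists>x\<in>U. inner (T x) x < \<mu> + 1 / Suc n" for n
  proof -
    have "Inf ((\<lambda>x. inner (T x) x) ` U) < \<mu> + 1 / Suc n" unfolding \<mu>_def by simp
    from cInf_lessD[OF _ this] \<open>U \<noteq> {}\<close> show ?thesis by auto
  qed
  then obtain X where X: "\<And>n. X n \<in> U" "\<And>n. inner (T (X n)) (X n) < \<mu> + 1 / Suc n" by metis
  have XD: "X n \<in> D" and Xn: "norm (X n) = 1" for n using X by (auto simp: U_def)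
  have \<mu>0: "\<mu> \<ge> 0" unfolding \<mu>_def using \<open>U \<noteq> {}\<close> nonneg by (intro cInf_greatest) (auto simp: U_def)
  \<comment> \<open>The form of the sum is nonnegative, so that of the difference is at most twice
    the sum of the two forms. This bound decides which \<open>e\<close> is passed to
    \<open>comp\<close>.\<close>
  have form_diff: "inner (T (X i - X j)) (X i - X j) \<le> 4 * (\<mu> + 1)" for i j
  proof -
    have "0 \<le> inner (T (X i + X j)) (X i + X j)"
      using XD sD(1) by (intro nonneg) (simp add: subspace_add)
    then have "inner (T (X i - X j)) (X i - X j) \<le> 2 * inner (T (X i)) (X i) + 2 * inner (T (X j)) (X j)"
      using XD sD by (simp add: self_adjoint_op_diff[OF T] inner_diff inner_add)
    also have "\<dots> \<le> 2 * (\<mu> + 1) + 2 * (\<mu> + 1)"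
    proof -
      have "1 / real (Suc n) \<le> 1" for n by simp
      then show ?thesis using X(2)[of i] X(2)[of j] by (smt (verit))
    qed
    finally show ?thesis by simp
  qed
  have tb: "\<exists>k. finite k \<and> range X \<subseteq> (\<Union>x\<in>k. ball x e)" if "e > 0" for e
  proof (rule form_bounded_totally_bounded[OF _ _ that])
    fix e :: real assume e: "e > 0"
    obtain G where G: "finite G"
      "\<And>v. v \<in> D \<Longrightarrow> (norm v)\<^sup>2 \<le> e / (4 * (\<mu> + 1)) * inner (T v) v + (\<Sum>g\<in>G. (inner v g)\<^sup>2)"
      using comp[of "e / (4 * (\<mu> + 1))"] e \<mu>0 by auto
    have "(norm (X i - X j))\<^sup>2 \<le> e + (\<Sum>g\<in>G. (inner (X i - X j) g)\<^sup>2)" for i j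
    proof -
      have "e / (4 * (\<mu> + 1)) * inner (T (X i - X j)) (X i - X j) \<le> e / (4 * (\<mu> + 1)) * (4 * (\<mu> + 1))"
        using form_diff e \<mu>0 by (intro mult_left_mono) auto
      also have "\<dots> = e" using \<mu>0 by simp
      finally show ?thesis using G(2)[of "X i - X j"] XD sD(1) by (simp add: subspace_diff)
    qed
    then show "\<exists>G. finite G \<and>
       (\<forall>v\<in>range X. \<forall>w\<in>range X. (norm (v - w))\<^sup>2 \<le> e + (\<Sum>g\<in>G. (inner (v - w) g)\<^sup>2))"
      using G(1) by auto
  qed (use Xn in auto)
  have "\<exists>r x. strict_mono r \<and> x \<in> H \<and> (X \<circ> r) \<longlonglongrightarrow> x"
  proof -
    have cl: "closed H" using H by (rule complete_imp_closed)
    have sub: "closure (range X) \<subseteq> H" using XD sD(2) cl by (intro closure_minimal) auto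
    have "compact (closure (range X))"
      unfolding compact_eq_totally_bounded
    proof (intro conjI allI impI)
      show "complete (closure (range X))"
        using complete_closed_subset[OF closed_closure sub H] .
      fix e :: real assume e: "e > 0"
      then obtain k where k: "finite k" "range X \<subseteq> (\<Union>x\<in>k. ball x (e/2))" using tb[of "e/2"] by auto
      have "closure (range X) \<subseteq> (\<Union>x\<in>k. cball x (e/2))"
      proof (intro closure_minimal closed_UN k(1) ballI closed_cball)
        show "range X \<subseteq> (\<Union>x\<in>k. cball x (e/2))"
          by (rule order_trans[OF k(2)]) (intro UN_mono order_refl ball_subset_cball)
      qed
      also have "\<dots> \<subseteq> (\<Union>x\<in>k. ball x e)" using e by (intro UN_mono) auto
      finally show "\<exists>k. finite k \<and> closure (range X) \<subseteq> (\<Union>x\<in>k. ball x e)" using k(1) by blast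
    qed
    then have "\<exists>l\<in>closure (range X). \<exists>r. strict_mono r \<and> (X \<circ> r) \<longlonglongrightarrow> l"
      unfolding compact_def using closure_subset by (metis rangeI subsetD)
    then show ?thesis using sub by blast
  qed
  then obtain r x where rx: "strict_mono r" "x \<in> H" "(X \<circ> r) \<longlonglongrightarrow> x" by blast
  have "norm x = 1"
    using tendsto_norm[OF rx(3)] Xn by (simp add: LIMSEQ_const_iff)
  have weak: "inner (T y) x = inner y (\<mu> *\<^sub>R x)" if y: "y \<in> D" for y
  proof -
    \<comment> \<open>\<open>q\<close> is the form of \<open>T - \<mu>\<close>. It is nonnegative on
      \<open>D\<close> and at most \<open>1 / Suc n\<close> at \<open>X n\<close>, so the
      discriminant makes \<open>T y - \<mu> *\<^sub>R y\<close> asymptotically orthogonal to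
      \<open>X n\<close>.\<close>
    define q where "q z = inner (T z) z - \<mu> * (norm z)\<^sup>2" for z
    have near: "(inner (T y - \<mu> *\<^sub>R y) (X n))\<^sup>2 \<le> q y * (1 / Suc n)" for n
    proof (rule square_le_if_quadratic_nonneg)
      show "q y \<ge> 0" unfolding q_def using \<mu>_le[OF y] by simp
      fix t :: real
      have ty: "t *\<^sub>R y \<in> D" using y sD(1) by (simp add: subspace_scale)
      then have D2: "X n + t *\<^sub>R y \<in> D" using XD sD(1) by (simp add: subspace_add)
      from \<mu>_le[OF this]
      have "0 \<le> q (X n + t *\<^sub>R y)" by (simp add: q_def)
      also have "\<dots> = q (X n) + 2 * inner (T y - \<mu> *\<^sub>R y) (X n) * t + q y * t\<^sup>2"
        unfolding q_def power2_norm_eq_inner using XD[of n] y ty self_adjoint_op_sym[OF T y XD[of n]]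
        by (simp add: sD inner_add inner_diff inner_commute algebra_simps power2_eq_square)
      also have "q (X n) \<le> 1 / Suc n" using X(2)[of n] Xn[of n] by (simp add: q_def)
      finally show "0 \<le> q y * t\<^sup>2 + 2 * inner (T y - \<mu> *\<^sub>R y) (X n) * t + 1 / Suc n" by simp
    qed
    have "(\<lambda>n. (inner (T y - \<mu> *\<^sub>R y) (X n))\<^sup>2) \<longlonglongrightarrow> 0"
    proof (rule tendsto_sandwich[OF _ _ tendsto_const])
      show "(\<lambda>n. q y * (1 / Suc n)) \<longlonglongrightarrow> 0"
        using one_over_Suc_tendsto[of "q y"] by simp
    qed (use near in auto)
    from LIMSEQ_subseq_LIMSEQ[OF this rx(1)]
    have "(\<lambda>n. (inner (T y - \<mu> *\<^sub>R y) ((X \<circ> r) n))\<^sup>2) \<longlonglongrightarrow> 0" by (simp add: o_def)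
    moreover have "(\<lambda>n. (inner (T y - \<mu> *\<^sub>R y) ((X \<circ> r) n))\<^sup>2) \<longlonglongrightarrow> (inner (T y - \<mu> *\<^sub>R y) x)\<^sup>2"
      using rx(3) by (intro tendsto_intros)
    ultimately have "(inner (T y - \<mu> *\<^sub>R y) x)\<^sup>2 = 0" by (metis LIMSEQ_unique)
    then show ?thesis by (simp add: inner_diff)
  qed
  have "\<mu> *\<^sub>R x \<in> H"
  proof -
    have "(\<lambda>n. \<mu> *\<^sub>R (X \<circ> r) n) \<longlonglongrightarrow> \<mu> *\<^sub>R x" using rx(3) by (intro tendsto_intros)
    moreover have "\<mu> *\<^sub>R (X \<circ> r) n \<in> H" for n
      using XD sD(1,2) by (auto simp: subspace_scale)
    ultimately show ?thesis
      using complete_imp_closed[OF H] by (metis closed_sequentially)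
  qed
  \<comment> \<open>The limit was taken in norm only; self-adjointness brings it back into
    \<open>D\<close>, as an eigenvector.\<close>
  from self_adjoint_op_domI[OF T rx(2) this weak]
  have "x \<in> D" "T x = \<mu> *\<^sub>R x" by auto
  then have "eigenvalue_op D T \<mu>"
    unfolding eigenvalue_op_def using \<open>norm x = 1\<close> by (metis norm_zero zero_neq_one)
  from eig[OF this] have "lam * (norm v)\<^sup>2 \<le> \<mu> * (norm v)\<^sup>2" by (intro mult_right_mono) auto
  then show ?thesis using \<mu>_le[OF v] by linarith
qed

text \<open>By coercivity the functional \<open>inner f\<close> is bounded in the form norm, so the
  minimising sequence converges to a weak solution, and self-adjointness makes it a strong
  one.\<close>

lemma self_adjoint_op_surj:
  assumes T: "self_adjoint_op H D T" and H: "complete H"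
    and lam: "lam > 0" and coercive: "\<And>x. x \<in> D \<Longrightarrow> lam * (norm x)\<^sup>2 \<le> inner (T x) x"
    and f: "f \<in> H"
  obtains x where "x \<in> D" "T x = f"
proof -
  have bound: "(inner f y)\<^sup>2 \<le> (norm f)\<^sup>2 / lam * inner (T y) y" if y: "y \<in> D" for y
  proof -
    have "(inner f y)\<^sup>2 \<le> (norm f)\<^sup>2 * (norm y)\<^sup>2"
      using Cauchy_Schwarz_ineq[of f y] by (simp add: power2_norm_eq_inner)
    also have "\<dots> = (norm f)\<^sup>2 / lam * (lam * (norm y)\<^sup>2)" using lam by simp
    also have "\<dots> \<le> (norm f)\<^sup>2 / lam * inner (T y) y"
      using coercive[OF y] lam by (intro mult_left_mono) auto
    finally show ?thesis .
  qed
  obtain x where x: "x \<in> H" "\<And>y. y \<in> D \<Longrightarrow> inner x (T y) = inner f y"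
  proof (rule weak_solution_sequence[OF T H lam coercive _ _ bound])
    show "0 \<le> (norm f)\<^sup>2 / lam" using lam by simp
  qed (auto simp: inner_add)
  have "x \<in> D" "T x = f"
    using self_adjoint_op_domI[OF T x(1) f] x(2) by (auto simp: inner_commute)
  then show thesis using that by blast
qed

lemma sqrt_op_norm:
  assumes S: "sqrt_op H D T DS S" and x: "x \<in> D"
  shows "(norm (S x))\<^sup>2 = inner (T x) x"
proof -
  have "self_adjoint_op H DS S" "x \<in> DS" "S x \<in> DS" "S (S x) = T x"
    using S x by (auto simp: sqrt_op_def)
  then show ?thesis
    using self_adjoint_op_sym[of H DS S "S x" x] by (simp add: power2_norm_eq_inner)
qed

text \<open>The minimising sequence for \<open>l y = inner (T y) v\<close> converges to a weak
  solution, which must be \<open>v\<close> by coercivity. Since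
  \<open>(norm (S z))\<^sup>2 = inner (T z) z\<close> on \<open>D\<close>, its images under
  \<open>S\<close> are Cauchy, and closedness of \<open>S\<close> puts \<open>v\<close> into
  \<open>DS\<close>. The last two conclusions are limits of the estimates along the
  sequence.\<close>

lemma sqrt_op_domI:
  assumes T: "self_adjoint_op H D T" and H: "complete H" "subspace H"
    and lam: "lam > 0" and coercive: "\<And>x. x \<in> D \<Longrightarrow> lam * (norm x)\<^sup>2 \<le> inner (T x) x"
    and S: "sqrt_op H D T DS S"
    and v: "v \<in> H" and q: "q \<ge> 0"
    and bound: "\<And>x. x \<in> D \<Longrightarrow> (inner (T x) v)\<^sup>2 \<le> q * inner (T x) x"
  shows "v \<in> DS" "(norm (S v))\<^sup>2 \<le> q" "lam * (norm v)\<^sup>2 \<le> (norm (S v))\<^sup>2"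
proof -
  note sD = self_adjoint_opD[OF T]
  have saS: "self_adjoint_op H DS S" and DDS: "D \<subseteq> DS" using S by (auto simp: sqrt_op_def)
  obtain X x where X: "\<And>n. X n \<in> D" "x \<in> H" "X \<longlonglongrightarrow> x"
    "\<And>y. y \<in> D \<Longrightarrow> inner x (T y) = inner (T y) v"
    "\<And>m n. inner (T (X m - X n)) (X m - X n) \<le> 2 / Suc m + 2 / Suc n"
    "\<And>n. sqrt (inner (T (X n)) (X n)) \<le> sqrt q + 1 / sqrt (Suc n)"
    using weak_solution_sequence[OF T H(1) lam coercive, of "\<lambda>y. inner (T y) v" q]
      bound q sD(5,6) by (auto simp: inner_add)
  have r: "x - v \<in> H" "0 \<in> H" using X(2) v H(2) by (auto simp: subspace_diff subspace_0)
  have "inner (T y) (x - v) = inner y 0" if "y \<in> D" for y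
    using X(4)[OF that] by (simp add: inner_diff inner_commute)
  from self_adjoint_op_domI[OF T r this] have "x - v \<in> D" "T (x - v) = 0" by auto
  then have "x = v" using coercive[of "x - v"] lam by (simp add: mult_le_0_iff)
  have nS: "(norm (S y))\<^sup>2 = inner (T y) y" if "y \<in> D" for y using sqrt_op_norm[OF S that] .
  have "Cauchy (\<lambda>n. S (X n))"
  proof (rule CauchyI)
    fix e :: real assume "e > 0"
    then have pos: "e\<^sup>2 > 0" by simp
    have "(\<lambda>n. 4 / real (Suc n)) \<longlonglongrightarrow> 0" by (rule one_over_Suc_tendsto)
    from order_tendstoD(2)[OF this pos] obtain N where N: "\<And>n. n \<ge> N \<Longrightarrow> 4 / Suc n < e\<^sup>2"
      unfolding eventually_sequentially by blast
    show "\<exists>M. \<forall>m\<ge>M. \<forall>n\<ge>M. norm (S (X m) - S (X n)) < e"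
    proof (intro exI allI impI)
      fix i j assume ij: "i \<ge> N" "j \<ge> N"
      have "(norm (S (X i) - S (X j)))\<^sup>2 = (norm (S (X i - X j)))\<^sup>2"
        using X(1) DDS by (subst self_adjoint_op_diff[OF saS]) auto
      also have "\<dots> = inner (T (X i - X j)) (X i - X j)"
        using X(1) sD(1) by (intro nS) (simp add: subspace_diff)
      also have "\<dots> < e\<^sup>2" using X(5)[of i j] N[OF ij(1)] N[OF ij(2)] by simp
      finally show "norm (S (X i) - S (X j)) < e" using \<open>e > 0\<close> by (simp add: power2_less_imp_less)
    qed
  qed
  moreover have "S (X n) \<in> H" for n using self_adjoint_opD(4)[OF saS] DDS X(1) by auto
  ultimately obtain w where w: "w \<in> H" "(\<lambda>n. S (X n)) \<longlonglongrightarrow> w"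
    using H(1) unfolding complete_def by meson
  \<comment> \<open>Closedness of \<open>S\<close>, read off from the graph of its adjoint.\<close>
  have "inner (S y) v = inner y w" if y: "y \<in> DS" for y
  proof (rule LIMSEQ_unique)
    show "(\<lambda>n. inner (S y) (X n)) \<longlonglongrightarrow> inner (S y) v"
      using X(3) \<open>x = v\<close> by (auto intro: tendsto_intros)
    have "inner (S y) (X n) = inner y (S (X n))" for n
      using self_adjoint_op_sym[OF saS y] X(1) DDS by auto
    then show "(\<lambda>n. inner (S y) (X n)) \<longlonglongrightarrow> inner y w"
      using w(2) by (auto intro: tendsto_intros)
  qed
  from self_adjoint_op_domI[OF saS v w(1) this] have vS: "v \<in> DS" and Sv: "S v = w" by auto
  from vS show "v \<in> DS" .
  have "norm w \<le> sqrt q"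
  proof (rule LIMSEQ_le)
    show "(\<lambda>n. norm (S (X n))) \<longlonglongrightarrow> norm w" using w(2) by (rule tendsto_norm)
    have "(\<lambda>n. sqrt q + sqrt (1 / Suc n)) \<longlonglongrightarrow> sqrt q + sqrt 0"
      by (intro tendsto_intros tendsto_real_sqrt one_over_Suc_tendsto)
    then show "(\<lambda>n. sqrt q + 1 / sqrt (Suc n)) \<longlonglongrightarrow> sqrt q" by (simp add: real_sqrt_divide)
    show "\<exists>N. \<forall>n\<ge>N. norm (S (X n)) \<le> sqrt q + 1 / sqrt (Suc n)"
      using X(6) nS[OF X(1)] by (metis norm_ge_zero real_sqrt_abs abs_of_nonneg)
  qed
  then have "(norm w)\<^sup>2 \<le> (sqrt q)\<^sup>2" by (intro power_mono) auto
  then show "(norm (S v))\<^sup>2 \<le> q" using q Sv by simp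
  have "lam * (norm v)\<^sup>2 \<le> (norm w)\<^sup>2"
  proof (rule LIMSEQ_le)
    show "(\<lambda>n. lam * (norm (X n))\<^sup>2) \<longlonglongrightarrow> lam * (norm v)\<^sup>2"
      using X(3) \<open>x = v\<close> by (auto intro!: tendsto_intros)
    show "(\<lambda>n. (norm (S (X n)))\<^sup>2) \<longlonglongrightarrow> (norm w)\<^sup>2" using w(2) by (intro tendsto_intros)
    show "\<exists>N. \<forall>n\<ge>N. lam * (norm (X n))\<^sup>2 \<le> (norm (S (X n)))\<^sup>2"
      using coercive[OF X(1)] nS[OF X(1)] by auto
  qed
  then show "lam * (norm v)\<^sup>2 \<le> (norm (S v))\<^sup>2" using Sv by simp
qed

section \<open>Energy decay along a damped trajectory\<close>

text \<open>The equation holds for \<open>t > 0\<close> only. Continuity at 0 lets the mean value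
  theorem start from the initial data.\<close>

lemma nonincreasing_from_zero:
  fixes f :: "real \<Rightarrow> real"
  assumes cont: "continuous_on {0..} f"
    and deriv: "\<And>t. t > 0 \<Longrightarrow> (f has_real_derivative f' t) (at t)"
    and le: "\<And>t. t > 0 \<Longrightarrow> f' t \<le> 0" and t: "t \<ge> 0"
  shows "f t \<le> f 0"
proof (cases "t = 0")
  case False
  then have "0 < t" using t by simp
  moreover have "continuous_on {0..t} f" using cont by (rule continuous_on_subset) auto
  ultimately obtain l z where "0 < z" "z < t" "(f has_real_derivative l) (at z)" "f t - f 0 = (t - 0) * l"
    using MVT[of 0 t f] deriv real_differentiable_def by blast
  moreover from this have "l \<le> 0" using DERIV_unique deriv le by metis
  ultimately show ?thesis using mult_nonneg_nonpos[of t l] t by simp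
qed simp

lemma exp_decay_from_zero:
  fixes f :: "real \<Rightarrow> real"
  assumes cont: "continuous_on {0..} f"
    and deriv: "\<And>t. t > 0 \<Longrightarrow> (f has_real_derivative f' t) (at t)"
    and le: "\<And>t. t > 0 \<Longrightarrow> f' t + c * f t \<le> 0" and t: "t \<ge> 0"
  shows "f t \<le> exp (- c * t) * f 0"
proof -
  have "exp (c * t) * f t \<le> exp (c * 0) * f 0"
  proof (rule nonincreasing_from_zero[where f' = "\<lambda>t. exp (c * t) * (f' t + c * f t)"])
    show "continuous_on {0..} (\<lambda>t. exp (c * t) * f t)" by (intro continuous_intros cont)
    show "((\<lambda>t. exp (c * t) * f t) has_real_derivative exp (c * t) * (f' t + c * f t)) (at t)"
      if "t > 0" for t
      using deriv[OF that] by (auto intro!: derivative_eq_intros simp: algebra_simps)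
  qed (use le t in \<open>auto simp: mult_le_0_iff\<close>)
  then have "exp (- (c * t)) * (exp (c * t) * f t) \<le> exp (- (c * t)) * f 0"
    by (intro mult_left_mono) auto
  moreover have "exp (- (c * t)) * (exp (c * t) * f t) = f t"
    by (simp add: mult.assoc[symmetric] exp_add[symmetric])
  ultimately show ?thesis by simp
qed

lemma has_real_derivative_inner:
  fixes f g :: "real \<Rightarrow> 'h::real_inner"
  assumes "(f has_vector_derivative f') (at t)" "(g has_vector_derivative g') (at t)"
  shows "((\<lambda>t. inner (f t) (g t)) has_real_derivative inner (f t) g' + inner f' (g t)) (at t)"
  using bounded_bilinear.has_vector_derivative[OF bounded_bilinear_inner assms]
  by (simp add: has_real_derivative_iff_has_vector_derivative)

lemma power2_norm_add_scaleR:
  fixes x y :: "'h::real_inner"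
  shows "(norm (x + c *\<^sub>R y))\<^sup>2 = inner x x + 2 * c * inner x y + c\<^sup>2 * inner y y"
  unfolding power2_norm_eq_inner
  by (simp add: inner_add inner_commute power2_eq_square algebra_simps)

text \<open>Difference quotient form, matching \<open>has_H1_deriv_at\<close>, so that the norm in
  it can be exchanged for another one.\<close>

lemma has_vector_derivative_iff_quotient:
  "(f has_vector_derivative D) (at t within A) \<longleftrightarrow>
    ((\<lambda>s. norm ((f s - f t) /\<^sub>R (s - t) - D)) \<longlongrightarrow> 0) (at t within A)"
proof -
  have "norm (f s - f t - (s - t) *\<^sub>R D) / norm (s - t) = norm ((f s - f t) /\<^sub>R (s - t) - D)"
    if "s \<noteq> t" for s
  proof -
    have "(f s - f t) /\<^sub>R (s - t) - D = (f s - f t - (s - t) *\<^sub>R D) /\<^sub>R (s - t)"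
      using that by (simp add: scaleR_diff_right)
    then show ?thesis by (simp add: divide_inverse)
  qed
  then have "((\<lambda>s. norm (f s - f t - (s - t) *\<^sub>R D) / norm (s - t)) \<longlongrightarrow> 0) (at t within A) \<longleftrightarrow>
      ((\<lambda>s. norm ((f s - f t) /\<^sub>R (s - t) - D)) \<longlongrightarrow> 0) (at t within A)"
    by (intro filterlim_cong refl) (simp add: eventually_at_filter)
  then show ?thesis
    by (simp add: has_vector_derivative_def has_derivative_iff_norm bounded_linear_scaleR_left)
qed

text \<open>An operator bounded by \<open>n\<close> turns differentiability measured by
  \<open>n\<close> into differentiability in norm. It serves for \<open>S\<close> with the H1 norm
  and for \<open>J\<close> with the norm itself.\<close>

lemma has_vector_derivative_linear_on:
  assumes V: "subspace V"
    and add: "\<And>v w. v \<in> V \<Longrightarrow> w \<in> V \<Longrightarrow> L (v + w) = L v + L w"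
    and scale: "\<And>v c. v \<in> V \<Longrightarrow> L (c *\<^sub>R v) = c *\<^sub>R L v"
    and bound: "\<And>v. v \<in> V \<Longrightarrow> norm (L v) \<le> c * n v"
    and fV: "\<forall>\<^sub>F s in at t. f s \<in> V" "f t \<in> V" "D \<in> V"
    and lim: "((\<lambda>s. n ((f s - f t) /\<^sub>R (s - t) - D)) \<longlongrightarrow> 0) (at t)"
  shows "((\<lambda>s. L (f s)) has_vector_derivative L D) (at t)"
  unfolding has_vector_derivative_iff_quotient
proof (rule Lim_null_comparison)
  have diff: "L (v - w) = L v - L w" if "v \<in> V" "w \<in> V" for v w
    using add[of v "(-1) *\<^sub>R w"] scale[of w "-1"] that V by (simp add: subspace_neg)
  show "\<forall>\<^sub>F s in at t. norm (norm ((L (f s) - L (f t)) /\<^sub>R (s - t) - L D))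
      \<le> c * n ((f s - f t) /\<^sub>R (s - t) - D)"
    using fV(1)
  proof eventually_elim
    case (elim s)
    then have "f s - f t \<in> V" "(f s - f t) /\<^sub>R (s - t) \<in> V" "(f s - f t) /\<^sub>R (s - t) - D \<in> V"
      using fV V by (auto simp: subspace_diff subspace_scale)
    then show ?case
      using bound[of "(f s - f t) /\<^sub>R (s - t) - D"] elim fV by (simp add: diff scale)
  qed
  show "((\<lambda>s. c * n ((f s - f t) /\<^sub>R (s - t) - D)) \<longlongrightarrow> 0) (at t)"
    using tendsto_mult_right_zero[OF lim] .
qed

text \<open>\<open>J\<close> plays the role of the inverse of the operator \<open>A\<close> whose square root is \<open>S\<close>.\<close>

locale damped_trajectory =
  fixes V :: "'h::real_inner set" and S J :: "'h \<Rightarrow> 'h" and \<alpha> \<beta> lam :: real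
    and u u1 u2 :: "real \<Rightarrow> 'h"
  assumes lam: "lam > 0" and \<alpha>: "\<alpha> \<ge> 0" and \<beta>: "\<beta> \<ge> 0"
    and V: "subspace V"
    and S_add: "\<And>v w. v \<in> V \<Longrightarrow> w \<in> V \<Longrightarrow> S (v + w) = S v + S w"
    and S_scale: "\<And>v c. v \<in> V \<Longrightarrow> S (c *\<^sub>R v) = c *\<^sub>R S v"
    and poincare: "\<And>v. v \<in> V \<Longrightarrow> lam * (norm v)\<^sup>2 \<le> (norm (S v))\<^sup>2"
    and J_V: "\<And>v. v \<in> V \<Longrightarrow> J v \<in> V"
    and J_add: "\<And>v w. v \<in> V \<Longrightarrow> w \<in> V \<Longrightarrow> J (v + w) = J v + J w"
    and J_scale: "\<And>v c. v \<in> V \<Longrightarrow> J (c *\<^sub>R v) = c *\<^sub>R J v"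
    and J_inverse: "\<And>v w. v \<in> V \<Longrightarrow> w \<in> V \<Longrightarrow> inner (S (J v)) (S w) = inner v w"
    and u_V: "\<And>t. t \<ge> 0 \<Longrightarrow> u t \<in> V" and u1_V: "\<And>t. t > 0 \<Longrightarrow> u1 t \<in> V"
    and cont_u: "continuous_on {0..} u" and cont_Su: "continuous_on {0..} (\<lambda>t. S (u t))"
    and cont_u1: "continuous_on {0..} u1"
    and deriv_u: "\<And>t. t > 0 \<Longrightarrow> (u has_vector_derivative u1 t) (at t)"
    and deriv_Su: "\<And>t. t > 0 \<Longrightarrow> ((\<lambda>t. S (u t)) has_vector_derivative S (u1 t)) (at t)"
    and deriv_u1: "\<And>t. t > 0 \<Longrightarrow> (u1 has_vector_derivative u2 t) (at t)"
    and equation: "\<And>t v. t > 0 \<Longrightarrow> v \<in> V \<Longrightarrow>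
      inner (u2 t) v + \<beta> * inner (S (u1 t)) (S v) + \<alpha> * inner (u1 t) v + inner (S (u t)) (S v) = 0"
begin

section \<open>Energy quantities of a trajectory and their derivatives\<close>

definition "X t = inner (u1 t) (u1 t)"
definition "Y t = inner (S (u t)) (S (u t))"
definition "Z t = inner (u t) (u t)"
definition "M t = inner (u1 t) (u t)"

lemma nonneg: "X t \<ge> 0" "Y t \<ge> 0" "Z t \<ge> 0"
  by (auto simp: X_def Y_def Z_def)

lemma Z_le: "t \<ge> 0 \<Longrightarrow> lam * Z t \<le> Y t"
  using poincare[OF u_V] by (simp add: Z_def Y_def power2_norm_eq_inner)

lemma deriv_X: "t > 0 \<Longrightarrow> (X has_real_derivative
    - 2 * \<beta> * inner (S (u1 t)) (S (u1 t)) - 2 * \<alpha> * X t - 2 * inner (S (u1 t)) (S (u t))) (at t)"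
  and deriv_Y: "t > 0 \<Longrightarrow> (Y has_real_derivative 2 * inner (S (u1 t)) (S (u t))) (at t)"
  and deriv_Z: "t > 0 \<Longrightarrow> (Z has_real_derivative 2 * M t) (at t)"
  and deriv_M: "t > 0 \<Longrightarrow> (M has_real_derivative
    X t - \<beta> * inner (S (u1 t)) (S (u t)) - \<alpha> * M t - Y t) (at t)"
proof -
  assume t: "t > 0"
  note d = has_real_derivative_inner[OF deriv_u1[OF t] deriv_u1[OF t]]
    has_real_derivative_inner[OF deriv_Su[OF t] deriv_Su[OF t]]
    has_real_derivative_inner[OF deriv_u[OF t] deriv_u[OF t]]
    has_real_derivative_inner[OF deriv_u1[OF t] deriv_u[OF t]]
  \<comment> \<open>Testing with \<open>u1 t\<close> gives the derivative of \<open>X\<close>,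
    testing with \<open>u t\<close> that of \<open>M\<close>.\<close>
  note e = equation[OF t u1_V[OF t]] equation[OF t u_V, of t] t
  show "(X has_real_derivative
    - 2 * \<beta> * inner (S (u1 t)) (S (u1 t)) - 2 * \<alpha> * X t - 2 * inner (S (u1 t)) (S (u t))) (at t)"
    unfolding X_def[abs_def] by (rule DERIV_cong[OF d(1)]) (use e in \<open>simp add: inner_commute\<close>)
  show "(Y has_real_derivative 2 * inner (S (u1 t)) (S (u t))) (at t)"
    unfolding Y_def[abs_def] by (rule DERIV_cong[OF d(2)]) (simp add: inner_commute)
  show "(Z has_real_derivative 2 * M t) (at t)"
    unfolding Z_def[abs_def] M_def by (rule DERIV_cong[OF d(3)]) (simp add: inner_commute)
  show "(M has_real_derivative X t - \<beta> * inner (S (u1 t)) (S (u t)) - \<alpha> * M t - Y t) (at t)"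
    unfolding M_def[abs_def] X_def Y_def
    by (rule DERIV_cong[OF d(4)]) (use e in \<open>simp add: inner_commute\<close>)
qed

lemma cont_XYZM:
  "continuous_on {0..} X" "continuous_on {0..} Y" "continuous_on {0..} Z" "continuous_on {0..} M"
  unfolding X_def[abs_def] Y_def[abs_def] Z_def[abs_def] M_def[abs_def]
  by (intro continuous_intros cont_u cont_u1 cont_Su)+

text \<open>The energy of \<open>w t = exp (\<delta> * t) *\<^sub>R u t\<close>, up to the factor \<open>exp (2 * \<delta> * t)\<close>: \<open>w\<close> solves
  \<open>w'' + (\<alpha> - 2 * \<delta>) w' + \<beta> A w' + (1 - \<beta> * \<delta>) A w - \<delta> * (\<alpha> - \<delta>) w = 0\<close>.\<close>

definition "W \<delta> t = (norm (u1 t + \<delta> *\<^sub>R u t))\<^sup>2"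
definition "\<Phi> \<delta> t = W \<delta> t + (1 - \<beta> * \<delta>) * Y t - \<delta> * (\<alpha> - \<delta>) * Z t"

lemma W_eq: "W \<delta> t = X t + 2 * \<delta> * M t + \<delta>\<^sup>2 * Z t"
  by (simp add: W_def X_def M_def Z_def power2_norm_add_scaleR)

lemma W_nonneg: "W \<delta> t \<ge> 0"
  by (simp add: W_def)

text \<open>The right side minus the left side is the squared norm of
  \<open>u1 t + (2 * \<delta>) *\<^sub>R u t\<close>. The converse bound below comes from
  \<open>u1 t - \<delta> *\<^sub>R u t\<close> in the same way.\<close>

lemma X_le_W: "X t \<le> 2 * W \<delta> t + 2 * \<delta>\<^sup>2 * Z t"
proof -
  have "0 \<le> (norm (u1 t + (2 * \<delta>) *\<^sub>R u t))\<^sup>2" by simp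
  also have "\<dots> = X t + 4 * \<delta> * M t + 4 * \<delta>\<^sup>2 * Z t"
    by (simp add: X_def M_def Z_def power2_norm_add_scaleR power_mult_distrib)
  finally show ?thesis unfolding W_eq by (simp add: algebra_simps)
qed

lemma W_le_X: "W \<delta> t \<le> 2 * X t + 2 * \<delta>\<^sup>2 * Z t"
proof -
  have "0 \<le> (norm (u1 t + (- \<delta>) *\<^sub>R u t))\<^sup>2" by (rule zero_le_power2)
  also have "\<dots> = X t - 2 * \<delta> * M t + \<delta>\<^sup>2 * Z t"
    unfolding power2_norm_add_scaleR by (simp add: X_def M_def Z_def)
  finally show ?thesis unfolding W_eq by (simp add: algebra_simps)
qed

lemma S_shift: 
  assumes "t > 0"
  shows "u1 t + \<delta> *\<^sub>R u t \<in> V" "S (u1 t + \<delta> *\<^sub>R u t) = S (u1 t) + \<delta> *\<^sub>R S (u t)"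
  using assms u1_V[of t] u_V[of t] V by (auto simp: S_add S_scale subspace_add subspace_scale)

lemma cont_\<Phi>: "continuous_on {0..} (\<Phi> \<delta>)"
  unfolding \<Phi>_def[abs_def] W_eq by (intro continuous_intros cont_XYZM)

text \<open>Energy identity for \<open>w\<close>. Removing the weight
  \<open>exp (2 * \<delta> * t)\<close> produces the first term; the others are the dissipation of
  the damping operator \<open>\<beta> A + \<alpha> - 2 * \<delta>\<close> at
  \<open>w'\<close>.\<close>

lemma deriv_\<Phi>:
  assumes t: "t > 0"
  shows "(\<Phi> \<delta> has_real_derivative
    - 2 * \<delta> * \<Phi> \<delta> t - 2 * \<beta> * (norm (S (u1 t + \<delta> *\<^sub>R u t)))\<^sup>2 - 2 * (\<alpha> - 2 * \<delta>) * W \<delta> t) (at t)"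
proof -
  have "(\<Phi> \<delta> has_real_derivative
     (- 2 * \<beta> * inner (S (u1 t)) (S (u1 t)) - 2 * \<alpha> * X t - 2 * inner (S (u1 t)) (S (u t))) +
     2 * \<delta> * (X t - \<beta> * inner (S (u1 t)) (S (u t)) - \<alpha> * M t - Y t) + \<delta>\<^sup>2 * (2 * M t) +
     (1 - \<beta> * \<delta>) * (2 * inner (S (u1 t)) (S (u t))) - \<delta> * (\<alpha> - \<delta>) * (2 * M t)) (at t)"
    unfolding \<Phi>_def[abs_def] W_eq
    by (auto intro!: derivative_eq_intros deriv_X deriv_Y deriv_Z deriv_M t)
  then show ?thesis
  proof (rule DERIV_cong)
    have a: "(norm (S (u1 t + \<delta> *\<^sub>R u t)))\<^sup>2 =
        inner (S (u1 t)) (S (u1 t)) + 2 * \<delta> * inner (S (u1 t)) (S (u t)) + \<delta>\<^sup>2 * Y t"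
      unfolding S_shift(2)[OF t] power2_norm_eq_inner
      by (simp add: Y_def inner_add inner_commute power2_eq_square)
    show "(- 2 * \<beta> * inner (S (u1 t)) (S (u1 t)) - 2 * \<alpha> * X t - 2 * inner (S (u1 t)) (S (u t))) +
     2 * \<delta> * (X t - \<beta> * inner (S (u1 t)) (S (u t)) - \<alpha> * M t - Y t) + \<delta>\<^sup>2 * (2 * M t) +
     (1 - \<beta> * \<delta>) * (2 * inner (S (u1 t)) (S (u t))) - \<delta> * (\<alpha> - \<delta>) * (2 * M t) =
     - 2 * \<delta> * \<Phi> \<delta> t - 2 * \<beta> * (norm (S (u1 t + \<delta> *\<^sub>R u t)))\<^sup>2 - 2 * (\<alpha> - 2 * \<delta>) * W \<delta> t"
      unfolding a \<Phi>_def W_eq by (simp add: algebra_simps power2_eq_square)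
  qed
qed

lemma \<Phi>_decay:
  assumes \<delta>: "\<delta> \<le> (\<alpha> + \<beta> * lam) / 2" and t: "t \<ge> 0"
  shows "\<Phi> \<delta> t \<le> exp (- (2 * \<delta>) * t) * \<Phi> \<delta> 0"
proof (rule exp_decay_from_zero[OF cont_\<Phi> deriv_\<Phi> _ t])
  fix t :: real assume t: "t > 0"
  have "\<beta> * (lam * W \<delta> t) \<le> \<beta> * (norm (S (u1 t + \<delta> *\<^sub>R u t)))\<^sup>2"
    unfolding W_def by (intro mult_left_mono poincare S_shift t \<beta>)
  moreover have "0 \<le> (\<alpha> + \<beta> * lam - 2 * \<delta>) * W \<delta> t"
    using \<delta> W_nonneg by (intro mult_nonneg_nonneg) auto
  ultimately show "- 2 * \<delta> * \<Phi> \<delta> t - 2 * \<beta> * (norm (S (u1 t + \<delta> *\<^sub>R u t)))\<^sup>2 -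
      2 * (\<alpha> - 2 * \<delta>) * W \<delta> t + 2 * \<delta> * \<Phi> \<delta> t \<le> 0"
    by (simp add: algebra_simps)
qed

lemma \<Phi>_le:
  assumes t: "t \<ge> 0" and \<delta>: "\<delta> \<ge> 0"
  shows "\<Phi> \<delta> t \<le> (2 + 3 * \<delta>\<^sup>2 / lam) * (X t + Y t)"
proof -
  \<comment> \<open>Together with the two copies of \<open>\<delta>\<^sup>2 * Z t\<close> from
    \<open>W_le_X\<close> this makes the factor 3.\<close>
  have "- \<delta> * (\<alpha> - \<delta>) * Z t \<le> \<delta>\<^sup>2 * Z t"
    using \<delta> \<alpha> nonneg(3)[of t] by (intro mult_right_mono) (auto simp: algebra_simps power2_eq_square)
  moreover have "0 \<le> \<beta> * \<delta> * Y t" using \<beta> \<delta> nonneg by simp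
  ultimately have "\<Phi> \<delta> t \<le> 2 * X t + 3 * \<delta>\<^sup>2 * Z t + Y t"
    unfolding \<Phi>_def using W_le_X[of \<delta> t] by (simp add: algebra_simps)
  also have "3 * \<delta>\<^sup>2 * Z t \<le> 3 * \<delta>\<^sup>2 / lam * Y t"
  proof -
    have "3 * \<delta>\<^sup>2 / lam * (lam * Z t) \<le> 3 * \<delta>\<^sup>2 / lam * Y t"
      using Z_le[OF t] lam by (intro mult_left_mono) auto
    then show ?thesis using lam by simp
  qed
  also have "2 * X t + 3 * \<delta>\<^sup>2 / lam * Y t + Y t \<le> (2 + 3 * \<delta>\<^sup>2 / lam) * (X t + Y t)"
  proof -
    have "0 \<le> 3 * \<delta>\<^sup>2 / lam * X t" using lam nonneg by (intro mult_nonneg_nonneg) auto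
    then show ?thesis using nonneg[of t] by (simp add: distrib_left distrib_right)
  qed
  finally show ?thesis by simp
qed

text \<open>\<open>c\<close> is a coercivity constant for the potential part of \<Phi>. If
  \<open>\<alpha> \<le> \<delta>\<close>, the \<open>Z\<close> term has the favourable sign and
  \<open>1 - \<beta> * \<delta>\<close> serves. Otherwise \<open>Z\<close> is estimated by
  \<open>Y / lam\<close>, and the third bound on \<delta> leaves at least
  \<open>\<delta>\<^sup>2 / lam\<close>.\<close>

lemma energy_decay_nondegenerate:
  assumes \<delta>: "0 < \<delta>" "\<delta> \<le> (\<alpha> + \<beta> * lam) / 2" "\<delta> * (\<alpha> + \<beta> * lam) \<le> lam" and p: "\<beta> * \<delta> < 1"
    and t: "t \<ge> 0"
  defines "c \<equiv> min (1 - \<beta> * \<delta>) (\<delta>\<^sup>2 / lam)"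
  shows "X t + Y t \<le> (2 + (2 * \<delta>\<^sup>2 / lam + 1) / c) * (2 + 3 * \<delta>\<^sup>2 / lam) * exp (- (2 * \<delta>) * t) * (X 0 + Y 0)"
proof -
  have c: "c > 0" using p \<delta>(1) lam by (simp add: c_def)
  have "c * Y t \<le> (1 - \<beta> * \<delta>) * Y t - \<delta> * (\<alpha> - \<delta>) * Z t"
  proof (cases "\<alpha> \<le> \<delta>")
    case True
    have "c * Y t \<le> (1 - \<beta> * \<delta>) * Y t" using nonneg by (intro mult_right_mono) (auto simp: c_def)
    moreover have "\<delta> * (\<alpha> - \<delta>) * Z t \<le> 0"
      using True \<delta>(1) nonneg(3)[of t] by (simp add: mult_le_0_iff)
    ultimately show ?thesis by linarith
  next
    case False
    have "c * Y t \<le> (\<delta>\<^sup>2 / lam) * Y t" using nonneg by (intro mult_right_mono) (auto simp: c_def)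
    also have "\<dots> \<le> (1 - \<beta> * \<delta> - \<delta> * (\<alpha> - \<delta>) / lam) * Y t"
      using \<delta>(3) lam nonneg by (intro mult_right_mono) (auto simp: field_simps power2_eq_square)
    also have "\<dots> \<le> (1 - \<beta> * \<delta>) * Y t - \<delta> * (\<alpha> - \<delta>) * Z t"
    proof -
      have "\<delta> * (\<alpha> - \<delta>) / lam * (lam * Z t) \<le> \<delta> * (\<alpha> - \<delta>) / lam * Y t"
        using Z_le[OF t] lam \<delta>(1) False by (intro mult_left_mono) auto
      moreover have "\<delta> * (\<alpha> - \<delta>) / lam * (lam * Z t) = \<delta> * (\<alpha> - \<delta>) * Z t" using lam by simp
      ultimately show ?thesis unfolding left_diff_distrib[of "1 - \<beta> * \<delta>"] by linarith
    qed
    finally show ?thesis .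
  qed
  then have W: "W \<delta> t + c * Y t \<le> \<Phi> \<delta> t" by (simp add: \<Phi>_def)
  define k where "k = 2 * \<delta>\<^sup>2 / lam"
  have k: "k \<ge> 0" using lam by (simp add: k_def)
  have "X t + Y t \<le> 2 * W \<delta> t + (k + 1) * Y t"
  proof -
    have "k * (lam * Z t) \<le> k * Y t" using Z_le[OF t] k by (intro mult_left_mono)
    then show ?thesis using X_le_W[of t \<delta>] lam by (simp add: k_def algebra_simps)
  qed
  also have "\<dots> \<le> (2 + (k + 1) / c) * (W \<delta> t + c * Y t)"
  proof -
    have "0 \<le> (k + 1) / c * W \<delta> t" "0 \<le> c * Y t" using c k W_nonneg nonneg by auto
    moreover have "(k + 1) / c * (c * Y t) = (k + 1) * Y t" using c by simp
    ultimately show ?thesis unfolding distrib_right[of 2 "(k + 1) / c"] distrib_left[of 2] distrib_left[of "(k + 1) / c"]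
      by linarith
  qed
  also have "\<dots> \<le> (2 + (k + 1) / c) * (exp (- (2 * \<delta>) * t) * ((2 + 3 * \<delta>\<^sup>2 / lam) * (X 0 + Y 0)))"
    using W \<Phi>_decay[OF \<delta>(2) t] \<Phi>_le[of 0 \<delta>] \<delta>(1) c k
    by (intro mult_left_mono order_trans[OF W] order_trans[OF \<Phi>_decay[OF \<delta>(2) t]]) auto
  finally show ?thesis by (simp add: k_def mult_ac)
qed

text \<open>If \<open>\<alpha> = 0\<close> and \<open>\<beta> * \<delta> = 1\<close>, then \<open>\<Phi>\<close> does not see \<open>S u\<close>. It is corrected by
  \<open>2 (u' + \<delta> u, K u) + \<beta> (S u, S (K u)) - 2 \<delta> (u, K u)\<close> with \<open>K = 1 - lam * J\<close>. The operator \<open>K\<close>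
  vanishes on the eigenspace of \<open>lam\<close>, where the damping of \<open>w\<close> may degenerate.\<close>

definition "N t = inner (u t) (J (u t))"
definition "P t = inner (u1 t) (J (u t))"

text \<open>On an eigenvalue \<open>\<mu> \<ge> lam\<close> the operator \<open>J\<close> acts as
  \<open>1 / \<mu>\<close>, and the last inequality is
  \<open>2 \<le> lam / \<mu> + \<mu> / lam\<close>. It comes from the squared norm of
  \<open>S v - lam *\<^sub>R S (J v)\<close>.\<close>

lemma J_facts:
  assumes v: "v \<in> V"
  shows "norm (J v) \<le> norm v / lam" "0 \<le> inner v (J v)" "lam * inner v (J v) \<le> (norm v)\<^sup>2"
    "2 * (norm v)\<^sup>2 \<le> lam * inner v (J v) + (norm (S v))\<^sup>2 / lam"
proof -
  have e: "(norm (S (J v)))\<^sup>2 = inner v (J v)"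
    using J_inverse[OF v J_V[OF v]] by (simp add: power2_norm_eq_inner)
  then show "0 \<le> inner v (J v)" by (metis zero_le_power2)
  have cs: "inner v (J v) \<le> norm v * norm (J v)" by (rule norm_cauchy_schwarz)
  have "lam * (norm (J v) * norm (J v)) \<le> norm v * norm (J v)"
    using poincare[OF J_V[OF v]] e cs by (simp add: power2_eq_square)
  then have "lam * norm (J v) \<le> norm v"
    by (cases "norm (J v) = 0") (auto simp: mult.assoc[symmetric])
  then show *: "norm (J v) \<le> norm v / lam" using lam by (simp add: field_simps)
  have "inner v (J v) \<le> norm v * (norm v / lam)"
    using mult_left_mono[OF *, of "norm v"] cs by simp
  then show "lam * inner v (J v) \<le> (norm v)\<^sup>2" using lam by (simp add: field_simps power2_eq_square)
  have "0 \<le> (norm (S v + (- lam) *\<^sub>R S (J v)))\<^sup>2" by (rule zero_le_power2)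
  also have "\<dots> = (norm (S v))\<^sup>2 - 2 * lam * (norm v)\<^sup>2 + lam\<^sup>2 * inner v (J v)"
    using J_inverse[OF v v] e unfolding power2_norm_add_scaleR
    by (simp add: power2_norm_eq_inner inner_commute)
  finally have "2 * (norm v)\<^sup>2 \<le> (lam\<^sup>2 * inner v (J v) + (norm (S v))\<^sup>2) / lam"
    using lam by (simp add: pos_le_divide_eq mult_ac)
  also have "\<dots> = lam * inner v (J v) + (norm (S v))\<^sup>2 / lam"
    using lam by (simp add: add_divide_distrib power2_eq_square)
  finally show "2 * (norm v)\<^sup>2 \<le> lam * inner v (J v) + (norm (S v))\<^sup>2 / lam" .
qed

lemma J_diff: "v \<in> V \<Longrightarrow> w \<in> V \<Longrightarrow> J (v - w) = J v - J w"
  using J_add[of v "(-1) *\<^sub>R w"] J_scale[of w "-1"] V by (simp add: subspace_neg)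

lemma J_sym: "v \<in> V \<Longrightarrow> w \<in> V \<Longrightarrow> inner v (J w) = inner (J v) w"
  using J_inverse[of v "J w"] J_inverse[of w "J v"] J_V by (simp add: inner_commute)

lemma cont_Ju: "continuous_on {0..} (\<lambda>t. J (u t))"
  unfolding continuous_on_def
proof
  fix t :: real assume "t \<in> {0..}"
  have "((\<lambda>s. J (u s) - J (u t)) \<longlongrightarrow> 0) (at t within {0..})"
  proof (rule Lim_null_comparison)
    show "\<forall>\<^sub>F s in at t within {0..}. norm (J (u s) - J (u t)) \<le> norm (u s - u t) / lam"
      unfolding eventually_at_filter
    proof (intro always_eventually allI impI)
      fix s :: real assume "s \<in> {0..}"
      then show "norm (J (u s) - J (u t)) \<le> norm (u s - u t) / lam"
        using J_facts(1)[of "u s - u t"] J_diff u_V V \<open>t \<in> {0..}\<close> by (simp add: subspace_diff)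
    qed
    have "((\<lambda>s. norm (u s - u t) / lam) \<longlongrightarrow> norm (u t - u t) / lam) (at t within {0..})"
      using cont_u \<open>t \<in> {0..}\<close> lam by (intro tendsto_intros) (auto simp: continuous_on_def)
    then show "((\<lambda>s. norm (u s - u t) / lam) \<longlongrightarrow> 0) (at t within {0..})" by simp
  qed
  then show "((\<lambda>t. J (u t)) \<longlongrightarrow> J (u t)) (at t within {0..})" by (rule LIM_zero_cancel)
qed

lemma deriv_Ju:
  assumes t: "t > 0"
  shows "((\<lambda>t. J (u t)) has_vector_derivative J (u1 t)) (at t)"
proof -
  have "\<forall>\<^sub>F s in at t. s > 0" using t by (intro order_tendstoD) (auto intro: tendsto_ident_at)
  then have ev: "\<forall>\<^sub>F s in at t. u s \<in> V" by eventually_elim (simp add: u_V)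
  show ?thesis
  proof (rule has_vector_derivative_linear_on[OF V J_add J_scale _ ev, where c = "1 / lam" and n = norm])
    show "((\<lambda>s. norm ((u s - u t) /\<^sub>R (s - t) - u1 t)) \<longlongrightarrow> 0) (at t)"
      using deriv_u[OF t] by (simp add: has_vector_derivative_iff_quotient)
  qed (use t u_V u1_V J_facts(1) in auto)
qed

lemma deriv_N: "t > 0 \<Longrightarrow> (N has_real_derivative 2 * P t) (at t)"
  and deriv_P: "t > 0 \<Longrightarrow> (P has_real_derivative
    inner (u1 t) (J (u1 t)) - \<beta> * M t - \<alpha> * P t - Z t) (at t)"
proof -
  assume t: "t > 0"
  note d = has_real_derivative_inner[OF deriv_u[OF t] deriv_Ju[OF t]]
    has_real_derivative_inner[OF deriv_u1[OF t] deriv_Ju[OF t]]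
  have uV: "u t \<in> V" "u1 t \<in> V" using t u_V u1_V by auto
  have e: "inner (u2 t) (J (u t)) + \<beta> * M t + \<alpha> * P t + Z t = 0"
    using equation[OF t J_V[OF uV(1)]] J_inverse[OF uV(1) uV(1)] J_inverse[OF uV]
    by (simp add: M_def P_def Z_def inner_commute)
  show "(N has_real_derivative 2 * P t) (at t)"
    unfolding N_def[abs_def] P_def
    by (rule DERIV_cong[OF d(1)]) (use J_sym[OF uV] in \<open>simp add: inner_commute\<close>)
  show "(P has_real_derivative inner (u1 t) (J (u1 t)) - \<beta> * M t - \<alpha> * P t - Z t) (at t)"
    unfolding P_def[abs_def] by (rule DERIV_cong[OF d(2)]) (use e in \<open>simp add: P_def\<close>)
qed

lemma cont_NP: "continuous_on {0..} N" "continuous_on {0..} P"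
  unfolding N_def[abs_def] P_def[abs_def]
  by (intro continuous_intros cont_u cont_u1 cont_Ju)+

text \<open>In the degenerate case \<open>w'' - 2 * \<delta> * w' + \<beta> A w' + \<delta>\<^sup>2
  w = 0\<close>. Tested with \<open>2 K w\<close> this is a total derivative up to
  \<open>2 (w', K w')\<close> and \<open>2 * \<delta>\<^sup>2 * (w, K w)\<close>; \<Gamma> is the
  differentiated quantity without its exponential weight, with
  \<open>(S u, S (J u)) = (u, u)\<close> inserted.\<close>

definition "\<Gamma> \<delta> t = 2 * (M t + \<delta> * Z t - lam * (P t + \<delta> * N t)) + \<beta> * (Y t - lam * Z t)
  - 2 * \<delta> * (Z t - lam * N t)"

text \<open>Since \<open>norm K \<le> 2 * norm (u t)\<close>, \<Gamma> is \<open>\<beta> * Y\<close>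
  up to multiples of \<open>W\<close> and \<open>Z\<close>, which \<Phi> controls in the degenerate
  case.\<close>

lemma \<Gamma>_bounds:
  assumes t: "t \<ge> 0" and \<delta>: "\<delta> \<ge> 0"
  shows "\<Gamma> \<delta> t \<le> 2 * W \<delta> t + 2 * Z t + \<beta> * Y t"
    and "\<beta> * Y t \<le> \<Gamma> \<delta> t + 2 * W \<delta> t + (2 + 2 * \<delta> + \<beta> * lam) * Z t"
proof -
  define K where "K = u t - lam *\<^sub>R J (u t)"
  have Jt: "norm (J (u t)) \<le> norm (u t) / lam" "0 \<le> N t" "lam * N t \<le> Z t"
    using J_facts[OF u_V[OF t]] by (auto simp: N_def Z_def power2_norm_eq_inner)
  have "norm K \<le> norm (u t) + lam * norm (J (u t))"
    unfolding K_def using norm_triangle_ineq4[of "u t" "lam *\<^sub>R J (u t)"] lam by simp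
  also have "\<dots> \<le> 2 * norm (u t)"
    using Jt(1) lam by (simp add: field_simps)
  finally have K: "norm K \<le> 2 * norm (u t)" .
  define y where "y = u1 t + \<delta> *\<^sub>R u t"
  have yK: "inner y K = M t + \<delta> * Z t - lam * (P t + \<delta> * N t)"
    by (simp add: y_def K_def M_def Z_def P_def N_def inner_add inner_diff inner_commute algebra_simps)
  have "2 * \<bar>inner y K\<bar> \<le> 2 * (norm y * norm K)" using Cauchy_Schwarz_ineq2[of y K] by simp
  also have "\<dots> \<le> 2 * (norm y * (2 * norm (u t)))" using K by (intro mult_left_mono) auto
  also have "\<dots> \<le> 2 * (norm y)\<^sup>2 + 2 * (norm (u t))\<^sup>2"
    using sum_squares_bound[of "norm y" "norm (u t)"] by (simp add: algebra_simps)
  finally have b: "\<bar>M t + \<delta> * Z t - lam * (P t + \<delta> * N t)\<bar> \<le> W \<delta> t + Z t"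
    unfolding yK by (simp add: W_def y_def Z_def power2_norm_eq_inner)
  have b': "M t + \<delta> * Z t - lam * (P t + \<delta> * N t) \<le> W \<delta> t + Z t"
    "- (M t + \<delta> * Z t - lam * (P t + \<delta> * N t)) \<le> W \<delta> t + Z t"
    using b unfolding abs_le_iff by blast+
  have "0 \<le> \<beta> * lam * Z t" using \<beta> lam nonneg by simp
  moreover have "0 \<le> 2 * \<delta> * (Z t - lam * N t)" "2 * \<delta> * (Z t - lam * N t) \<le> 2 * \<delta> * Z t"
    using Jt \<delta> lam by (auto intro!: mult_nonneg_nonneg mult_left_mono)
  ultimately show "\<Gamma> \<delta> t \<le> 2 * W \<delta> t + 2 * Z t + \<beta> * Y t"
    and "\<beta> * Y t \<le> \<Gamma> \<delta> t + 2 * W \<delta> t + (2 + 2 * \<delta> + \<beta> * lam) * Z t"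
    using b' unfolding \<Gamma>_def by (auto simp: algebra_simps)
qed

text \<open>The growth \<open>2 (w', K w')\<close> of \<Gamma> is at most
  \<open>2 (|S w'|^2 / lam - |w'|^2)\<close> by the last part of \<open>J_facts\<close>. The weight
  \<open>\<beta> * lam\<close> makes its first term cancel the dissipation
  \<open>2 * \<beta> * |S w'|^2\<close> of \<Phi> exactly, leaving
  \<open>(4 * \<delta> - 2 * \<beta> * lam) * |w'|^2 \<le> 0\<close>.\<close>

lemma \<Phi>\<Gamma>_decay:
  assumes \<alpha>0: "\<alpha> = 0" and \<delta>: "\<delta> \<le> \<beta> * lam / 2" "\<beta> * \<delta> = 1" and t: "t \<ge> 0"
  shows "\<Phi> \<delta> t + \<beta> * lam * \<Gamma> \<delta> t \<le> exp (- (2 * \<delta>) * t) * (\<Phi> \<delta> 0 + \<beta> * lam * \<Gamma> \<delta> 0)"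
proof (rule exp_decay_from_zero[OF _ _ _ t])
  show "continuous_on {0..} (\<lambda>t. \<Phi> \<delta> t + \<beta> * lam * \<Gamma> \<delta> t)"
    unfolding \<Gamma>_def by (intro continuous_intros cont_\<Phi> cont_XYZM cont_NP)
  fix t :: real assume t: "t > 0"
  define a01 where "a01 = inner (S (u1 t)) (S (u t))"
  define Q where "Q = inner (u1 t) (J (u1 t))"
  let ?\<Gamma>' = "2 * (X t - \<beta> * a01 - Y t + \<delta> * (2 * M t) - lam * (Q - \<beta> * M t - Z t + \<delta> * (2 * P t)))
    + \<beta> * (2 * a01 - lam * (2 * M t)) - 2 * \<delta> * (2 * M t - lam * (2 * P t))"
  let ?\<Phi>' = "- 2 * \<delta> * \<Phi> \<delta> t - 2 * \<beta> * (norm (S (u1 t + \<delta> *\<^sub>R u t)))\<^sup>2 - 2 * (\<alpha> - 2 * \<delta>) * W \<delta> t"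
  have "(\<Gamma> \<delta> has_real_derivative ?\<Gamma>') (at t)"
    unfolding \<Gamma>_def[abs_def]
    by (rule DERIV_cong,
        (rule derivative_eq_intros deriv_Y deriv_Z deriv_M deriv_N deriv_P t refl)+)
      (simp add: \<alpha>0 a01_def Q_def algebra_simps)
  then show "((\<lambda>t. \<Phi> \<delta> t + \<beta> * lam * \<Gamma> \<delta> t) has_real_derivative ?\<Phi>' + \<beta> * lam * ?\<Gamma>') (at t)"
    by (intro DERIV_add DERIV_cmult deriv_\<Phi> t)
  define y where "y = u1 t + \<delta> *\<^sub>R u t"
  have uV: "u t \<in> V" "u1 t \<in> V" "\<delta> *\<^sub>R u t \<in> V" using t u_V u1_V V by (auto simp: subspace_scale)
  have yV: "y \<in> V" unfolding y_def using S_shift(1)[OF t] .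
  have yJ: "inner y (J y) = Q + 2 * \<delta> * P t + \<delta>\<^sup>2 * N t"
    unfolding y_def using uV J_sym[OF uV(1,2)]
    by (simp add: J_add J_scale Q_def P_def N_def inner_add inner_commute power2_eq_square algebra_simps)
  \<comment> \<open>The last summand vanishes for \<open>\<beta> * \<delta> = 1\<close>, and the
    middle one is nonpositive because \<open>lam * N t \<le> Z t\<close>.\<close>
  have \<Gamma>': "?\<Gamma>' + 2 * \<delta> * \<Gamma> \<delta> t =
      2 * (W \<delta> t - lam * inner y (J y)) - 2 * \<delta>\<^sup>2 * (Z t - lam * N t)
      + 2 * (\<beta> * \<delta> - 1) * (Y t - lam * Z t)"
    unfolding \<Gamma>_def yJ W_eq by (simp add: algebra_simps power2_eq_square)
  have "lam * N t \<le> Z t"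
    using J_facts(3)[OF uV(1)] by (simp add: N_def Z_def power2_norm_eq_inner)
  then have "0 \<le> 2 * \<delta>\<^sup>2 * (Z t - lam * N t)" by simp
  then have "?\<Gamma>' + 2 * \<delta> * \<Gamma> \<delta> t \<le> 2 * (W \<delta> t - lam * inner y (J y))"
    using \<Gamma>' \<delta>(2) by simp
  also have "\<dots> \<le> 2 * ((norm (S y))\<^sup>2 / lam - W \<delta> t)"
    using J_facts(4)[OF yV] by (simp add: W_def y_def)
  finally have "\<beta> * lam * (?\<Gamma>' + 2 * \<delta> * \<Gamma> \<delta> t) \<le> \<beta> * lam * (2 * ((norm (S y))\<^sup>2 / lam - W \<delta> t))"
    using \<beta> lam by (intro mult_left_mono) auto
  also have "\<dots> = 2 * \<beta> * (norm (S y))\<^sup>2 - 2 * (\<beta> * lam) * W \<delta> t"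
    using lam by (simp add: algebra_simps)
  moreover have "4 * \<delta> * W \<delta> t \<le> 2 * (\<beta> * lam) * W \<delta> t"
    using \<delta>(1) W_nonneg by (intro mult_right_mono) auto
  ultimately show "?\<Phi>' + \<beta> * lam * ?\<Gamma>' + 2 * \<delta> * (\<Phi> \<delta> t + \<beta> * lam * \<Gamma> \<delta> t) \<le> 0"
    using \<alpha>0 by (simp add: y_def[symmetric] algebra_simps)
qed

text \<open>Here \<Phi> is \<open>W + \<delta>\<^sup>2 * Z\<close>, so its own decay bounds
  \<open>X\<close>. The constant \<open>b\<close> makes the error terms of
  \<open>\<Gamma>_bounds\<close> at most \<open>b * \<Phi>\<close>, and \<open>Y\<close> is then
  extracted from the decay of \<open>\<Phi> + \<beta> * lam * \<Gamma>\<close>.\<close>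

lemma energy_decay_degenerate:
  assumes \<alpha>0: "\<alpha> = 0" and \<delta>: "0 < \<delta>" "\<delta> \<le> \<beta> * lam / 2" "\<beta> * \<delta> = 1" and t: "t \<ge> 0"
  defines "a \<equiv> 2 + 3 * \<delta>\<^sup>2 / lam" and "b \<equiv> 2 + (2 + 2 * \<delta> + \<beta> * lam) / \<delta>\<^sup>2"
  shows "X t + Y t \<le> (2 * a + (a + 2 * b * \<beta> * lam * a + \<beta>\<^sup>2 * lam) / (\<beta>\<^sup>2 * lam)) *
    exp (- (2 * \<delta>) * t) * (X 0 + Y 0)"
proof -
  have \<beta>0: "\<beta> > 0" using \<delta> \<beta> by (cases "\<beta> = 0") auto
  have pos: "\<beta> * lam > 0" using \<beta>0 lam by simp
  have \<Phi>: "\<Phi> \<delta> t = W \<delta> t + \<delta>\<^sup>2 * Z t" for t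
    unfolding \<Phi>_def using \<delta>(3) by (simp add: \<alpha>0 power2_eq_square)
  have b_bd: "2 * W \<delta> t + c * Z t \<le> b * \<Phi> \<delta> t" if "c \<le> 2 + 2 * \<delta> + \<beta> * lam" for c t
  proof -
    have "c * Z t \<le> (2 + 2 * \<delta> + \<beta> * lam) * Z t" using that nonneg by (intro mult_right_mono)
    also have "\<dots> = (2 + 2 * \<delta> + \<beta> * lam) / \<delta>\<^sup>2 * (\<delta>\<^sup>2 * Z t)" using \<delta>(1) by simp
    finally have 1: "c * Z t \<le> (2 + 2 * \<delta> + \<beta> * lam) / \<delta>\<^sup>2 * (\<delta>\<^sup>2 * Z t)" .
    have 2: "0 \<le> (2 + 2 * \<delta> + \<beta> * lam) / \<delta>\<^sup>2 * W \<delta> t" "0 \<le> \<delta>\<^sup>2 * Z t"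
      using \<delta>(1) pos W_nonneg nonneg by auto
    have "b * \<Phi> \<delta> t = 2 * W \<delta> t + 2 * (\<delta>\<^sup>2 * Z t) + (2 + 2 * \<delta> + \<beta> * lam) / \<delta>\<^sup>2 * W \<delta> t
        + (2 + 2 * \<delta> + \<beta> * lam) / \<delta>\<^sup>2 * (\<delta>\<^sup>2 * Z t)"
      unfolding \<Phi> b_def by (simp only: distrib_left distrib_right)
    then show ?thesis using 1 2 by linarith
  qed
  have b0: "b \<ge> 0" using \<delta>(1) pos by (simp add: b_def)
  have a0: "a \<ge> 0" using lam by (simp add: a_def)
  define e where "e = exp (- (2 * \<delta>) * t)"
  have e0: "e > 0" by (simp add: e_def)
  define E0 where "E0 = X 0 + Y 0"
  have \<Phi>0: "\<Phi> \<delta> 0 \<le> a * E0" using \<Phi>_le[of 0 \<delta>] \<delta>(1) by (simp add: a_def E0_def)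
  have "\<Phi> \<delta> t \<le> e * \<Phi> \<delta> 0" unfolding e_def using \<delta> \<alpha>0 t by (intro \<Phi>_decay) auto
  also have "\<dots> \<le> e * (a * E0)" using e0 \<Phi>0 by (intro mult_left_mono) auto
  finally have \<Phi>t: "\<Phi> \<delta> t \<le> e * (a * E0)" .
  have "X t \<le> 2 * \<Phi> \<delta> t" using X_le_W[of t \<delta>] \<Phi>[of t] by simp
  moreover have "2 * a * e * E0 = 2 * (e * (a * E0))" by simp
  ultimately have X: "X t \<le> 2 * a * e * E0" using \<Phi>t by linarith
  have "\<beta> * lam * (\<beta> * Y t) \<le> \<beta> * lam * (\<Gamma> \<delta> t + b * \<Phi> \<delta> t)"
    using \<Gamma>_bounds(2)[OF t, of \<delta>] b_bd[OF order_refl, of t] \<delta>(1) pos by (intro mult_left_mono) auto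
  \<comment> \<open>Adding the nonnegative \<Phi> completes the combination that decays.\<close>
  also have "\<dots> \<le> (\<Phi> \<delta> t + \<beta> * lam * \<Gamma> \<delta> t) + \<beta> * lam * b * \<Phi> \<delta> t"
    using \<Phi>[of t] W_nonneg nonneg by (simp add: algebra_simps)
  also have "\<dots> \<le> e * (\<Phi> \<delta> 0 + \<beta> * lam * \<Gamma> \<delta> 0) + \<beta> * lam * b * (e * (a * E0))"
    using \<Phi>\<Gamma>_decay[OF \<alpha>0 \<delta>(2,3) t] \<Phi>t pos b0
    by (intro add_mono mult_left_mono) (auto simp: e_def)
  also have "\<dots> \<le> e * (a * E0 + \<beta> * lam * (b * (a * E0) + \<beta> * E0)) + \<beta> * lam * b * (e * (a * E0))"
  proof -
    have "\<Gamma> \<delta> 0 \<le> b * \<Phi> \<delta> 0 + \<beta> * Y 0"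
      using \<Gamma>_bounds(1)[of 0 \<delta>] b_bd[of 2 0] \<delta>(1) pos by simp
    also have "\<dots> \<le> b * (a * E0) + \<beta> * E0"
      using b0 \<Phi>0 \<beta> nonneg by (intro add_mono mult_left_mono) (auto simp: E0_def)
    finally show ?thesis
      using e0 pos \<Phi>0 by (intro add_right_mono mult_left_mono add_mono) auto
  qed
  also have "\<dots> = (a + 2 * b * \<beta> * lam * a + \<beta>\<^sup>2 * lam) * e * E0"
    by (simp add: algebra_simps power2_eq_square)
  finally have "\<beta>\<^sup>2 * lam * Y t \<le> (a + 2 * b * \<beta> * lam * a + \<beta>\<^sup>2 * lam) * e * E0"
    by (simp add: power2_eq_square mult_ac)
  then have "Y t \<le> (a + 2 * b * \<beta> * lam * a + \<beta>\<^sup>2 * lam) * e * E0 / (\<beta>\<^sup>2 * lam)"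
    using \<beta>0 lam by (simp add: field_simps)
  then show ?thesis using X unfolding e_def[symmetric] E0_def[symmetric]
    by (simp add: distrib_right)
qed

end

section \<open>Completeness of the space of square-integrable functions\<close>

lemma L2_rep: obtains f where "square_integrable f" "F = L2_of f"
proof -
  have "\<exists>f. square_integrable f \<and> F = L2_of f"
    by transfer (auto intro: exI simp: square_integrable_zero)
  then show thesis using that by blast
qed

lemma inner_L2_of:
  "square_integrable f \<Longrightarrow> square_integrable g \<Longrightarrow> inner (L2_of f) (L2_of g) = (\<integral>x. f x * g x \<partial>lborel)"
  by transfer simp

lemma norm_L2_of: "square_integrable f \<Longrightarrow> (norm (L2_of f))\<^sup>2 = (\<integral>x. (f x)\<^sup>2 \<partial>lborel)"
  by (subst power2_norm_eq_inner, subst inner_L2_of) (auto simp: power2_eq_square)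

lemma L2_of_add:
  "square_integrable f \<Longrightarrow> square_integrable g \<Longrightarrow> L2_of (\<lambda>x. f x + g x) = L2_of f + L2_of g"
  by transfer (simp add: square_integrable_add)

lemma L2_of_scale: "square_integrable f \<Longrightarrow> L2_of (\<lambda>x. c * f x) = c *\<^sub>R L2_of f"
  by transfer (simp add: square_integrable_scale)

lemma square_integrable_diff:
  "square_integrable f \<Longrightarrow> square_integrable g \<Longrightarrow> square_integrable (\<lambda>x. f x - g x)"
  using square_integrable_add[of f "\<lambda>x. - g x"] square_integrable_minus[of g] by simp

lemma L2_of_diff:
  "square_integrable f \<Longrightarrow> square_integrable g \<Longrightarrow> L2_of (\<lambda>x. f x - g x) = L2_of f - L2_of g"
  using L2_of_add[of f "\<lambda>x. (-1) * g x"] L2_of_scale[of g "-1"] square_integrable_scale[of g "-1"]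
  by simp

lemma vanishes_outside_L2_of:
  "square_integrable f \<Longrightarrow> vanishes_outside \<Omega> (L2_of f) \<longleftrightarrow> (AE x in lborel. x \<notin> \<Omega> \<longrightarrow> f x = 0)"
  by transfer simp

lemma nn_integral_norm_L2_of:
  assumes "square_integrable f"
  shows "(\<integral>\<^sup>+x. ennreal ((f x)\<^sup>2) \<partial>lborel) = ennreal ((norm (L2_of f))\<^sup>2)"
  using assms unfolding norm_L2_of[OF assms]
  by (intro nn_integral_eq_integral) (auto simp: square_integrable_def)

lemma square_integrableI:
  fixes f :: "'a::euclidean_space \<Rightarrow> real"
  assumes "f \<in> borel_measurable lborel" "(\<integral>\<^sup>+x. ennreal ((f x)\<^sup>2) \<partial>lborel) < \<infinity>"
  shows "square_integrable f"
  using assms by (auto simp: square_integrable_def intro!: integrableI_bounded)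

text \<open>Riesz-Fischer. With the weight \<open>2 ^ k\<close> the integrals of the squared
  increments are still at most \<open>(1/2) ^ k\<close>; pointwise the weight makes the increments
  themselves summable, because \<open>y \<le> (1/2) ^ k + 2 ^ k * y\<^sup>2\<close>. Hence the limit
  exists almost everywhere.\<close>

lemma L2_fast_Cauchy_convergent:
  fixes F :: "nat \<Rightarrow> 'a::euclidean_space L2"
  assumes fast: "\<And>k m. k \<le> m \<Longrightarrow> norm (F m - F k) \<le> (1/2) ^ k"
  shows "\<exists>L. F \<longlonglongrightarrow> L"
proof -
  have "\<exists>f. square_integrable f \<and> F k = L2_of f" for k using L2_rep[of "F k"] by metis
  then obtain f where f: "\<And>k. square_integrable (f k)" "\<And>k. F k = L2_of (f k)" by metis
  have [measurable]: "f k \<in> borel_measurable lborel" for k using f(1) by (simp add: square_integrable_def)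
  have nn: "(\<integral>\<^sup>+x. ennreal ((f m x - f k x)\<^sup>2) \<partial>lborel) = ennreal ((norm (F m - F k))\<^sup>2)" for m k
    using nn_integral_norm_L2_of[OF square_integrable_diff[OF f(1) f(1)]]
    by (simp add: L2_of_diff f)
  define d where "d k x = (f (Suc k) x - f k x)\<^sup>2" for k x
  have "(\<integral>\<^sup>+x. (\<Sum>k. ennreal (2 ^ k * d k x)) \<partial>lborel) = (\<Sum>k. \<integral>\<^sup>+x. ennreal (2 ^ k * d k x) \<partial>lborel)"
    unfolding d_def by (rule nn_integral_suminf) auto
  also have "\<dots> \<le> (\<Sum>k. ennreal ((1/2) ^ k))"
  proof (intro suminf_le summableI)
    fix k
    have "(\<integral>\<^sup>+x. ennreal (2 ^ k * d k x) \<partial>lborel) = ennreal (2 ^ k) * ennreal ((norm (F (Suc k) - F k))\<^sup>2)"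
      unfolding nn[symmetric] d_def by (simp add: ennreal_mult nn_integral_cmult)
    also have "\<dots> = ennreal (2 ^ k * (norm (F (Suc k) - F k))\<^sup>2)" by (simp add: ennreal_mult)
    also have "\<dots> \<le> ennreal (2 ^ k * ((1/2) ^ k)\<^sup>2)"
      using fast[of k "Suc k"] by (intro ennreal_leI mult_left_mono power_mono) auto
    also have "(2::real) ^ k * ((1/2) ^ k)\<^sup>2 = (1/2) ^ k"
      by (simp add: power2_eq_square power_one_over)
    finally show "(\<integral>\<^sup>+x. ennreal (2 ^ k * d k x) \<partial>lborel) \<le> ennreal ((1/2) ^ k)" .
  qed
  also have "\<dots> < \<infinity>"
  proof -
    have "(\<Sum>k. ennreal ((1/2) ^ k)) = ennreal (\<Sum>k. (1/2) ^ k)"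
      by (rule suminf_ennreal2) (auto intro: summable_geometric)
    then show ?thesis by (metis ennreal_less_top infinity_ennreal_def)
  qed
  finally have "AE x in lborel. (\<Sum>k. ennreal (2 ^ k * d k x)) \<noteq> \<infinity>"
    unfolding d_def by (intro nn_integral_PInf_AE) auto
  then have conv: "AE x in lborel. convergent (\<lambda>k. f k x)"
  proof eventually_elim
    fix x assume "(\<Sum>k. ennreal (2 ^ k * d k x)) \<noteq> \<infinity>"
    then have s: "summable (\<lambda>k. 2 ^ k * d k x)"
      by (intro summable_suminf_not_top) (auto simp: d_def)
    have "summable (\<lambda>k. f (Suc k) x - f k x)"
    proof (rule summable_comparison_test'[where N = 0])
      show "summable (\<lambda>k. (1/2) ^ k + 2 ^ k * d k x)"
        using s by (intro summable_add summable_geometric) auto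
      fix k :: nat
      define y where "y = \<bar>f (Suc k) x - f k x\<bar>"
      have "2 * 1 * (2 ^ k * y) \<le> 1\<^sup>2 + (2 ^ k * y)\<^sup>2" by (rule sum_squares_bound)
      then have "(1/2) ^ k * (2 * (2 ^ k * y)) \<le> (1/2) ^ k * (1 + (2 ^ k * y)\<^sup>2)"
        by (intro mult_left_mono) auto
      also have "(1/2) ^ k * (2 * (2 ^ k * y)) = 2 * y"
        by (simp add: power_one_over)
      also have "(1/2) ^ k * (1 + (2 ^ k * y)\<^sup>2) = (1/2) ^ k + 2 ^ k * d k x"
        by (simp add: d_def y_def power_one_over add_divide_distrib power2_eq_square)
      finally have "2 * y \<le> (1/2) ^ k + 2 ^ k * d k x" .
      moreover have "0 \<le> y" by (simp add: y_def)
      ultimately have "y \<le> (1/2) ^ k + 2 ^ k * d k x" by linarith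
      then show "norm (f (Suc k) x - f k x) \<le> (1/2) ^ k + 2 ^ k * d k x"
        by (simp add: y_def)
    qed
    then have "convergent (\<lambda>n. \<Sum>k<n. f (Suc k) x - f k x)" by (simp add: summable_iff_convergent)
    then have "convergent (\<lambda>n. f n x - f 0 x)" 
      by (simp add: sum_lessThan_telescope[of "\<lambda>k. f k x"])
    then show "convergent (\<lambda>k. f k x)"
      using convergent_add[of "\<lambda>n. f n x - f 0 x" "\<lambda>_. f 0 x"] by (simp add: convergent_const)
  qed
  define g where "g x = lim (\<lambda>k. f k x)" for x
  have gm[measurable]: "g \<in> borel_measurable lborel"
    unfolding g_def by (intro borel_measurable_lim_metric) auto
  \<comment> \<open>Fatou's lemma in the index \<open>m\<close> turns the almost everywhere limit
    into a mean square estimate.\<close>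
  have dist: "(\<integral>\<^sup>+x. ennreal ((g x - f k x)\<^sup>2) \<partial>lborel) \<le> ennreal (((1/2) ^ k)\<^sup>2)" for k
  proof -
    have "(\<integral>\<^sup>+x. ennreal ((g x - f k x)\<^sup>2) \<partial>lborel)
        = (\<integral>\<^sup>+x. liminf (\<lambda>m. ennreal ((f m x - f k x)\<^sup>2)) \<partial>lborel)"
    proof (rule nn_integral_cong_AE)
      show "AE x in lborel. ennreal ((g x - f k x)\<^sup>2) = liminf (\<lambda>m. ennreal ((f m x - f k x)\<^sup>2))"
        using conv
      proof eventually_elim
        fix x assume "convergent (\<lambda>k. f k x)"
        then have "(\<lambda>m. f m x) \<longlonglongrightarrow> g x" by (simp add: g_def convergent_LIMSEQ_iff)
        then have "(\<lambda>m. ennreal ((f m x - f k x)\<^sup>2)) \<longlonglongrightarrow> ennreal ((g x - f k x)\<^sup>2)"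
          by (intro tendsto_intros tendsto_ennrealI)
        from lim_imp_Liminf[OF _ this] show "ennreal ((g x - f k x)\<^sup>2) = liminf (\<lambda>m. ennreal ((f m x - f k x)\<^sup>2))"
          by simp
      qed
    qed
    also have "\<dots> \<le> liminf (\<lambda>m. \<integral>\<^sup>+x. ennreal ((f m x - f k x)\<^sup>2) \<partial>lborel)"
      by (rule nn_integral_liminf) auto
    also have "\<dots> \<le> ennreal (((1/2) ^ k)\<^sup>2)"
    proof (rule Liminf_le)
      show "\<forall>\<^sub>F m in sequentially. (\<integral>\<^sup>+x. ennreal ((f m x - f k x)\<^sup>2) \<partial>lborel) \<le> ennreal (((1/2) ^ k)\<^sup>2)"
        unfolding nn eventually_sequentially
        using fast by (intro exI[of _ k]) (auto intro!: ennreal_leI power_mono)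
    qed simp
    finally show ?thesis .
  qed
  have sq: "square_integrable (\<lambda>x. g x - f k x)" for k
  proof (rule square_integrableI)
    show "(\<integral>\<^sup>+x. ennreal ((g x - f k x)\<^sup>2) \<partial>lborel) < \<infinity>"
      using dist[of k] by (rule order.strict_trans1) simp
  qed auto
  have gs: "square_integrable g"
    using square_integrable_add[OF sq[of 0] f(1)[of 0]] by simp
  have bound: "norm (F k - L2_of g) \<le> (1/2) ^ k" for k
  proof -
    have "ennreal ((norm (L2_of g - F k))\<^sup>2) \<le> ennreal (((1/2) ^ k)\<^sup>2)"
      using dist[of k] nn_integral_norm_L2_of[OF sq[of k]] by (simp add: L2_of_diff gs f)
    then have "(norm (L2_of g - F k))\<^sup>2 \<le> ((1/2) ^ k)\<^sup>2" by (simp add: ennreal_le_iff)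
    then have "norm (L2_of g - F k) \<le> (1/2) ^ k" by (rule power2_le_imp_le) simp
    then show ?thesis by (simp only: norm_minus_commute)
  qed
  have "(\<lambda>k. F k - L2_of g) \<longlonglongrightarrow> 0"
  proof (rule Lim_null_comparison)
    show "\<forall>\<^sub>F k in sequentially. norm (F k - L2_of g) \<le> (1/2) ^ k"
      by (intro always_eventually allI bound)
    show "(\<lambda>k. (1/2 :: real) ^ k) \<longlonglongrightarrow> 0" by (rule LIMSEQ_power_zero) simp
  qed
  then have "F \<longlonglongrightarrow> L2_of g" by (rule LIM_zero_cancel)
  then show ?thesis ..
qed

lemma L2_Cauchy_convergent:
  fixes F :: "nat \<Rightarrow> 'a::euclidean_space L2"
  assumes "Cauchy F"
  shows "\<exists>L. F \<longlonglongrightarrow> L"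
proof -
  have "\<exists>N. \<forall>m\<ge>N. \<forall>n\<ge>N. norm (F m - F n) < (1/2) ^ k" for k
    using CauchyD[OF assms, of "(1/2) ^ k"] by simp
  then obtain N where N: "\<And>k m n. m \<ge> N k \<Longrightarrow> n \<ge> N k \<Longrightarrow> norm (F m - F n) < (1/2) ^ k" by metis
  \<comment> \<open>The sum makes \<open>r k\<close> at least \<open>N k\<close>; the summand
    \<open>k\<close> makes \<open>r\<close> strictly increasing.\<close>
  define r where "r k = (\<Sum>i\<le>k. N i) + k" for k
  have r: "strict_mono r" by (rule strict_monoI_Suc) (simp add: r_def)
  have "N k \<le> r k" for k unfolding r_def by (simp add: trans_le_add1 member_le_sum)
  then have "norm (F (r m) - F (r k)) \<le> (1/2) ^ k" if "k \<le> m" for k m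
    using N[of k "r m" "r k"] that r by (meson less_imp_le order_trans strict_mono_less_eq)
  from L2_fast_Cauchy_convergent[of "F \<circ> r"] this obtain L where "(F \<circ> r) \<longlonglongrightarrow> L" by auto
  from Cauchy_converges_subseq[OF assms r this] show ?thesis by blast
qed

lemma subspace_L2_on: "subspace (L2_on \<Omega>)"
proof -
  have "vanishes_outside \<Omega> 0" by transfer simp
  moreover have "vanishes_outside \<Omega> (f + g)" if "vanishes_outside \<Omega> f" "vanishes_outside \<Omega> g" for f g
    using that by transfer (auto elim: eventually_elim2)
  moreover have "vanishes_outside \<Omega> (c *\<^sub>R f)" if "vanishes_outside \<Omega> f" for c f
    using that by transfer auto
  ultimately show ?thesis unfolding subspace_def L2_on_def by blast
qed

lemma L2_on_orthogonal:
  assumes "f \<in> L2_on \<Omega>" "square_integrable g" "\<And>x. x \<in> \<Omega> \<Longrightarrow> g x = 0"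
  shows "inner f (L2_of g) = 0"
proof -
  obtain f' where f': "square_integrable f'" "f = L2_of f'" using L2_rep by blast
  then have "AE x in lborel. x \<notin> \<Omega> \<longrightarrow> f' x = 0"
    using assms(1) by (simp add: L2_on_def vanishes_outside_L2_of)
  then have "AE x in lborel. f' x * g x = 0"
    by eventually_elim (use assms(3) in auto)
  then have "(\<integral>x. f' x * g x \<partial>lborel) = 0"
    by (subst integral_cong_AE[where g = "\<lambda>_. 0"]) (use f' assms in \<open>auto simp: square_integrable_def\<close>)
  then show ?thesis using f' assms by (simp add: inner_L2_of)
qed

lemma complete_L2_on:
  assumes [measurable]: "\<Omega> \<in> sets lborel"
  shows "complete (L2_on \<Omega>)"
proof -
  have "complete (UNIV :: 'a L2 set)"
    unfolding complete_def using L2_Cauchy_convergent by auto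
  moreover have "closed (L2_on \<Omega>)"
    unfolding closed_sequential_limits
  proof (intro allI impI)
    fix F L assume F: "(\<forall>n. F n \<in> L2_on \<Omega>) \<and> F \<longlonglongrightarrow> L"
    obtain f where f: "square_integrable f" "L = L2_of f" using L2_rep by blast
    have [measurable]: "f \<in> borel_measurable lborel" using f(1) by (simp add: square_integrable_def)
    \<comment> \<open>The limit is tested against its own part outside \<Omega>, to which every
      \<open>F n\<close> is orthogonal.\<close>
    define g where "g x = indicator (- \<Omega>) x * f x" for x
    have g: "square_integrable g"
    proof (rule square_integrableI)
      show "g \<in> borel_measurable lborel"
        unfolding g_def by measurable
      have "(\<integral>\<^sup>+x. ennreal ((g x)\<^sup>2) \<partial>lborel) \<le> (\<integral>\<^sup>+x. ennreal ((f x)\<^sup>2) \<partial>lborel)"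
        by (intro nn_integral_mono) (auto simp: g_def indicator_def)
      also have "\<dots> < \<infinity>" by (simp add: nn_integral_norm_L2_of[OF f(1)])
      finally show "(\<integral>\<^sup>+x. ennreal ((g x)\<^sup>2) \<partial>lborel) < \<infinity>" .
    qed
    have "inner (F n) (L2_of g) = 0" for n
      using F g by (intro L2_on_orthogonal[of _ \<Omega>]) (auto simp: g_def)
    moreover have "(\<lambda>n. inner (F n) (L2_of g)) \<longlonglongrightarrow> inner L (L2_of g)"
      using F by (intro tendsto_intros) auto
    ultimately have "inner L (L2_of g) = 0" by (simp add: LIMSEQ_const_iff)
    then have "(\<integral>x. f x * g x \<partial>lborel) = 0" using f g by (simp add: inner_L2_of)
    then have "AE x in lborel. f x * g x = 0"
      by (subst (asm) integral_nonneg_eq_0_iff_AE)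
        (use square_integrable_mult[OF f(1) g] in \<open>auto simp: g_def indicator_def\<close>)
    then have "AE x in lborel. x \<notin> \<Omega> \<longrightarrow> f x = 0"
      by eventually_elim (auto simp: g_def)
    then show "L \<in> L2_on \<Omega>" using f by (simp add: L2_on_def vanishes_outside_L2_of)
  qed
  ultimately show ?thesis using complete_closed_subset by blast
qed

section \<open>Test functions and Sobolev spaces\<close>

lemma nn_integral_lborel_translate:
  fixes f :: "'a::euclidean_space \<Rightarrow> ennreal"
  assumes [measurable]: "f \<in> borel_measurable borel"
  shows "(\<integral>\<^sup>+x. f (x + c) \<partial>lborel) = (\<integral>\<^sup>+x. f x \<partial>lborel)"
proof -
  have "(\<integral>\<^sup>+x. f x \<partial>lborel) = (\<integral>\<^sup>+x. f x \<partial>distr lborel borel ((+) c))"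
    by (simp add: lborel_distr_plus)
  also have "\<dots> = (\<integral>\<^sup>+x. f (c + x) \<partial>lborel)" by (subst nn_integral_distr) auto
  finally show ?thesis by (simp add: add.commute)
qed

lemma integral_lborel_translate:
  fixes f :: "'a::euclidean_space \<Rightarrow> real"
  assumes [measurable]: "f \<in> borel_measurable borel"
  shows "(\<integral>x. f (x + c) \<partial>lborel) = (\<integral>x. f x \<partial>lborel)"
proof -
  have "(\<integral>x. f x \<partial>lborel) = (\<integral>x. f x \<partial>distr lborel borel ((+) c))"
    by (simp add: lborel_distr_plus)
  also have "\<dots> = (\<integral>x. f (c + x) \<partial>lborel)" by (subst integral_distr) auto
  finally show ?thesis by (simp add: add.commute)
qed

lemma integrable_lborel_translate:
  fixes f :: "'a::euclidean_space \<Rightarrow> real"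
  assumes "integrable lborel f"
  shows "integrable lborel (\<lambda>x. f (x + c))"
proof -
  have "integrable (distr lborel borel ((+) c)) f" using assms by (simp add: lborel_distr_plus)
  then have "integrable lborel (\<lambda>x. f (c + x))"
    using borel_measurable_integrable[OF assms] by (subst (asm) integrable_distr_eq) auto
  then show ?thesis by (simp add: add.commute)
qed

lemma integrable_continuous_compact_support:
  fixes f :: "'a::euclidean_space \<Rightarrow> real"
  assumes "continuous_on UNIV f" "compact K" "\<And>x. x \<notin> K \<Longrightarrow> f x = 0"
  shows "integrable lborel f"
proof -
  have "integrable lborel (\<lambda>x. indicator K x *\<^sub>R f x)"
    using assms by (intro borel_integrable_compact) (auto intro: continuous_on_subset)
  also have "(\<lambda>x. indicator K x *\<^sub>R f x) = f"
  proof
    fix x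
    show "indicator K x *\<^sub>R f x = f x" using assms(3) by (cases "x \<in> K") auto
  qed
  finally show ?thesis .
qed

lemma square_integrable_continuous_compact_support:
  fixes f :: "'a::euclidean_space \<Rightarrow> real"
  assumes "continuous_on UNIV f" "compact K" "\<And>x. x \<notin> K \<Longrightarrow> f x = 0"
  shows "square_integrable f"
  unfolding square_integrable_def
proof
  show "f \<in> borel_measurable lborel" using assms(1) by (simp add: borel_measurable_continuous_onI)
  show "integrable lborel (\<lambda>x. (f x)\<^sup>2)"
    using assms by (intro integrable_continuous_compact_support[of _ K] continuous_intros) auto
qed

lemma has_real_derivative_along_line:
  fixes f :: "'a::euclidean_space \<Rightarrow> real"
  assumes "\<And>x. f differentiable (at x)"
  shows "((\<lambda>s. f (x + s *\<^sub>R z)) has_real_derivative frechet_derivative f (at (x + s *\<^sub>R z)) z) (at s)"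
proof -
  have "((\<lambda>s. f (x + s *\<^sub>R z)) has_derivative
      (\<lambda>h. frechet_derivative f (at (x + s *\<^sub>R z)) (h *\<^sub>R z))) (at s)"
    using assms frechet_derivative_works
    by (auto intro!: derivative_eq_intros has_derivative_compose[where f = "\<lambda>s. x + s *\<^sub>R z" and g = f])
  moreover have "frechet_derivative f (at (x + s *\<^sub>R z)) (h *\<^sub>R z) =
      h * frechet_derivative f (at (x + s *\<^sub>R z)) z" for h
    using linear_frechet_derivative[OF assms] by (simp add: linear_scale)
  ultimately show ?thesis by (simp add: has_field_derivative_def mult_commute_abs)
qed

text \<open>Translation invariance makes the integrals of the difference quotients vanish.\<close>

lemma integral_partial_deriv_eq_0:
  fixes f :: "'a::euclidean_space \<Rightarrow> real"
  assumes diff: "\<And>x. f differentiable (at x)" and cont: "continuous_on UNIV (partial_deriv b f)"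
    and K: "compact K" "\<And>x. x \<notin> K \<Longrightarrow> f x = 0"
    and supp: "\<And>x. x \<notin> K \<Longrightarrow> partial_deriv b f x = 0"
  shows "(\<integral>x. partial_deriv b f x \<partial>lborel) = 0"
proof -
  have contf: "continuous_on UNIV f"
    using diff by (simp add: continuous_at_imp_continuous_on differentiable_imp_continuous_within)
  have [measurable]: "f \<in> borel_measurable borel" "partial_deriv b f \<in> borel_measurable borel"
    using contf cont by (auto intro: borel_measurable_continuous_onI)
  have intf: "integrable lborel f"
    by (rule integrable_continuous_compact_support[OF contf K])
  have "bounded (partial_deriv b f ` K)"
    using K(1) cont by (intro compact_imp_bounded compact_continuous_image) (auto intro: continuous_on_subset)
  then obtain B0 where B0: "\<And>x. x \<in> K \<Longrightarrow> \<bar>partial_deriv b f x\<bar> \<le> B0"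
    by (auto simp: bounded_iff)
  define B where "B = max 0 B0"
  have B: "\<bar>partial_deriv b f x\<bar> \<le> B" for x
    using B0[of x] supp[of x] by (cases "x \<in> K") (auto simp: B_def)
  \<comment> \<open>All points from which a step \<open>t *\<^sub>R b\<close> with \<open>t\<close>
    in \<open>{0..1}\<close> reaches \<open>K\<close>. As \<open>1 / Suc n \<le> 1\<close>, every
    quotient \<open>q n\<close> vanishes outside, which gives an integrable majorant.\<close>
  define K' where "K' = (\<lambda>(x, t). x - t *\<^sub>R b) ` (K \<times> {0..1::real})"
  have K': "compact K'" unfolding K'_def case_prod_beta
    by (intro compact_continuous_image continuous_intros compact_Times K compact_Icc)
  define q where "q n x = (f (x + (1 / Suc n) *\<^sub>R b) - f x) / (1 / Suc n)" for n x
  have q_bd: "\<bar>q n x\<bar> \<le> B * indicator K' x" for n x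
  proof (cases "x \<in> K'")
    case True
    obtain s where "f (x + (1 / Suc n) *\<^sub>R b) - f (x + 0 *\<^sub>R b) = (1 / Suc n - 0) * frechet_derivative f (at (x + s *\<^sub>R b)) b"
      using MVT2[of 0 "1 / real (Suc n)" "\<lambda>s. f (x + s *\<^sub>R b)", OF _ has_real_derivative_along_line[OF diff]]
      by auto
    then have "q n x = partial_deriv b f (x + s *\<^sub>R b)"
      by (simp add: q_def partial_deriv_def)
    then show ?thesis using B True by simp
  next
    case False
    have "f (x + t *\<^sub>R b) = 0" if "t \<in> {0..1}" for t
    proof (rule K(2), rule notI)
      assume "x + t *\<^sub>R b \<in> K"
      with that have "(\<lambda>(x, t). x - t *\<^sub>R b) (x + t *\<^sub>R b, t) \<in> K'"
        unfolding K'_def by (intro imageI) auto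
      with False show False by simp
    qed
    from this[of "1 / Suc n"] this[of 0] False show ?thesis by (simp add: q_def)
  qed
  have "(\<lambda>n. \<integral>x. q n x \<partial>lborel) \<longlonglongrightarrow> (\<integral>x. partial_deriv b f x \<partial>lborel)"
  proof (rule integral_dominated_convergence[where w = "\<lambda>x. B * indicator K' x"])
    show "integrable lborel (\<lambda>x. B * indicator K' x)"
      using K' by (intro integrable_mult_right integrable_real_indicator)
        (use K' emeasure_compact_finite[OF K'] in \<open>auto simp: borel_compact\<close>)
    show "AE x in lborel. (\<lambda>n. q n x) \<longlonglongrightarrow> partial_deriv b f x"
    proof (rule AE_I2)
      fix x
      have "((\<lambda>h. (f (x + (0 + h) *\<^sub>R b) - f (x + 0 *\<^sub>R b)) / h) \<longlongrightarrow> frechet_derivative f (at (x + 0 *\<^sub>R b)) b) (at 0)"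
        using has_real_derivative_along_line[OF diff, of x b 0] unfolding DERIV_def .
      then have "((\<lambda>h. (f (x + h *\<^sub>R b) - f x) / h) \<longlongrightarrow> partial_deriv b f x) (at 0)"
        by (simp add: partial_deriv_def)
      moreover have "filterlim (\<lambda>n. 1 / real (Suc n)) (at 0) sequentially"
        unfolding filterlim_at using LIMSEQ_Suc[OF lim_1_over_n] by simp
      ultimately show "(\<lambda>n. q n x) \<longlonglongrightarrow> partial_deriv b f x"
        unfolding q_def by (rule filterlim_compose)
    qed
    show "AE x in lborel. norm (q n x) \<le> B * indicator K' x" for n using q_bd by simp
  qed (auto simp: q_def)
  moreover have "(\<integral>x. q n x \<partial>lborel) = 0" for n
    unfolding q_def using intf integrable_lborel_translate[OF intf]
    by (simp add: integral_lborel_translate)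
  ultimately show ?thesis by (simp add: LIMSEQ_const_iff)
qed

section \<open>Test functions and their weak derivatives\<close>

lemma Ck_imp_continuous: "Ck n \<phi> \<Longrightarrow> continuous_on UNIV \<phi>"
  by (cases n) (auto intro: differentiable_imp_continuous_on)

context
  fixes \<phi> :: "'a::euclidean_space \<Rightarrow> real" and \<Omega>
  assumes \<phi>: "\<phi> \<in> test_functions \<Omega>"
begin

lemma test_differentiable: "\<phi> differentiable (at x)"
proof -
  have "Ck (Suc 0) \<phi>" using \<phi> unfolding test_functions_def by blast
  then show ?thesis by (simp add: differentiable_on_def)
qed

lemma test_continuous: "continuous_on UNIV \<phi>"
  using \<phi> Ck_imp_continuous[of 0] unfolding test_functions_def by blast

lemma partial_deriv_eq_0_outside:
  assumes "x \<notin> closure {x. \<phi> x \<noteq> 0}"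
  shows "partial_deriv b \<phi> x = 0"
proof -
  have "((\<lambda>_. 0) has_derivative (\<lambda>_. 0)) (at x)" by simp
  then have "(\<phi> has_derivative (\<lambda>_. 0)) (at x)"
    by (rule has_derivative_transform_within_open[where s = "- closure {x. \<phi> x \<noteq> 0}"])
      (use assms closure_subset[of "{x. \<phi> x \<noteq> 0}"] in auto)
  then show ?thesis by (metis frechet_derivative_at partial_deriv_def)
qed

lemma partial_deriv_test: "b \<in> Basis \<Longrightarrow> partial_deriv b \<phi> \<in> test_functions \<Omega>"
proof -
  assume b: "b \<in> Basis"
  have "Ck n (partial_deriv b \<phi>)" for n
  proof -
    have "Ck (Suc n) \<phi>" using \<phi> unfolding test_functions_def by blast
    then show ?thesis using b by simp
  qed
  moreover have sub: "closure {x. partial_deriv b \<phi> x \<noteq> 0} \<subseteq> closure {x. \<phi> x \<noteq> 0}"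
    using partial_deriv_eq_0_outside by (intro closure_minimal) auto
  moreover have "compact (closure {x. \<phi> x \<noteq> 0})" "closure {x. \<phi> x \<noteq> 0} \<subseteq> \<Omega>"
    using \<phi> unfolding test_functions_def by auto
  moreover from closed_Int_compact[OF closed_closure this(1), of "{x. partial_deriv b \<phi> x \<noteq> 0}"] sub
  have "compact (closure {x. partial_deriv b \<phi> x \<noteq> 0})" by (simp add: Int_absorb2)
  ultimately show ?thesis
    unfolding test_functions_def by blast
qed

lemma test_support:
  obtains K where "compact K" "K \<subseteq> \<Omega>" "\<And>x. x \<notin> K \<Longrightarrow> \<phi> x = 0"
    "\<And>x b. x \<notin> K \<Longrightarrow> partial_deriv b \<phi> x = 0"
proof
  show "compact (closure {x. \<phi> x \<noteq> 0})" "closure {x. \<phi> x \<noteq> 0} \<subseteq> \<Omega>"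
    using \<phi> unfolding test_functions_def by auto
  show "\<phi> x = 0" if "x \<notin> closure {x. \<phi> x \<noteq> 0}" for x
    using that closure_subset[of "{x. \<phi> x \<noteq> 0}"] by auto
qed (rule partial_deriv_eq_0_outside)

lemma test_square_integrable: "square_integrable \<phi>"
  using test_support square_integrable_continuous_compact_support[OF test_continuous] by metis

lemma test_L2_on: "L2_of \<phi> \<in> L2_on \<Omega>"
proof -
  obtain K where "K \<subseteq> \<Omega>" "\<And>x. x \<notin> K \<Longrightarrow> \<phi> x = 0" using test_support by metis
  then show ?thesis using test_square_integrable by (auto simp: L2_on_def vanishes_outside_L2_of)
qed

lemma frechet_derivative_test:
  "frechet_derivative \<phi> (at x) z = (\<Sum>b\<in>Basis. inner z b * partial_deriv b \<phi> x)"
proof -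
  have "frechet_derivative \<phi> (at x) (\<Sum>b\<in>Basis. inner z b *\<^sub>R b)
      = (\<Sum>b\<in>Basis. inner z b * partial_deriv b \<phi> x)"
    using linear_frechet_derivative[OF test_differentiable]
    by (simp add: linear_sum linear_scale partial_deriv_def)
  then show ?thesis by (simp add: euclidean_representation)
qed

end

text \<open>Integration by parts on the whole space: the partial derivative of the product with
  another test function has integral zero.\<close>

lemma test_weak_deriv:
  assumes \<phi>: "\<phi> \<in> test_functions \<Omega>" and b: "b \<in> Basis"
  shows "is_weak_deriv \<Omega> b (L2_of \<phi>) (L2_of (partial_deriv b \<phi>))"
  unfolding is_weak_deriv_def
proof (intro conjI ballI)
  note \<phi>' = partial_deriv_test[OF \<phi> b]
  show "L2_of \<phi> \<in> L2_on \<Omega>" "L2_of (partial_deriv b \<phi>) \<in> L2_on \<Omega>"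
    using \<phi> \<phi>' by (auto intro: test_L2_on)
  fix \<psi> assume \<psi>: "\<psi> \<in> test_functions \<Omega>"
  note \<psi>' = partial_deriv_test[OF \<psi> b]
  have prod: "((\<lambda>x. \<phi> x * \<psi> x) has_derivative
      (\<lambda>h. \<phi> x * frechet_derivative \<psi> (at x) h + frechet_derivative \<phi> (at x) h * \<psi> x)) (at x)" for x
    using test_differentiable[OF \<phi>] test_differentiable[OF \<psi>]
    by (intro has_derivative_mult) (auto simp: frechet_derivative_works)
  then have pd: "partial_deriv b (\<lambda>x. \<phi> x * \<psi> x) = (\<lambda>x. \<phi> x * partial_deriv b \<psi> x + partial_deriv b \<phi> x * \<psi> x)"
    unfolding partial_deriv_def by (simp add: frechet_derivative_at[OF prod, symmetric])
  obtain K where K: "compact K" "\<And>x. x \<notin> K \<Longrightarrow> \<phi> x = 0" "\<And>x b. x \<notin> K \<Longrightarrow> partial_deriv b \<phi> x = 0"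
    using test_support[OF \<phi>] by metis
  have "(\<integral>x. partial_deriv b (\<lambda>x. \<phi> x * \<psi> x) x \<partial>lborel) = 0"
  proof (rule integral_partial_deriv_eq_0[OF _ _ K(1)])
    show "(\<lambda>x. \<phi> x * \<psi> x) differentiable at x" for x using prod by (auto simp: differentiable_def)
    show "continuous_on UNIV (partial_deriv b (\<lambda>x. \<phi> x * \<psi> x))"
      unfolding pd using \<phi> \<psi> \<phi>' \<psi>' by (intro continuous_intros test_continuous)
  qed (use K in \<open>auto simp: pd\<close>)
  moreover have "integrable lborel (\<lambda>x. \<phi> x * partial_deriv b \<psi> x)"
    "integrable lborel (\<lambda>x. partial_deriv b \<phi> x * \<psi> x)"
    using \<phi> \<psi> \<phi>' \<psi>' by (auto intro!: square_integrable_mult test_square_integrable)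
  ultimately show "inner (L2_of \<phi>) (L2_of (partial_deriv b \<psi>)) = - inner (L2_of (partial_deriv b \<phi>)) (L2_of \<psi>)"
    unfolding pd using test_square_integrable[OF \<phi>] test_square_integrable[OF \<psi>]
      test_square_integrable[OF \<phi>'] test_square_integrable[OF \<psi>']
    by (simp add: inner_L2_of)
qed

lemma Ck_add: "Ck n \<phi> \<Longrightarrow> Ck n \<psi> \<Longrightarrow> Ck n (\<lambda>x. \<phi> x + \<psi> x)"
proof (induction n arbitrary: \<phi> \<psi>)
  case 0
  then show ?case by (auto intro: continuous_intros)
next
  case (Suc n)
  have d: "\<phi> differentiable (at x)" "\<psi> differentiable (at x)" for x
    using Suc.prems by (auto simp: differentiable_on_def)
  have "partial_deriv b (\<lambda>x. \<phi> x + \<psi> x) = (\<lambda>x. partial_deriv b \<phi> x + partial_deriv b \<psi> x)" for b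
    unfolding partial_deriv_def
    using frechet_derivative_at[OF has_derivative_add[OF d(1)[unfolded frechet_derivative_works] d(2)[unfolded frechet_derivative_works]], symmetric]
    by simp
  then show ?case using Suc by (auto intro: differentiable_on_add)
qed

lemma Ck_scale: "Ck n \<phi> \<Longrightarrow> Ck n (\<lambda>x. c * \<phi> x)"
proof (induction n arbitrary: \<phi>)
  case 0
  then show ?case by (auto intro: continuous_intros)
next
  case (Suc n)
  have d: "\<phi> differentiable (at x)" for x
    using Suc.prems by (auto simp: differentiable_on_def)
  have "partial_deriv b (\<lambda>x. c * \<phi> x) = (\<lambda>x. c * partial_deriv b \<phi> x)" for b
    unfolding partial_deriv_def
    using frechet_derivative_at[OF has_derivative_mult_right[OF d(1)[unfolded frechet_derivative_works]], symmetric]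
    by simp
  then show ?case using Suc by (auto intro: differentiable_on_mult)
qed

lemma test_add:
  assumes "\<phi> \<in> test_functions \<Omega>" "\<psi> \<in> test_functions \<Omega>"
  shows "(\<lambda>x. \<phi> x + \<psi> x) \<in> test_functions \<Omega>"
proof -
  have sub: "closure {x. \<phi> x + \<psi> x \<noteq> 0} \<subseteq> closure {x. \<phi> x \<noteq> 0} \<union> closure {x. \<psi> x \<noteq> 0}"
    unfolding closure_Un[symmetric] by (intro closure_mono) auto
  have "compact (closure {x. \<phi> x \<noteq> 0} \<union> closure {x. \<psi> x \<noteq> 0})"
    using assms unfolding test_functions_def by (intro compact_Un) auto
  from closed_Int_compact[OF closed_closure this, of "{x. \<phi> x + \<psi> x \<noteq> 0}"]
  have "compact (closure {x. \<phi> x + \<psi> x \<noteq> 0})" using sub by (simp add: Int_absorb2)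
  then show ?thesis using assms sub Ck_add unfolding test_functions_def by blast
qed

lemma test_scale:
  assumes "\<phi> \<in> test_functions \<Omega>"
  shows "(\<lambda>x. c * \<phi> x) \<in> test_functions \<Omega>"
proof -
  have sub: "closure {x. c * \<phi> x \<noteq> 0} \<subseteq> closure {x. \<phi> x \<noteq> 0}"
    by (intro closure_mono) auto
  have "compact (closure {x. \<phi> x \<noteq> 0})"
    using assms unfolding test_functions_def by auto
  from closed_Int_compact[OF closed_closure this, of "{x. c * \<phi> x \<noteq> 0}"]
  have "compact (closure {x. c * \<phi> x \<noteq> 0})" using sub by (simp add: Int_absorb2)
  then show ?thesis using assms sub Ck_scale unfolding test_functions_def by blast
qed

text \<open>Density of the test functions makes weak derivatives unique. In the Dirichlet setting
  it follows from the density of the domain of the Laplacian.\<close>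

locale sobolev =
  fixes \<Omega> :: "'a::euclidean_space set"
  assumes test_dense: "\<And>g. g \<in> L2_on \<Omega> \<Longrightarrow> (\<And>\<phi>. \<phi> \<in> test_functions \<Omega> \<Longrightarrow> inner g (L2_of \<phi>) = 0) \<Longrightarrow> g = 0"
begin

lemma weak_deriv_unique:
  assumes "is_weak_deriv \<Omega> b f g" "is_weak_deriv \<Omega> b f h"
  shows "g = h"
proof -
  have "g - h = 0"
    using assms subspace_diff[OF subspace_L2_on]
    by (intro test_dense) (auto simp: is_weak_deriv_def inner_diff)
  then show ?thesis by simp
qed

lemma weak_deriv_eq: "is_weak_deriv \<Omega> b f g \<Longrightarrow> weak_deriv \<Omega> b f = g"
  unfolding weak_deriv_def by (rule the_equality) (auto intro: weak_deriv_unique)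

lemma weak_deriv_H1: "f \<in> H1 \<Omega> \<Longrightarrow> b \<in> Basis \<Longrightarrow> is_weak_deriv \<Omega> b f (weak_deriv \<Omega> b f)"
  using weak_deriv_eq by (auto simp: H1_def)

lemma is_weak_deriv_add:
  "is_weak_deriv \<Omega> b f f' \<Longrightarrow> is_weak_deriv \<Omega> b g g' \<Longrightarrow> is_weak_deriv \<Omega> b (f + g) (f' + g')"
  unfolding is_weak_deriv_def using subspace_add[OF subspace_L2_on] by (auto simp: inner_add)

lemma is_weak_deriv_scale: "is_weak_deriv \<Omega> b f f' \<Longrightarrow> is_weak_deriv \<Omega> b (c *\<^sub>R f) (c *\<^sub>R f')"
  unfolding is_weak_deriv_def using subspace_scale[OF subspace_L2_on] by auto

lemma subspace_H1: "subspace (H1 \<Omega>)"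
proof -
  have "is_weak_deriv \<Omega> b 0 0" for b
    unfolding is_weak_deriv_def using subspace_0[OF subspace_L2_on] by auto
  then show ?thesis
    unfolding subspace_def H1_def using subspace_L2_on[of \<Omega>, unfolded subspace_def]
    by (auto intro: is_weak_deriv_add is_weak_deriv_scale) (metis is_weak_deriv_add is_weak_deriv_scale)+
qed

lemma weak_deriv_add: "f \<in> H1 \<Omega> \<Longrightarrow> g \<in> H1 \<Omega> \<Longrightarrow> b \<in> Basis \<Longrightarrow>
    weak_deriv \<Omega> b (f + g) = weak_deriv \<Omega> b f + weak_deriv \<Omega> b g"
  and weak_deriv_scale: "f \<in> H1 \<Omega> \<Longrightarrow> b \<in> Basis \<Longrightarrow> weak_deriv \<Omega> b (c *\<^sub>R f) = c *\<^sub>R weak_deriv \<Omega> b f"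
  by (intro weak_deriv_eq is_weak_deriv_add is_weak_deriv_scale weak_deriv_H1; assumption)+

lemma weak_deriv_diff: "f \<in> H1 \<Omega> \<Longrightarrow> g \<in> H1 \<Omega> \<Longrightarrow> b \<in> Basis \<Longrightarrow>
    weak_deriv \<Omega> b (f - g) = weak_deriv \<Omega> b f - weak_deriv \<Omega> b g"
  using weak_deriv_add[of f "(-1) *\<^sub>R g" b] weak_deriv_scale[of g b "-1"] subspace_neg[OF subspace_H1, of g]
  by simp

lemma test_H1: "\<phi> \<in> test_functions \<Omega> \<Longrightarrow> L2_of \<phi> \<in> H1 \<Omega>"
  using test_weak_deriv test_L2_on by (auto simp: H1_def)

lemma weak_deriv_test: "\<phi> \<in> test_functions \<Omega> \<Longrightarrow> b \<in> Basis \<Longrightarrow>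
    weak_deriv \<Omega> b (L2_of \<phi>) = L2_of (partial_deriv b \<phi>)"
  by (intro weak_deriv_eq test_weak_deriv)

section \<open>The gradient seminorm and Green's formula\<close>

definition grad2 :: "'a L2 \<Rightarrow> real" where
  "grad2 f = (\<Sum>b\<in>Basis. (norm (weak_deriv \<Omega> b f))\<^sup>2)"

lemma grad2_nonneg: "grad2 f \<ge> 0"
  by (simp add: grad2_def sum_nonneg)

lemma H1_norm_eq: "H1_norm \<Omega> f = sqrt ((norm f)\<^sup>2 + grad2 f)"
  by (simp add: H1_norm_def grad2_def)

lemma H1_norm_squared: "(H1_norm \<Omega> f)\<^sup>2 = (norm f)\<^sup>2 + grad2 f"
  using grad2_nonneg by (simp add: H1_norm_eq)

lemma norm_le_H1_norm: "norm f \<le> H1_norm \<Omega> f"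
  unfolding H1_norm_eq using grad2_nonneg by (intro real_le_rsqrt) simp

lemma sqrt_grad2_le_H1_norm: "sqrt (grad2 f) \<le> H1_norm \<Omega> f"
  unfolding H1_norm_eq by simp

lemma weak_deriv_le_H1_norm:
  assumes "b \<in> Basis"
  shows "norm (weak_deriv \<Omega> b f) \<le> H1_norm \<Omega> f"
proof -
  have "(norm (weak_deriv \<Omega> b f))\<^sup>2 \<le> grad2 f"
    unfolding grad2_def using assms by (intro member_le_sum) auto
  then have "norm (weak_deriv \<Omega> b f) \<le> sqrt (grad2 f)" by (intro real_le_rsqrt)
  then show ?thesis using sqrt_grad2_le_H1_norm order_trans by blast
qed

lemma grad2_add_le:
  assumes "f \<in> H1 \<Omega>" "g \<in> H1 \<Omega>"
  shows "grad2 (f + g) \<le> 2 * grad2 f + 2 * grad2 g"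
proof -
  have "(norm (x + y))\<^sup>2 \<le> 2 * (norm x)\<^sup>2 + 2 * (norm y)\<^sup>2" for x y :: "'a L2"
  proof -
    have "0 \<le> (norm (x - y))\<^sup>2" by simp
    then show ?thesis unfolding power2_norm_eq_inner by (simp add: inner_add inner_diff inner_commute)
  qed
  then show ?thesis
    unfolding grad2_def sum_distrib_left sum.distrib[symmetric]
    by (intro sum_mono) (simp add: weak_deriv_add assms)
qed

text \<open>The factor 2 comes from the elementary bound for squares of sums. It suffices for
  approximation arguments and explains the \<open>e / 4\<close> in
  \<open>subspace_H10\<close>.\<close>

lemma H1_norm_add_le:
  assumes "f \<in> H1 \<Omega>" "g \<in> H1 \<Omega>"
  shows "H1_norm \<Omega> (f + g) \<le> 2 * (H1_norm \<Omega> f + H1_norm \<Omega> g)"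
proof (rule power2_le_imp_le)
  have nn: "H1_norm \<Omega> f \<ge> 0" for f using norm_le_H1_norm norm_ge_zero order_trans by blast
  have "0 \<le> (norm (f - g))\<^sup>2" by simp
  then have "(norm (f + g))\<^sup>2 \<le> 2 * (norm f)\<^sup>2 + 2 * (norm g)\<^sup>2"
    unfolding power2_norm_eq_inner by (simp add: inner_add inner_diff inner_commute)
  then have "(H1_norm \<Omega> (f + g))\<^sup>2 \<le> 2 * (H1_norm \<Omega> f)\<^sup>2 + 2 * (H1_norm \<Omega> g)\<^sup>2"
    using grad2_add_le[OF assms] unfolding H1_norm_squared by simp
  also have "\<dots> \<le> (2 * (H1_norm \<Omega> f + H1_norm \<Omega> g))\<^sup>2"
    using nn[of f] nn[of g] mult_nonneg_nonneg[OF nn[of f] nn[of g]] by (simp add: power2_eq_square algebra_simps)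
  finally show "(H1_norm \<Omega> (f + g))\<^sup>2 \<le> (2 * (H1_norm \<Omega> f + H1_norm \<Omega> g))\<^sup>2" .
  show "0 \<le> 2 * (H1_norm \<Omega> f + H1_norm \<Omega> g)" using nn by (simp add: add_nonneg_nonneg)
qed

lemma H1_norm_scale: "f \<in> H1 \<Omega> \<Longrightarrow> H1_norm \<Omega> (c *\<^sub>R f) = \<bar>c\<bar> * H1_norm \<Omega> f"
  by (simp add: H1_norm_def weak_deriv_scale power_mult_distrib sum_distrib_left[symmetric]
      distrib_left[symmetric] real_sqrt_mult)

lemma H10_H1: "f \<in> H10 \<Omega> \<Longrightarrow> f \<in> H1 \<Omega>"
  by (simp add: H10_def)

lemma H10_approx:
  assumes f: "f \<in> H10 \<Omega>"
  obtains \<phi> where "\<And>n. \<phi> n \<in> test_functions \<Omega>" "(\<lambda>n. L2_of (\<phi> n)) \<longlonglongrightarrow> f"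
    "\<And>b. b \<in> Basis \<Longrightarrow> (\<lambda>n. weak_deriv \<Omega> b (L2_of (\<phi> n))) \<longlonglongrightarrow> weak_deriv \<Omega> b f"
proof -
  have "\<exists>\<phi>\<in>test_functions \<Omega>. H1_norm \<Omega> (f - L2_of \<phi>) < 1 / Suc n" for n
    using f unfolding H10_def by simp
  then obtain \<phi> where \<phi>: "\<And>n. \<phi> n \<in> test_functions \<Omega>" "\<And>n. H1_norm \<Omega> (f - L2_of (\<phi> n)) < 1 / Suc n"
    by metis
  have lim: "(\<lambda>n. 1 / real (Suc n)) \<longlonglongrightarrow> 0" using LIMSEQ_Suc[OF lim_1_over_n] .
  show thesis
  proof (rule that[OF \<phi>(1)])
    have "(\<lambda>n. L2_of (\<phi> n) - f) \<longlonglongrightarrow> 0"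
      using less_imp_le[OF order.strict_trans1[OF norm_le_H1_norm \<phi>(2)]]
      by (intro Lim_null_comparison[OF always_eventually lim]) (simp add: norm_minus_commute)
    then show "(\<lambda>n. L2_of (\<phi> n)) \<longlonglongrightarrow> f" by (rule LIM_zero_cancel)
    fix b :: 'a assume b: "b \<in> Basis"
    have "(\<lambda>n. weak_deriv \<Omega> b (L2_of (\<phi> n)) - weak_deriv \<Omega> b f) \<longlonglongrightarrow> 0"
      using less_imp_le[OF order.strict_trans1[OF weak_deriv_le_H1_norm[OF b] \<phi>(2)]]
      by (intro Lim_null_comparison[OF always_eventually lim])
        (simp add: norm_minus_commute weak_deriv_diff H10_H1[OF f] test_H1[OF \<phi>(1)] b)
    then show "(\<lambda>n. weak_deriv \<Omega> b (L2_of (\<phi> n))) \<longlonglongrightarrow> weak_deriv \<Omega> b f" by (rule LIM_zero_cancel)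
  qed
qed

lemma subspace_H10: "subspace (H10 \<Omega>)"
  unfolding subspace_def
proof (intro conjI allI impI ballI)
  have nn: "H1_norm \<Omega> f \<ge> 0" for f using norm_le_H1_norm norm_ge_zero order_trans by blast
  have zero: "(\<lambda>_. 0) \<in> test_functions \<Omega>"
  proof -
    have "Ck n (\<lambda>_::'a. 0)" for n
      by (induction n) (auto simp: partial_deriv_def[abs_def])
    then show ?thesis by (simp add: test_functions_def)
  qed
  have H1_0: "H1_norm \<Omega> 0 = 0" using H1_norm_scale[OF subspace_0[OF subspace_H1], of 0] by simp
  have L0: "L2_of (\<lambda>_::'a. 0) = 0" by transfer (simp add: square_integrable_zero)
  have "H1_norm \<Omega> (0 - L2_of (\<lambda>_. 0)) = 0" by (simp add: L0 H1_0)
  then show "0 \<in> H10 \<Omega>"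
    unfolding H10_def using zero subspace_0[OF subspace_H1] by force
  fix f assume f: "f \<in> H10 \<Omega>"
  show "f + g \<in> H10 \<Omega>" if g: "g \<in> H10 \<Omega>" for g
    unfolding H10_def
  proof (intro CollectI conjI allI impI)
    show "f + g \<in> H1 \<Omega>" using f g subspace_add[OF subspace_H1] by (auto intro: H10_H1)
    fix e :: real assume "e > 0"
    then have "e / 4 > 0" by simp
    then obtain \<phi> \<psi> where a: "\<phi> \<in> test_functions \<Omega>" "H1_norm \<Omega> (f - L2_of \<phi>) < e / 4"
      "\<psi> \<in> test_functions \<Omega>" "H1_norm \<Omega> (g - L2_of \<psi>) < e / 4"
      using f g unfolding H10_def by blast
    have "H1_norm \<Omega> ((f - L2_of \<phi>) + (g - L2_of \<psi>)) \<le> 2 * (H1_norm \<Omega> (f - L2_of \<phi>) + H1_norm \<Omega> (g - L2_of \<psi>))"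
      using f g a by (intro H1_norm_add_le subspace_diff[OF subspace_H1] H10_H1 test_H1)
    also have "\<dots> < e" using a by simp
    finally have "H1_norm \<Omega> (f + g - L2_of (\<lambda>x. \<phi> x + \<psi> x)) < e"
      using a by (simp add: L2_of_add test_square_integrable algebra_simps)
    then show "\<exists>\<phi>\<in>test_functions \<Omega>. H1_norm \<Omega> (f + g - L2_of \<phi>) < e" using test_add a by blast
  qed
  show "c *\<^sub>R f \<in> H10 \<Omega>" for c
    unfolding H10_def
  proof (intro CollectI conjI allI impI)
    show "c *\<^sub>R f \<in> H1 \<Omega>" using f subspace_scale[OF subspace_H1] by (auto intro: H10_H1)
    fix e :: real assume "e > 0"
    then have "e / (\<bar>c\<bar> + 1) > 0" by simp
    then obtain \<phi> where a: "\<phi> \<in> test_functions \<Omega>" "H1_norm \<Omega> (f - L2_of \<phi>) < e / (\<bar>c\<bar> + 1)"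
      using f unfolding H10_def by blast
    have "H1_norm \<Omega> (c *\<^sub>R (f - L2_of \<phi>)) = \<bar>c\<bar> * H1_norm \<Omega> (f - L2_of \<phi>)"
      using f a by (intro H1_norm_scale subspace_diff[OF subspace_H1] H10_H1 test_H1)
    also have "\<dots> \<le> (\<bar>c\<bar> + 1) * H1_norm \<Omega> (f - L2_of \<phi>)" using nn by (intro mult_right_mono) auto
    also have "\<dots> < e"
    proof -
      have p: "\<bar>c\<bar> + 1 > 0" by simp
      show ?thesis using a(2) unfolding pos_less_divide_eq[OF p] by (simp add: mult.commute)
    qed
    finally have "H1_norm \<Omega> (c *\<^sub>R f - L2_of (\<lambda>x. c * \<phi> x)) < e"
      using a by (simp add: L2_of_scale test_square_integrable scaleR_diff_right)
    then show "\<exists>\<phi>\<in>test_functions \<Omega>. H1_norm \<Omega> (c *\<^sub>R f - L2_of \<phi>) < e" using test_scale a by blast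
  qed
qed

text \<open>For a test function in the place of \<open>v\<close> this is the definition of the weak
  derivative of \<open>g\<close>; membership of \<open>v\<close> in \<open>H10\<close> allows
  passing to the limit without a boundary term.\<close>

lemma integration_by_parts:
  assumes g: "g \<in> H1 \<Omega>" and v: "v \<in> H10 \<Omega>" and b: "b \<in> Basis"
  shows "inner g (weak_deriv \<Omega> b v) = - inner (weak_deriv \<Omega> b g) v"
proof -
  obtain \<phi> where \<phi>: "\<And>n. \<phi> n \<in> test_functions \<Omega>" "(\<lambda>n. L2_of (\<phi> n)) \<longlonglongrightarrow> v"
    "(\<lambda>n. weak_deriv \<Omega> b (L2_of (\<phi> n))) \<longlonglongrightarrow> weak_deriv \<Omega> b v"
    using H10_approx[OF v] b by metis
  show ?thesis
  proof (rule LIMSEQ_unique)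
    show "(\<lambda>n. inner g (weak_deriv \<Omega> b (L2_of (\<phi> n)))) \<longlonglongrightarrow> inner g (weak_deriv \<Omega> b v)"
      using \<phi> by (intro tendsto_intros)
    have "inner g (weak_deriv \<Omega> b (L2_of (\<phi> n))) = - inner (weak_deriv \<Omega> b g) (L2_of (\<phi> n))" for n
      using weak_deriv_H1[OF g b] \<phi>(1) by (simp add: is_weak_deriv_def weak_deriv_test b)
    then show "(\<lambda>n. inner g (weak_deriv \<Omega> b (L2_of (\<phi> n)))) \<longlonglongrightarrow> - inner (weak_deriv \<Omega> b g) v"
      using \<phi>(2) by (simp add: tendsto_intros)
  qed
qed

lemma green:
  assumes f: "f \<in> H2 \<Omega>" and v: "v \<in> H10 \<Omega>"
  shows "inner (neg_laplacian \<Omega> f) v = (\<Sum>b\<in>Basis. inner (weak_deriv \<Omega> b f) (weak_deriv \<Omega> b v))"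
  using f v by (simp add: neg_laplacian_def inner_sum_left H2_def integration_by_parts sum_negf)

lemma green_grad2: "f \<in> H2 \<Omega> \<inter> H10 \<Omega> \<Longrightarrow> inner (neg_laplacian \<Omega> f) f = grad2 f"
  by (simp add: green grad2_def power2_norm_eq_inner)

text \<open>The hypothesis of \<open>sqrt_op_domI\<close> with \<open>q = grad2 v\<close>:
  Cauchy-Schwarz in L2 for each direction, then for the sum over the directions.\<close>

lemma green_bound:
  assumes f: "f \<in> H2 \<Omega> \<inter> H10 \<Omega>" and v: "v \<in> H10 \<Omega>"
  shows "(inner (neg_laplacian \<Omega> f) v)\<^sup>2 \<le> grad2 v * inner (neg_laplacian \<Omega> f) f"
proof -
  have "\<bar>inner (neg_laplacian \<Omega> f) v\<bar> \<le> (\<Sum>b\<in>Basis. norm (weak_deriv \<Omega> b f) * norm (weak_deriv \<Omega> b v))"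
    using f v by (auto simp: green intro!: order_trans[OF sum_abs] sum_mono Cauchy_Schwarz_ineq2)
  then have "(inner (neg_laplacian \<Omega> f) v)\<^sup>2 \<le> (\<Sum>b\<in>Basis. norm (weak_deriv \<Omega> b f) * norm (weak_deriv \<Omega> b v))\<^sup>2"
    by (metis abs_ge_zero power2_abs power_mono)
  also have "\<dots> \<le> grad2 f * grad2 v" unfolding grad2_def by (rule Cauchy_Schwarz_ineq_sum)
  finally show ?thesis using green_grad2[OF f] by (simp add: mult.commute)
qed

end

section \<open>The Friedrichs inequality\<close>

text \<open>The variance of \<open>g\<close> over the unit interval is nonnegative.\<close>

lemma square_integral_unit_interval_le:
  fixes g :: "real \<Rightarrow> real"
  assumes "continuous_on UNIV g"
  shows "(\<integral>s. indicator {0..1} s * g s \<partial>lborel)\<^sup>2 \<le> (\<integral>s. indicator {0..1} s * (g s)\<^sup>2 \<partial>lborel)"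
proof -
  define I where "I = (\<integral>s. indicator {0..1} s * g s \<partial>lborel)"
  have int: "integrable lborel (\<lambda>s. indicator {0..1} s * k s)" if "continuous_on UNIV k" for k :: "real \<Rightarrow> real"
    using borel_integrable_compact[of "{0..1}" k] that by (auto intro: continuous_on_subset)
  have one: "(\<integral>s. indicator {0..1::real} s \<partial>lborel) = (1::real)" by simp
  have "0 \<le> (\<integral>s. indicator {0..1} s * (g s - I)\<^sup>2 \<partial>lborel)"
    by (intro integral_nonneg_AE) auto
  also have "(\<lambda>s. indicator {0..1} s * (g s - I)\<^sup>2) =
      (\<lambda>s. indicator {0..1} s * (g s)\<^sup>2 - 2 * I * (indicator {0..1} s * g s) + I\<^sup>2 * indicator {0..1} s)"
    by (auto simp: power2_diff indicator_def)
  also have "(\<integral>s. indicator {0..1} s * (g s)\<^sup>2 - 2 * I * (indicator {0..1} s * g s) + I\<^sup>2 * indicator {0..1} s \<partial>lborel)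
      = (\<integral>s. indicator {0..1} s * (g s)\<^sup>2 \<partial>lborel) - 2 * I * I + I\<^sup>2 * 1"
    using int[of g] int[of "\<lambda>s. (g s)\<^sup>2"] int[of "\<lambda>_. 1"] assms
    by (simp add: continuous_on_power one I_def[symmetric])
  finally show ?thesis by (simp add: I_def[symmetric] power2_eq_square)
qed

context sobolev
begin

lemma grad2_test: "\<phi> \<in> test_functions \<Omega> \<Longrightarrow>
    grad2 (L2_of \<phi>) = (\<Sum>b\<in>Basis. (norm (L2_of (partial_deriv b \<phi>)))\<^sup>2)"
  by (simp add: grad2_def weak_deriv_test)

text \<open>The increment is the integral of the directional derivative \<open>D\<close> along the
  segment. The unit interval inequality, exchange of integrals and translation invariance reduce it
  to the integral of \<open>(D x)\<^sup>2\<close>, which Cauchy-Schwarz bounds by the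
  gradient.\<close>

lemma nn_integral_translation_le:
  assumes \<phi>: "\<phi> \<in> test_functions \<Omega>"
  shows "(\<integral>\<^sup>+x. ennreal ((\<phi> (x + z) - \<phi> x)\<^sup>2) \<partial>lborel) \<le> ennreal ((norm z)\<^sup>2 * grad2 (L2_of \<phi>))"
proof -
  define D where "D y = frechet_derivative \<phi> (at y) z" for y
  have D: "D y = (\<Sum>b\<in>Basis. inner z b * partial_deriv b \<phi> y)" for y
    unfolding D_def by (rule frechet_derivative_test[OF \<phi>])
  have contD: "continuous_on UNIV D"
    unfolding D by (intro continuous_intros test_continuous[OF partial_deriv_test[OF \<phi>]])
  then have [measurable]: "D \<in> borel_measurable borel" by (rule borel_measurable_continuous_onI)
  have pointwise: "ennreal ((\<phi> (x + z) - \<phi> x)\<^sup>2) \<le> (\<integral>\<^sup>+s. indicator {0..1} s * ennreal ((D (x + s *\<^sub>R z))\<^sup>2) \<partial>lborel)"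
    for x
  proof -
    define g where "g s = D (x + s *\<^sub>R z)" for s
    have contg: "continuous_on UNIV g"
      unfolding g_def by (rule continuous_on_compose2[OF contD]) (auto intro!: continuous_intros)
    have "(\<integral>s. indicator {0..1} s *\<^sub>R g s \<partial>lborel) = \<phi> (x + 1 *\<^sub>R z) - \<phi> (x + 0 *\<^sub>R z)"
    proof (rule integral_FTC_atLeastAtMost)
      show "continuous_on {0..1} g" using contg by (rule continuous_on_subset) auto
      show "((\<lambda>s. \<phi> (x + s *\<^sub>R z)) has_vector_derivative g s) (at s within {0..1})" for s
        using has_real_derivative_along_line[OF test_differentiable[OF \<phi>], of x z s]
        unfolding g_def D_def has_real_derivative_iff_has_vector_derivative
        by (rule has_vector_derivative_at_within)
    qed simp
    then have "(\<phi> (x + z) - \<phi> x)\<^sup>2 \<le> (\<integral>s. indicator {0..1} s * (g s)\<^sup>2 \<partial>lborel)"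
      using square_integral_unit_interval_le[OF contg] by simp
    also have "ennreal \<dots> = (\<integral>\<^sup>+s. ennreal (indicator {0..1} s * (g s)\<^sup>2) \<partial>lborel)"
    proof (rule nn_integral_eq_integral[symmetric])
      show "integrable lborel (\<lambda>s. indicator {0..1} s * (g s)\<^sup>2)"
        using borel_integrable_compact[of "{0..1}" "\<lambda>s. (g s)\<^sup>2"] contg
        by (auto intro: continuous_on_subset continuous_on_power)
    qed simp
    also have "\<dots> = (\<integral>\<^sup>+s. indicator {0..1} s * ennreal ((g s)\<^sup>2) \<partial>lborel)"
      by (intro nn_integral_cong) (auto simp: indicator_def)
    finally show ?thesis by (simp add: g_def ennreal_leI)
  qed
  have "(\<integral>\<^sup>+x. ennreal ((\<phi> (x + z) - \<phi> x)\<^sup>2) \<partial>lborel)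
      \<le> (\<integral>\<^sup>+x. \<integral>\<^sup>+s. indicator {0..1} s * ennreal ((D (x + s *\<^sub>R z))\<^sup>2) \<partial>lborel \<partial>lborel)"
    by (intro nn_integral_mono pointwise)
  also have "\<dots> = (\<integral>\<^sup>+s. \<integral>\<^sup>+x. indicator {0..1} s * ennreal ((D (x + s *\<^sub>R z))\<^sup>2) \<partial>lborel \<partial>lborel)"
    by (rule lborel_pair.Fubini'[symmetric]) measurable
  also have "\<dots> = (\<integral>\<^sup>+s. indicator {0..1::real} s * (\<integral>\<^sup>+x. ennreal ((D x)\<^sup>2) \<partial>lborel) \<partial>lborel)"
    by (intro nn_integral_cong)
      (simp add: nn_integral_cmult nn_integral_lborel_translate[of "\<lambda>x. ennreal ((D x)\<^sup>2)"])
  also have "\<dots> = (\<integral>\<^sup>+x. ennreal ((D x)\<^sup>2) \<partial>lborel)"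
    by (simp add: nn_integral_multc)
  also have "\<dots> \<le> (\<integral>\<^sup>+x. (\<Sum>b\<in>Basis. ennreal ((norm z)\<^sup>2) * ennreal ((partial_deriv b \<phi> x)\<^sup>2)) \<partial>lborel)"
  proof (rule nn_integral_mono)
    fix x
    have "(D x)\<^sup>2 \<le> (\<Sum>b\<in>Basis. (inner z b)\<^sup>2) * (\<Sum>b\<in>Basis. (partial_deriv b \<phi> x)\<^sup>2)"
      unfolding D by (rule Cauchy_Schwarz_ineq_sum)
    also have "(\<Sum>b\<in>Basis. (inner z b)\<^sup>2) = (norm z)\<^sup>2"
      unfolding power2_norm_eq_inner by (subst euclidean_inner) (simp add: power2_eq_square)
    finally show "ennreal ((D x)\<^sup>2) \<le> (\<Sum>b\<in>Basis. ennreal ((norm z)\<^sup>2) * ennreal ((partial_deriv b \<phi> x)\<^sup>2))"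
      by (simp add: ennreal_leI sum_distrib_left ennreal_mult[symmetric] sum_ennreal)
  qed
  also have "\<dots> = (\<Sum>b\<in>Basis. ennreal ((norm z)\<^sup>2) * ennreal ((norm (L2_of (partial_deriv b \<phi>)))\<^sup>2))"
  proof -
    have [measurable]: "partial_deriv b \<phi> \<in> borel_measurable borel" if "b \<in> Basis" for b
      using test_continuous[OF partial_deriv_test[OF \<phi> that]] by (rule borel_measurable_continuous_onI)
    show ?thesis
      by (subst nn_integral_sum)
        (auto intro!: sum.cong simp: nn_integral_cmult
          nn_integral_norm_L2_of[OF test_square_integrable[OF partial_deriv_test[OF \<phi>]]])
  qed
  also have "\<dots> = ennreal ((norm z)\<^sup>2 * grad2 (L2_of \<phi>))"
    by (simp add: grad2_test[OF \<phi>] sum_distrib_left ennreal_mult[symmetric] sum_ennreal)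
  finally show ?thesis .
qed

text \<open>With \<open>z = y - x\<close> the integral over \<open>x\<close> is a translation
  estimate; the cube \<open>B\<close> has volume \<open>(2 * h) ^ DIM('a)\<close>, and
  \<open>(norm z)\<^sup>2 \<le> DIM('a) * h\<^sup>2\<close> on it.\<close>

lemma nn_integral_near_diagonal_le:
  fixes h :: real
  assumes \<phi>: "\<phi> \<in> test_functions \<Omega>" and h: "h > 0"
  defines "B \<equiv> cbox (- h *\<^sub>R One) (h *\<^sub>R One) :: 'a set"
  shows "(\<integral>\<^sup>+x. \<integral>\<^sup>+y. indicator B (y - x) * ennreal ((\<phi> y - \<phi> x)\<^sup>2) \<partial>lborel \<partial>lborel)
    \<le> ennreal ((2 * h) ^ DIM('a) * (DIM('a) * h\<^sup>2 * grad2 (L2_of \<phi>)))"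
proof -
  have [measurable]: "\<phi> \<in> borel_measurable borel"
    using test_continuous[OF \<phi>] by (rule borel_measurable_continuous_onI)
  have B[measurable]: "B \<in> sets borel" by (simp add: B_def)
  have "(\<integral>\<^sup>+x. \<integral>\<^sup>+y. indicator B (y - x) * ennreal ((\<phi> y - \<phi> x)\<^sup>2) \<partial>lborel \<partial>lborel)
      = (\<integral>\<^sup>+x. \<integral>\<^sup>+z. indicator B z * ennreal ((\<phi> (x + z) - \<phi> x)\<^sup>2) \<partial>lborel \<partial>lborel)"
  proof (rule nn_integral_cong)
    fix x
    have "(\<integral>\<^sup>+y. indicator B (y - x) * ennreal ((\<phi> y - \<phi> x)\<^sup>2) \<partial>lborel)
        = (\<integral>\<^sup>+z. indicator B (z + x - x) * ennreal ((\<phi> (z + x) - \<phi> x)\<^sup>2) \<partial>lborel)"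
      by (rule nn_integral_lborel_translate[symmetric]) measurable
    then show "(\<integral>\<^sup>+y. indicator B (y - x) * ennreal ((\<phi> y - \<phi> x)\<^sup>2) \<partial>lborel)
        = (\<integral>\<^sup>+z. indicator B z * ennreal ((\<phi> (x + z) - \<phi> x)\<^sup>2) \<partial>lborel)"
      by (simp add: add.commute)
  qed
  also have "\<dots> = (\<integral>\<^sup>+z. \<integral>\<^sup>+x. indicator B z * ennreal ((\<phi> (x + z) - \<phi> x)\<^sup>2) \<partial>lborel \<partial>lborel)"
    by (rule lborel_pair.Fubini'[symmetric]) measurable
  also have "\<dots> \<le> (\<integral>\<^sup>+z. indicator B z * ennreal (DIM('a) * h\<^sup>2 * grad2 (L2_of \<phi>)) \<partial>lborel)"
  proof (rule nn_integral_mono)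
    fix z
    have "(norm z)\<^sup>2 \<le> DIM('a) * h\<^sup>2" if "z \<in> B"
    proof -
      have "(norm z)\<^sup>2 = (\<Sum>b\<in>Basis. (inner z b)\<^sup>2)"
        unfolding power2_norm_eq_inner by (subst euclidean_inner) (simp add: power2_eq_square)
      also have "\<dots> \<le> (\<Sum>b\<in>(Basis :: 'a set). h\<^sup>2)"
      proof (rule sum_mono)
        fix b :: 'a assume b: "b \<in> Basis"
        then have "\<bar>inner z b\<bar> \<le> h" using that by (auto simp: B_def mem_box)
        then show "(inner z b)\<^sup>2 \<le> h\<^sup>2" using h by (simp add: abs_le_square_iff[symmetric])
      qed
      finally show ?thesis by simp
    qed
    then have "indicator B z * (\<integral>\<^sup>+x. ennreal ((\<phi> (x + z) - \<phi> x)\<^sup>2) \<partial>lborel)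
        \<le> indicator B z * ennreal (DIM('a) * h\<^sup>2 * grad2 (L2_of \<phi>))"
      by (cases "z \<in> B")
        (auto intro!: order_trans[OF nn_integral_translation_le[OF \<phi>]] ennreal_leI mult_right_mono grad2_nonneg)
    then show "(\<integral>\<^sup>+x. indicator B z * ennreal ((\<phi> (x + z) - \<phi> x)\<^sup>2) \<partial>lborel)
        \<le> indicator B z * ennreal (DIM('a) * h\<^sup>2 * grad2 (L2_of \<phi>))"
      by (simp add: nn_integral_cmult)
  qed
  also have "\<dots> = emeasure lborel B * ennreal (DIM('a) * h\<^sup>2 * grad2 (L2_of \<phi>))"
    by (simp add: nn_integral_multc)
  also have "emeasure lborel B = ennreal ((2 * h) ^ DIM('a))"
  proof -
    have "emeasure lborel B = ennreal (\<Prod>b\<in>(Basis :: 'a set). (h *\<^sub>R One - - h *\<^sub>R One) \<bullet> b)"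
      unfolding B_def using h by (intro emeasure_lborel_cbox) (simp add: inner_minus_left)
    also have "(\<Prod>b\<in>(Basis :: 'a set). (h *\<^sub>R One - - h *\<^sub>R One) \<bullet> b) = (\<Prod>b\<in>(Basis :: 'a set). 2 * h)"
      by (intro prod.cong) (auto simp: inner_diff_left inner_add_left)
    finally show ?thesis by simp
  qed
  also have "ennreal ((2 * h) ^ DIM('a)) * ennreal (DIM('a) * h\<^sup>2 * grad2 (L2_of \<phi>))
      = ennreal ((2 * h) ^ DIM('a) * (DIM('a) * h\<^sup>2 * grad2 (L2_of \<phi>)))"
    using h grad2_nonneg by (intro ennreal_mult[symmetric]) auto
  finally show ?thesis .
qed

end

text \<open>Expansion of the square on the product of \<open>Q\<close> with itself. The second claim
  makes the real number in the first nonnegative, which is needed to leave the extended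
  reals.\<close>

lemma nn_integral_variance:
  fixes f :: "'a::euclidean_space \<Rightarrow> real"
  assumes f: "square_integrable f" and Q[measurable]: "Q \<in> sets borel" and m: "emeasure lborel Q = ennreal m" "m \<ge> 0"
  shows "(\<integral>\<^sup>+x. \<integral>\<^sup>+y. indicator Q x * indicator Q y * ennreal ((f y - f x)\<^sup>2) \<partial>lborel \<partial>lborel)
    = ennreal (2 * m * (\<integral>x. indicator Q x * (f x)\<^sup>2 \<partial>lborel) - 2 * (\<integral>x. indicator Q x * f x \<partial>lborel)\<^sup>2)"
      (is "?lhs = _")
    and "(\<integral>x. indicator Q x * f x \<partial>lborel)\<^sup>2 \<le> m * (\<integral>x. indicator Q x * (f x)\<^sup>2 \<partial>lborel)"
proof -
  have [measurable]: "f \<in> borel_measurable borel" using f by (simp add: square_integrable_def)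
  have int1: "integrable lborel (indicator Q :: 'a \<Rightarrow> real)"
    using m by (intro integrable_real_indicator) auto
  have iQ: "square_integrable (indicator Q :: 'a \<Rightarrow> real)"
    using int1 by (simp add: square_integrable_def power2_eq_square indicator_inter_arith[symmetric])
  have int2: "integrable lborel (\<lambda>x. indicator Q x * f x)"
    using square_integrable_mult[OF iQ f] .
  have int3: "integrable lborel (\<lambda>x. indicator Q x * (f x)\<^sup>2)"
    using f integrable_mult_indicator[of Q lborel "\<lambda>x. (f x)\<^sup>2"] by (simp add: square_integrable_def)
  have m': "(\<integral>x. indicator Q x \<partial>lborel) = m" using m by (simp add: measure_def)
  define A where "A = (\<integral>x. indicator Q x * (f x)\<^sup>2 \<partial>lborel)"
  define B where "B = (\<integral>x. indicator Q x * f x \<partial>lborel)"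
  have inner: "(\<integral>\<^sup>+y. indicator Q y * ennreal ((f y - c)\<^sup>2) \<partial>lborel) = ennreal (A - 2 * c * B + m * c\<^sup>2)" for c
  proof -
    have e: "indicator Q y * (f y - c)\<^sup>2 = indicator Q y * (f y)\<^sup>2 - 2 * c * (indicator Q y * f y) + c\<^sup>2 * indicator Q y" for y
      by (simp add: power2_diff algebra_simps)
    have "(\<integral>\<^sup>+y. indicator Q y * ennreal ((f y - c)\<^sup>2) \<partial>lborel) = (\<integral>\<^sup>+y. ennreal (indicator Q y * (f y - c)\<^sup>2) \<partial>lborel)"
      by (intro nn_integral_cong) (auto simp: indicator_def)
    also have "\<dots> = ennreal (\<integral>y. indicator Q y * (f y - c)\<^sup>2 \<partial>lborel)"
    proof (rule nn_integral_eq_integral)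
      show "integrable lborel (\<lambda>y. indicator Q y * (f y - c)\<^sup>2)"
        unfolding e using int1 int2 int3 by auto
    qed simp
    also have "(\<integral>y. indicator Q y * (f y - c)\<^sup>2 \<partial>lborel) = A - 2 * c * B + m * c\<^sup>2"
      unfolding e using int1 int2 int3 m' by (simp add: A_def B_def mult.commute)
    finally show ?thesis .
  qed
  have nonneg: "A - 2 * c * B + m * c\<^sup>2 \<ge> 0" for c
  proof -
    have "0 \<le> (\<integral>y. indicator Q y * (f y - c)\<^sup>2 \<partial>lborel)" by (intro integral_nonneg_AE) auto
    also have "\<dots> = (\<integral>y. indicator Q y * (f y)\<^sup>2 - 2 * c * (indicator Q y * f y) + c\<^sup>2 * indicator Q y \<partial>lborel)"
      by (intro Bochner_Integration.integral_cong) (auto simp: power2_diff algebra_simps)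
    also have "\<dots> = A - 2 * c * B + m * c\<^sup>2"
      using int1 int2 int3 m' by (simp add: A_def B_def mult.commute)
    finally show ?thesis .
  qed
  \<comment> \<open>Discriminant of a quadratic in the constant \<open>c\<close>.\<close>
  have "B\<^sup>2 \<le> m * A"
    using square_le_if_quadratic_nonneg[of m "- B" A] m(2) nonneg by (simp add: algebra_simps)
  then show "(\<integral>x. indicator Q x * f x \<partial>lborel)\<^sup>2 \<le> m * (\<integral>x. indicator Q x * (f x)\<^sup>2 \<partial>lborel)"
    by (simp add: A_def B_def)
  have "?lhs = (\<integral>\<^sup>+x. indicator Q x * ennreal (A - 2 * f x * B + m * (f x)\<^sup>2) \<partial>lborel)"
    by (simp add: mult.assoc nn_integral_cmult inner)
  also have "\<dots> = (\<integral>\<^sup>+x. ennreal (A * indicator Q x - 2 * B * (indicator Q x * f x) + m * (indicator Q x * (f x)\<^sup>2)) \<partial>lborel)"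
    by (intro nn_integral_cong) (auto simp: indicator_def mult_ac)
  also have "\<dots> = ennreal (\<integral>x. A * indicator Q x - 2 * B * (indicator Q x * f x) + m * (indicator Q x * (f x)\<^sup>2) \<partial>lborel)"
  proof (rule nn_integral_eq_integral)
    show "integrable lborel (\<lambda>x. A * indicator Q x - 2 * B * (indicator Q x * f x) + m * (indicator Q x * (f x)\<^sup>2))"
      using int1 int2 int3
      by (intro Bochner_Integration.integrable_add Bochner_Integration.integrable_diff integrable_mult_right)
    show "AE x in lborel. 0 \<le> A * indicator Q x - 2 * B * (indicator Q x * f x) + m * (indicator Q x * (f x)\<^sup>2)"
    proof (rule AE_I2)
      fix x
      show "0 \<le> A * indicator Q x - 2 * B * (indicator Q x * f x) + m * (indicator Q x * (f x)\<^sup>2)"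
        using nonneg[of "f x"] by (cases "x \<in> Q") (auto simp: mult_ac)
    qed
  qed
  also have "(\<integral>x. A * indicator Q x - 2 * B * (indicator Q x * f x) + m * (indicator Q x * (f x)\<^sup>2) \<partial>lborel)
      = 2 * m * A - 2 * B\<^sup>2"
    using int1 int2 int3 m' by (simp flip: A_def B_def) (simp add: power2_eq_square)
  finally show "?lhs = ennreal (2 * m * (\<integral>x. indicator Q x * (f x)\<^sup>2 \<partial>lborel) - 2 * (\<integral>x. indicator Q x * f x \<partial>lborel)\<^sup>2)"
    by (simp add: A_def B_def)
qed

text \<open>Half-open cubes partition the space, so each point has exactly one index. Restricting
  the index to \<open>Basis\<close> puts the indices of a bounded set into a finite product.\<close>

definition cell :: "real \<Rightarrow> 'a::euclidean_space \<Rightarrow> 'a \<Rightarrow> int" where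
  "cell h x = (\<lambda>b\<in>Basis. \<lfloor>inner x b / h\<rfloor>)"

lemma cell_eq_iff:
  fixes h :: real
  assumes "h > 0"
  shows "cell h x = cell h y \<longleftrightarrow>
    (\<forall>b\<in>Basis. \<lfloor>inner y b / h\<rfloor> * h \<le> inner x b \<and> inner x b < (\<lfloor>inner y b / h\<rfloor> + 1) * h)"
proof -
  have "cell h x = cell h y \<longleftrightarrow> (\<forall>b\<in>Basis. \<lfloor>inner x b / h\<rfloor> = \<lfloor>inner y b / h\<rfloor>)"
    unfolding cell_def by (auto simp: fun_eq_iff restrict_def)
  also have "\<dots> \<longleftrightarrow> (\<forall>b\<in>Basis. \<lfloor>inner y b / h\<rfloor> * h \<le> inner x b \<and> inner x b < (\<lfloor>inner y b / h\<rfloor> + 1) * h)"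
    unfolding floor_eq_iff using assms by (simp add: field_simps)
  finally show ?thesis .
qed

text \<open>The half-open cube lies between an open and a closed box of the same volume.\<close>

lemma cell_measure:
  fixes y :: "'a::euclidean_space" and h :: real
  assumes h: "h > 0"
  defines "Q \<equiv> {x. cell h x = cell h y}"
  shows "Q \<in> sets borel" "emeasure lborel Q = ennreal (h ^ DIM('a))"
proof -
  show Q: "Q \<in> sets borel" unfolding Q_def cell_eq_iff[OF h] by measurable
  define l u where "l = (\<Sum>b\<in>Basis. (\<lfloor>inner y b / h\<rfloor> * h) *\<^sub>R b)"
    and "u = (\<Sum>b\<in>Basis. ((\<lfloor>inner y b / h\<rfloor> + 1) * h) *\<^sub>R b)"
  have lu: "inner l b = \<lfloor>inner y b / h\<rfloor> * h" "inner u b = (\<lfloor>inner y b / h\<rfloor> + 1) * h" if "b \<in> Basis" for b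
    using that by (simp_all add: l_def u_def)
  have sub: "box l u \<subseteq> Q" "Q \<subseteq> cbox l u"
    unfolding Q_def cell_eq_iff[OF h] by (auto simp: mem_box lu less_imp_le)
  have le: "inner l b \<le> inner u b" if "b \<in> Basis" for b using that h by (simp add: lu)
  have "(\<Prod>b\<in>Basis. (u - l) \<bullet> b) = (\<Prod>b\<in>(Basis :: 'a set). h)"
    by (intro prod.cong) (auto simp: inner_diff_left lu algebra_simps)
  then have p: "(\<Prod>b\<in>Basis. (u - l) \<bullet> b) = h ^ DIM('a)" by simp
  show "emeasure lborel Q = ennreal (h ^ DIM('a))"
  proof (rule antisym)
    have "emeasure lborel Q \<le> emeasure lborel (cbox l u)" using sub by (intro emeasure_mono) auto
    then show "emeasure lborel Q \<le> ennreal (h ^ DIM('a))" using le p by simp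
    have "emeasure lborel (box l u) \<le> emeasure lborel Q" using sub Q by (intro emeasure_mono) auto
    then show "ennreal (h ^ DIM('a)) \<le> emeasure lborel Q" using le p by simp
  qed
qed

lemma cell_close:
  fixes x y :: "'a::euclidean_space" and h :: real
  assumes h: "h > 0" and eq: "cell h x = cell h y"
  shows "y - x \<in> cbox (- h *\<^sub>R One) (h *\<^sub>R One)"
proof -
  have "- h \<le> inner y b - inner x b \<and> inner y b - inner x b \<le> h" if "b \<in> Basis" for b
  proof -
    have "\<lfloor>inner y b / h\<rfloor> * h \<le> inner x b \<and> inner x b < (\<lfloor>inner y b / h\<rfloor> + 1) * h"
      "\<lfloor>inner y b / h\<rfloor> * h \<le> inner y b \<and> inner y b < (\<lfloor>inner y b / h\<rfloor> + 1) * h"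
      using eq cell_eq_iff[OF h, of x y] cell_eq_iff[OF h, of y y] that by blast+
    then show ?thesis by (simp add: algebra_simps)
  qed
  then show ?thesis by (simp add: mem_box inner_diff_left)
qed

lemma finite_cells:
  fixes \<Omega> :: "'a::euclidean_space set" and h :: real
  assumes "bounded \<Omega>" "h > 0"
  shows "finite (cell h ` \<Omega>)"
proof -
  obtain R where R: "\<And>x. x \<in> \<Omega> \<Longrightarrow> norm x \<le> R" using assms(1) by (auto simp: bounded_iff)
  have "cell h ` \<Omega> \<subseteq> PiE Basis (\<lambda>_. {\<lfloor>- R / h\<rfloor> .. \<lfloor>R / h\<rfloor>})"
  proof (clarsimp simp: cell_def)
    fix x b :: 'a assume "x \<in> \<Omega>" "b \<in> Basis"
    then have "\<bar>inner x b\<bar> \<le> R" using Basis_le_norm R order_trans by blast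
    then show "\<lfloor>- (R / h)\<rfloor> \<le> \<lfloor>inner x b / h\<rfloor> \<and> \<lfloor>inner x b / h\<rfloor> \<le> \<lfloor>R / h\<rfloor>"
      using assms(2) by (auto intro!: floor_mono simp: field_simps abs_le_iff)
  qed
  then show ?thesis by (rule finite_subset) (intro finite_PiE; simp)
qed

context sobolev
begin

text \<open>Indicator of a cell, normalised in L2: the squared inner product with it is the squared
  integral over the cell divided by the cell volume.\<close>

definition cell_fun :: "real \<Rightarrow> ('a \<Rightarrow> int) \<Rightarrow> 'a \<Rightarrow> real" where
  "cell_fun h i = (\<lambda>x. sqrt (1 / h ^ DIM('a)) * indicator {x. cell h x = i} x)"

lemma square_integrable_cell_fun:
  assumes h: "h > 0" and i: "i \<in> range (cell h)"
  shows "square_integrable (cell_fun h i)"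
proof -
  have m: "{x. cell h x = i} \<in> sets borel" "emeasure lborel {x. cell h x = i} < \<infinity>"
    using i by (auto simp: cell_measure[OF h])
  then have "integrable lborel (indicator {x. cell h x = i} :: 'a \<Rightarrow> real)"
    by (intro integrable_real_indicator) auto
  then have "square_integrable (indicator {x. cell h x = i} :: 'a \<Rightarrow> real)"
    using m by (simp add: square_integrable_def power2_eq_square indicator_inter_arith[symmetric])
  then show ?thesis unfolding cell_fun_def by (rule square_integrable_scale)
qed

text \<open>Distinct cells give orthogonal nonzero functions. This is needed because the sum in
  \<open>friedrichs\<close> runs over the set of functions, not over the cells.\<close>

lemma inj_cell_fun:
  assumes h: "h > 0"
  shows "inj_on (\<lambda>i. L2_of (cell_fun h i)) (range (cell h))"
proof (rule inj_onI)
  fix i j assume ij: "i \<in> range (cell h)" "j \<in> range (cell h)" and eq: "L2_of (cell_fun h i) = L2_of (cell_fun h j)"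
  note sq = square_integrable_cell_fun[OF h ij(1)] square_integrable_cell_fun[OF h ij(2)]
  show "i = j"
  proof (rule ccontr)
    assume "i \<noteq> j"
    then have "(\<lambda>x. cell_fun h i x * cell_fun h j x) = (\<lambda>_. 0)"
      by (auto simp: cell_fun_def indicator_def)
    then have "inner (L2_of (cell_fun h i)) (L2_of (cell_fun h j)) = 0"
      using sq by (simp add: inner_L2_of)
    then have "(\<integral>x. cell_fun h i x * cell_fun h i x \<partial>lborel) = 0"
      using sq eq inner_L2_of[OF sq(1) sq(1)] by simp
    moreover have "(\<lambda>x. cell_fun h i x * cell_fun h i x) = (\<lambda>x. 1 / h ^ DIM('a) * indicator {x. cell h x = i} x)"
      using h by (auto simp: cell_fun_def indicator_def)
    moreover have "(\<integral>x. indicator {x. cell h x = i} x \<partial>lborel) = h ^ DIM('a)"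
      using ij(1) h by (auto simp: measure_def cell_measure[OF h])
    ultimately show False using h by simp
  qed
qed

text \<open>On each cell the mean square of \<open>\<phi>\<close> exceeds the square of its mean by the mean of
  \<open>(\<phi> y - \<phi> x)\<^sup>2 / 2\<close>, and this is controlled by the gradient.\<close>

lemma friedrichs_test:
  fixes h :: real
  assumes \<phi>: "\<phi> \<in> test_functions \<Omega>" and bdd: "bounded \<Omega>" and h: "h > 0"
  shows "(norm (L2_of \<phi>))\<^sup>2 \<le> 2 ^ DIM('a) * DIM('a) * h\<^sup>2 * grad2 (L2_of \<phi>) +
    (\<Sum>i\<in>cell h ` \<Omega>. (inner (L2_of \<phi>) (L2_of (cell_fun h i)))\<^sup>2)"
proof -
  define I where "I = cell h ` \<Omega>"
  have finI: "finite I" unfolding I_def using bdd h by (rule finite_cells)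
  define Q where "Q i = {x :: 'a. cell h x = i}" for i
  have Q: "Q i \<in> sets borel" "emeasure lborel (Q i) = ennreal (h ^ DIM('a))" if "i \<in> I" for i
    using that by (auto simp: Q_def I_def cell_measure[OF h])
  have sq: "square_integrable \<phi>" using \<phi> by (rule test_square_integrable)
  have [measurable]: "\<phi> \<in> borel_measurable borel"
    using test_continuous[OF \<phi>] by (rule borel_measurable_continuous_onI)
  define A where "A i = (\<integral>x. indicator (Q i) x * (\<phi> x)\<^sup>2 \<partial>lborel)" for i
  define M where "M i = (\<integral>x. indicator (Q i) x * \<phi> x \<partial>lborel)" for i
  define m where "m = h ^ DIM('a)"
  have m: "m > 0" using h by (simp add: m_def)
  define B where "B = (cbox (- h *\<^sub>R One) (h *\<^sub>R One) :: 'a set)"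
  have [measurable]: "B \<in> sets borel" by (simp add: B_def)
  have sumA: "(\<Sum>i\<in>I. A i) = (norm (L2_of \<phi>))\<^sup>2"
  proof -
    have "(norm (L2_of \<phi>))\<^sup>2 = (\<integral>x. (\<phi> x)\<^sup>2 \<partial>lborel)" by (rule norm_L2_of[OF sq])
    also have "\<dots> = (\<integral>x. (\<Sum>i\<in>I. indicator (Q i) x * (\<phi> x)\<^sup>2) \<partial>lborel)"
    proof (rule Bochner_Integration.integral_cong)
      fix x
      \<comment> \<open>The support lies in \<Omega>, so the cells that meet \<Omega> carry the
        whole integral.\<close>
      obtain K where "K \<subseteq> \<Omega>" "\<And>x. x \<notin> K \<Longrightarrow> \<phi> x = 0" using test_support[OF \<phi>] by metis
      then have "\<phi> x = 0" if "cell h x \<notin> I" using that by (auto simp: I_def)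
      moreover have "(\<Sum>i\<in>I. indicator (Q i) x * (\<phi> x)\<^sup>2) = (\<Sum>i\<in>I. if i = cell h x then (\<phi> x)\<^sup>2 else 0)"
        by (intro sum.cong) (auto simp: Q_def indicator_def)
      ultimately show "(\<phi> x)\<^sup>2 = (\<Sum>i\<in>I. indicator (Q i) x * (\<phi> x)\<^sup>2)"
        using finI by (simp add: sum.delta)
    qed simp
    also have "\<dots> = (\<Sum>i\<in>I. A i)" unfolding A_def
    proof (rule Bochner_Integration.integral_sum)
      show "integrable lborel (\<lambda>x. indicator (Q i) x * (\<phi> x)\<^sup>2)" if "i \<in> I" for i
        using sq integrable_mult_indicator[of "Q i" lborel "\<lambda>x. (\<phi> x)\<^sup>2"] Q[OF that]
        by (simp add: square_integrable_def)
    qed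
    finally show ?thesis by simp
  qed
  have var: "(\<integral>\<^sup>+x. \<integral>\<^sup>+y. indicator (Q i) x * indicator (Q i) y * ennreal ((\<phi> y - \<phi> x)\<^sup>2) \<partial>lborel \<partial>lborel)
      = ennreal (2 * m * A i - 2 * (M i)\<^sup>2)" if "i \<in> I" for i
    unfolding A_def M_def using nn_integral_variance(1)[OF sq Q(1)[OF that] Q(2)[OF that]] h by (simp add: m_def)
  have var_nn: "0 \<le> 2 * m * A i - 2 * (M i)\<^sup>2" if i: "i \<in> I" for i
    using nn_integral_variance(2)[OF sq Q(1)[OF i] Q(2)[OF i]] h by (simp add: A_def M_def m_def)
  have "ennreal (\<Sum>i\<in>I. 2 * m * A i - 2 * (M i)\<^sup>2)
      = (\<Sum>i\<in>I. \<integral>\<^sup>+x. \<integral>\<^sup>+y. indicator (Q i) x * indicator (Q i) y * ennreal ((\<phi> y - \<phi> x)\<^sup>2) \<partial>lborel \<partial>lborel)"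
    using var var_nn by (simp add: sum_ennreal)
  also have "\<dots> = (\<integral>\<^sup>+x. \<integral>\<^sup>+y. (\<Sum>i\<in>I. indicator (Q i) x * indicator (Q i) y * ennreal ((\<phi> y - \<phi> x)\<^sup>2)) \<partial>lborel \<partial>lborel)"
    using Q(1) by (simp add: nn_integral_sum)
  \<comment> \<open>At most one index, the cell of \<open>x\<close>, contributes, and two points of
    one cell differ by a vector of \<open>B\<close>.\<close>
  also have "\<dots> \<le> (\<integral>\<^sup>+x. \<integral>\<^sup>+y. indicator B (y - x) * ennreal ((\<phi> y - \<phi> x)\<^sup>2) \<partial>lborel \<partial>lborel)"
  proof (intro nn_integral_mono)
    fix x y
    have "(\<Sum>i\<in>I. indicator (Q i) x * indicator (Q i) y * ennreal ((\<phi> y - \<phi> x)\<^sup>2))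
        = (\<Sum>i\<in>I. if i = cell h x then indicator (Q i) y * ennreal ((\<phi> y - \<phi> x)\<^sup>2) else 0)"
      by (intro sum.cong) (auto simp: Q_def indicator_def)
    also have "\<dots> \<le> indicator (Q (cell h x)) y * ennreal ((\<phi> y - \<phi> x)\<^sup>2)"
      using finI by (simp add: sum.delta)
    also have "\<dots> \<le> indicator B (y - x) * ennreal ((\<phi> y - \<phi> x)\<^sup>2)"
      using cell_close[OF h, of x y] by (auto simp: Q_def B_def indicator_def)
    finally show "(\<Sum>i\<in>I. indicator (Q i) x * indicator (Q i) y * ennreal ((\<phi> y - \<phi> x)\<^sup>2))
        \<le> indicator B (y - x) * ennreal ((\<phi> y - \<phi> x)\<^sup>2)" .
  qed
  also have "\<dots> \<le> ennreal ((2 * h) ^ DIM('a) * (DIM('a) * h\<^sup>2 * grad2 (L2_of \<phi>)))"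
    unfolding B_def by (rule nn_integral_near_diagonal_le[OF \<phi> h])
  finally have "(\<Sum>i\<in>I. 2 * m * A i - 2 * (M i)\<^sup>2) \<le> (2 * h) ^ DIM('a) * (DIM('a) * h\<^sup>2 * grad2 (L2_of \<phi>))"
    using h grad2_nonneg by (subst (asm) ennreal_le_iff) auto
  moreover have "(\<Sum>i\<in>I. 2 * m * A i - 2 * (M i)\<^sup>2) = 2 * m * (norm (L2_of \<phi>))\<^sup>2 - 2 * (\<Sum>i\<in>I. (M i)\<^sup>2)"
    unfolding sum_subtractf sum_distrib_left[symmetric] sumA ..
  \<comment> \<open>The cube \<open>B\<close> has the volume of \<open>2 ^ DIM('a)\<close> cells,
    the origin of that factor.\<close>
  moreover have "(2 * h) ^ DIM('a) * (DIM('a) * h\<^sup>2 * grad2 (L2_of \<phi>))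
      = m * (2 ^ DIM('a) * DIM('a) * h\<^sup>2 * grad2 (L2_of \<phi>))"
    by (simp add: m_def power_mult_distrib mult_ac)
  ultimately have "2 * m * (norm (L2_of \<phi>))\<^sup>2 \<le> 2 * (\<Sum>i\<in>I. (M i)\<^sup>2) + m * (2 ^ DIM('a) * DIM('a) * h\<^sup>2 * grad2 (L2_of \<phi>))"
    by linarith
  also have "\<dots> \<le> 2 * m * ((\<Sum>i\<in>I. (M i)\<^sup>2) / m + 2 ^ DIM('a) * DIM('a) * h\<^sup>2 * grad2 (L2_of \<phi>))"
    using m grad2_nonneg by (simp add: distrib_left)
  finally have "(norm (L2_of \<phi>))\<^sup>2 \<le> (\<Sum>i\<in>I. (M i)\<^sup>2) / m + 2 ^ DIM('a) * DIM('a) * h\<^sup>2 * grad2 (L2_of \<phi>)"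
    using m by (simp add: mult_le_cancel_left)
  moreover have "(M i)\<^sup>2 / m = (inner (L2_of \<phi>) (L2_of (cell_fun h i)))\<^sup>2" if i: "i \<in> I" for i
  proof -
    have "inner (L2_of \<phi>) (L2_of (cell_fun h i)) = (\<integral>x. \<phi> x * cell_fun h i x \<partial>lborel)"
      using i by (intro inner_L2_of sq square_integrable_cell_fun[OF h]) (auto simp: I_def)
    also have "(\<lambda>x. \<phi> x * cell_fun h i x) = (\<lambda>x. sqrt (1 / m) * (indicator (Q i) x * \<phi> x))"
      by (auto simp: cell_fun_def Q_def m_def)
    also have "(\<integral>x. sqrt (1 / m) * (indicator (Q i) x * \<phi> x) \<partial>lborel) = sqrt (1 / m) * M i"
      by (simp add: M_def)
    finally show ?thesis using m by (simp add: power_mult_distrib)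
  qed
  ultimately show ?thesis unfolding I_def[symmetric] by (simp add: sum_divide_distrib)
qed

lemma friedrichs:
  assumes bdd: "bounded \<Omega>" and e: "e > 0"
  shows "\<exists>G. finite G \<and> (\<forall>v\<in>H10 \<Omega>. (norm v)\<^sup>2 \<le> e * grad2 v + (\<Sum>g\<in>G. (inner v g)\<^sup>2))"
proof -
  define c where "c = 2 ^ DIM('a) * real DIM('a)"
  have c: "c > 0" by (simp add: c_def)
  \<comment> \<open>The side length for which the gradient coefficient in
    \<open>friedrichs_test\<close> equals \<open>e\<close>.\<close>
  define h where "h = sqrt (e / c)"
  have h: "h > 0" "c * h\<^sup>2 = e" using e c by (auto simp: h_def)
  define G where "G = (\<lambda>i. L2_of (cell_fun h i)) ` cell h ` \<Omega>"
  have sumG: "(\<Sum>g\<in>G. (inner v g)\<^sup>2) = (\<Sum>i\<in>cell h ` \<Omega>. (inner v (L2_of (cell_fun h i)))\<^sup>2)" for v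
    unfolding G_def using inj_on_subset[OF inj_cell_fun[OF h(1)], of "cell h ` \<Omega>"]
    by (subst sum.reindex) (auto simp: o_def)
  have "(norm v)\<^sup>2 \<le> e * grad2 v + (\<Sum>g\<in>G. (inner v g)\<^sup>2)" if v: "v \<in> H10 \<Omega>" for v
  proof -
    obtain \<phi> where \<phi>: "\<And>n. \<phi> n \<in> test_functions \<Omega>" "(\<lambda>n. L2_of (\<phi> n)) \<longlonglongrightarrow> v"
      "\<And>b. b \<in> Basis \<Longrightarrow> (\<lambda>n. weak_deriv \<Omega> b (L2_of (\<phi> n))) \<longlonglongrightarrow> weak_deriv \<Omega> b v"
      using H10_approx[OF v] by metis
    show ?thesis
    proof (rule LIMSEQ_le)
      show "(\<lambda>n. (norm (L2_of (\<phi> n)))\<^sup>2) \<longlonglongrightarrow> (norm v)\<^sup>2" using \<phi>(2) by (intro tendsto_intros)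
      show "(\<lambda>n. e * grad2 (L2_of (\<phi> n)) + (\<Sum>g\<in>G. (inner (L2_of (\<phi> n)) g)\<^sup>2))
          \<longlonglongrightarrow> e * grad2 v + (\<Sum>g\<in>G. (inner v g)\<^sup>2)"
        unfolding grad2_def using \<phi>(2,3) by (intro tendsto_intros) auto
      show "\<exists>N. \<forall>n\<ge>N. (norm (L2_of (\<phi> n)))\<^sup>2 \<le> e * grad2 (L2_of (\<phi> n)) + (\<Sum>g\<in>G. (inner (L2_of (\<phi> n)) g)\<^sup>2)"
        using friedrichs_test[OF \<phi>(1) bdd h(1)] by (simp add: sumG c_def[symmetric] h(2))
    qed
  qed
  moreover have "finite G" unfolding G_def using finite_cells[OF bdd h(1)] by simp
  ultimately show ?thesis by blast
qed

end

section \<open>The Dirichlet Laplacian and the damped wave equation\<close>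

text \<open>The constant is fixed before the space, the operators and the trajectory, so that one
  value serves all domains, solutions and orders \<open>k\<close>.\<close>

lemma uniform_energy_decay:
  fixes \<alpha> \<beta> lam :: real
  assumes damping: "(\<alpha> > 0 \<and> \<beta> \<ge> 0) \<or> (\<alpha> \<ge> 0 \<and> \<beta> > 0)" and lam: "lam > 0"
  defines "\<delta> \<equiv> min ((\<alpha> + \<beta> * lam) / 2) (lam / (\<alpha> + \<beta> * lam))"
  shows "\<exists>C>0. \<forall>(V :: 'h::real_inner set) S J u u1 u2 t.
    damped_trajectory V S J \<alpha> \<beta> lam u u1 u2 \<longrightarrow> t \<ge> 0 \<longrightarrow>
      (norm (u1 t))\<^sup>2 + (norm (S (u t)))\<^sup>2 \<le>
        C * exp (- 2 * \<delta> * t) * ((norm (u1 0))\<^sup>2 + (norm (S (u 0)))\<^sup>2)"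
proof -
  have pos: "\<alpha> + \<beta> * lam > 0"
    using damping lam by (auto intro: add_pos_nonneg add_nonneg_pos)
  have "\<delta> \<le> lam / (\<alpha> + \<beta> * lam)" by (simp add: \<delta>_def)
  then have "\<delta> * (\<alpha> + \<beta> * lam) \<le> lam" using pos by (simp only: pos_le_divide_eq)
  moreover have "\<delta> \<le> (\<alpha> + \<beta> * lam) / 2" unfolding \<delta>_def by (rule min.cobounded1)
  moreover have "0 < \<delta>" using pos lam by (simp add: \<delta>_def)
  ultimately have \<delta>: "0 < \<delta>" "\<delta> \<le> (\<alpha> + \<beta> * lam) / 2" "\<delta> * (\<alpha> + \<beta> * lam) \<le> lam" by auto
  have le1: "\<beta> * \<delta> * lam + \<alpha> * \<delta> \<le> lam" using \<delta>(3) by (simp add: algebra_simps)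
  have "\<exists>K. \<forall>(V :: 'h set) S J u u1 u2 t. damped_trajectory V S J \<alpha> \<beta> lam u u1 u2 \<longrightarrow> t \<ge> 0 \<longrightarrow>
      (norm (u1 t))\<^sup>2 + (norm (S (u t)))\<^sup>2 \<le>
        K * exp (- (2 * \<delta>) * t) * ((norm (u1 0))\<^sup>2 + (norm (S (u 0)))\<^sup>2)"
  proof (cases "\<beta> * \<delta> < 1")
    case True
    show ?thesis
    proof (intro exI allI impI)
      fix V :: "'h set" and S J u u1 u2 and t :: real
      assume traj: "damped_trajectory V S J \<alpha> \<beta> lam u u1 u2" and t: "t \<ge> 0"
      interpret damped_trajectory V S J \<alpha> \<beta> lam u u1 u2 by (rule traj)
      show "(norm (u1 t))\<^sup>2 + (norm (S (u t)))\<^sup>2 \<le>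
          (2 + (2 * \<delta>\<^sup>2 / lam + 1) / min (1 - \<beta> * \<delta>) (\<delta>\<^sup>2 / lam)) * (2 + 3 * \<delta>\<^sup>2 / lam) *
          exp (- (2 * \<delta>) * t) * ((norm (u1 0))\<^sup>2 + (norm (S (u 0)))\<^sup>2)"
        using energy_decay_nondegenerate[OF \<delta> True t] by (simp only: X_def Y_def power2_norm_eq_inner)
    qed
  next
    case False
    \<comment> \<open>This rewrites the bound on \<delta>. The left side is nonnegative and the
      right side nonpositive, so both vanish and the case is the degenerate one.\<close>
    have "\<alpha> * \<delta> \<le> (1 - \<beta> * \<delta>) * lam" using le1 by (simp add: algebra_simps)
    moreover have "(1 - \<beta> * \<delta>) * lam \<le> 0" "0 \<le> \<alpha> * \<delta>"
      using False lam damping \<delta>(1) by (auto simp: mult_le_0_iff)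
    ultimately have "\<alpha> * \<delta> = 0" "(1 - \<beta> * \<delta>) * lam = 0" by linarith+
    then have deg: "\<alpha> = 0" "\<beta> * \<delta> = 1" using \<delta>(1) lam by auto
    then have \<delta>2: "\<delta> \<le> \<beta> * lam / 2" using \<delta>(2) by simp
    show ?thesis
    proof (intro exI allI impI)
      fix V :: "'h set" and S J u u1 u2 and t :: real
      assume traj: "damped_trajectory V S J \<alpha> \<beta> lam u u1 u2" and t: "t \<ge> 0"
      interpret damped_trajectory V S J \<alpha> \<beta> lam u u1 u2 by (rule traj)
      let ?a = "2 + 3 * \<delta>\<^sup>2 / lam" and ?b = "2 + (2 + 2 * \<delta> + \<beta> * lam) / \<delta>\<^sup>2"
      show "(norm (u1 t))\<^sup>2 + (norm (S (u t)))\<^sup>2 \<le>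
          (2 * ?a + (?a + 2 * ?b * \<beta> * lam * ?a + \<beta>\<^sup>2 * lam) / (\<beta>\<^sup>2 * lam)) *
          exp (- (2 * \<delta>) * t) * ((norm (u1 0))\<^sup>2 + (norm (S (u 0)))\<^sup>2)"
        using energy_decay_degenerate[OF deg(1) \<delta>(1) \<delta>2 deg(2) t] by (simp only: X_def Y_def power2_norm_eq_inner)
    qed
  qed
  then obtain K where K: "\<forall>(V :: 'h set) S J u u1 u2 t. damped_trajectory V S J \<alpha> \<beta> lam u u1 u2 \<longrightarrow> t \<ge> 0 \<longrightarrow>
      (norm (u1 t))\<^sup>2 + (norm (S (u t)))\<^sup>2 \<le>
        K * exp (- (2 * \<delta>) * t) * ((norm (u1 0))\<^sup>2 + (norm (S (u 0)))\<^sup>2)" ..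
  show ?thesis
  proof (intro exI[of _ "max 1 K"] conjI allI impI)
    fix V :: "'h set" and S J u u1 u2 and t :: real
    assume "damped_trajectory V S J \<alpha> \<beta> lam u u1 u2" "t \<ge> 0"
    from K[rule_format, OF this] show "(norm (u1 t))\<^sup>2 + (norm (S (u t)))\<^sup>2 \<le>
        max 1 K * exp (- 2 * \<delta> * t) * ((norm (u1 0))\<^sup>2 + (norm (S (u 0)))\<^sup>2)"
      by (rule order_trans) (simp add: mult_right_mono)
  qed simp
qed

section \<open>From the Dirichlet setting to abstract trajectories\<close>

lemma dirichlet_setting_imp_sobolev:
  assumes "dirichlet_setting \<Omega> DS S lam"
  shows "sobolev \<Omega>"
proof
  have T: "self_adjoint_op (L2_on \<Omega>) (H2 \<Omega> \<inter> H10 \<Omega>) (neg_laplacian \<Omega>)"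
    using assms by (simp add: dirichlet_setting_def)
  fix g assume g: "g \<in> L2_on \<Omega>" "\<And>\<phi>. \<phi> \<in> test_functions \<Omega> \<Longrightarrow> inner g (L2_of \<phi>) = 0"
  show "g = 0"
  proof (rule self_adjoint_op_dense[OF T g(1)])
    fix x assume "x \<in> H2 \<Omega> \<inter> H10 \<Omega>"
    then have x: "x \<in> H10 \<Omega>" by simp
    have "\<bar>inner x g\<bar> \<le> 0 + e" if e: "e > 0" for e
    proof -
      have "e / (norm g + 1) > 0" using e by (simp add: add_nonneg_pos)
      then obtain \<phi> where \<phi>: "\<phi> \<in> test_functions \<Omega>" "H1_norm \<Omega> (x - L2_of \<phi>) < e / (norm g + 1)"
        using x unfolding H10_def by blast
      have "norm (x - L2_of \<phi>) \<le> H1_norm \<Omega> (x - L2_of \<phi>)"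
        unfolding H1_norm_def by (intro real_le_rsqrt) (simp add: sum_nonneg)
      then have "norm (x - L2_of \<phi>) * norm g \<le> e / (norm g + 1) * (norm g + 1)"
        using \<phi>(2) e by (intro mult_mono) auto
      moreover have "e / (norm g + 1) * (norm g + 1) = e"
        using norm_ge_zero[of g] by (simp add: add_nonneg_eq_0_iff)
      moreover have "inner x g = inner (x - L2_of \<phi>) g"
        using g(2)[OF \<phi>(1)] by (simp add: inner_diff inner_commute)
      ultimately show ?thesis using Cauchy_Schwarz_ineq2[of "x - L2_of \<phi>" g] by simp
    qed
    then have "\<bar>inner x g\<bar> \<le> 0" by (rule field_le_epsilon)
    then show "inner x g = 0" by simp
  qed
qed

locale dirichlet =
  fixes \<Omega> :: "'a::euclidean_space set" and DS S lam
  assumes ds: "dirichlet_setting \<Omega> DS S lam" and lam: "lam > 0"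

sublocale dirichlet \<subseteq> sobolev
  using ds by (rule dirichlet_setting_imp_sobolev)

context dirichlet
begin

abbreviation "A \<equiv> neg_laplacian \<Omega>"
abbreviation "DA \<equiv> H2 \<Omega> \<inter> H10 \<Omega>"

lemma A_self_adjoint: "self_adjoint_op (L2_on \<Omega>) DA A"
  and S_sqrt: "sqrt_op (L2_on \<Omega>) DA A DS S"
  and S_self_adjoint: "self_adjoint_op (L2_on \<Omega>) DS S"
  using ds by (auto simp: dirichlet_setting_def sqrt_op_def)

lemma domain_\<Omega>: "bounded \<Omega>" "\<Omega> \<in> sets lborel"
  using ds by (auto simp: dirichlet_setting_def bounded_domain_def)

text \<open>On \<open>DA\<close> the form of \<open>A\<close> is \<open>grad2\<close> by Green's
  formula, so \<open>friedrichs\<close> supplies the compactness hypothesis of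
  \<open>rayleigh_lower_bound\<close>.\<close>

lemma A_coercive:
  assumes "v \<in> DA"
  shows "lam * (norm v)\<^sup>2 \<le> inner (A v) v"
proof (rule rayleigh_lower_bound[OF A_self_adjoint complete_L2_on[OF domain_\<Omega>(2)] _ _ _ assms])
  show "0 \<le> inner (A v) v" if "v \<in> DA" for v using that by (simp add: green_grad2 grad2_nonneg)
  show "lam \<le> \<nu>" if "eigenvalue_op DA A \<nu>" for \<nu>
    using ds that by (simp add: dirichlet_setting_def smallest_eigenvalue_op_def)
  show "\<exists>G. finite G \<and> (\<forall>v\<in>DA. (norm v)\<^sup>2 \<le> e * inner (A v) v + (\<Sum>g\<in>G. (inner v g)\<^sup>2))" if e: "e > 0" for e
  proof -
    obtain G where "finite G" "\<And>v. v \<in> H10 \<Omega> \<Longrightarrow> (norm v)\<^sup>2 \<le> e * grad2 v + (\<Sum>g\<in>G. (inner v g)\<^sup>2)"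
      using friedrichs[OF domain_\<Omega>(1) e] by blast
    then show ?thesis by (intro exI[of _ G]) (auto simp: green_grad2)
  qed
qed

lemma H10_L2_on: "v \<in> H10 \<Omega> \<Longrightarrow> v \<in> L2_on \<Omega>"
  by (simp add: H10_def H1_def)

lemma H10_DS: "v \<in> H10 \<Omega> \<Longrightarrow> v \<in> DS"
  and norm_S_le: "v \<in> H10 \<Omega> \<Longrightarrow> norm (S v) \<le> H1_norm \<Omega> v"
  and S_poincare: "v \<in> H10 \<Omega> \<Longrightarrow> lam * (norm v)\<^sup>2 \<le> (norm (S v))\<^sup>2"
proof -
  assume v: "v \<in> H10 \<Omega>"
  have bound: "(inner (A x) v)\<^sup>2 \<le> grad2 v * inner (A x) x" if "x \<in> DA" for x
    using that v by (rule green_bound)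
  note * = sqrt_op_domI[OF A_self_adjoint complete_L2_on[OF domain_\<Omega>(2)] subspace_L2_on lam A_coercive
      S_sqrt H10_L2_on[OF v] grad2_nonneg bound]
  show "v \<in> DS" by (rule *(1))
  show "lam * (norm v)\<^sup>2 \<le> (norm (S v))\<^sup>2" by (rule *(3))
  have "norm (S v) \<le> sqrt (grad2 v)" using *(2) by (rule real_le_rsqrt)
  then show "norm (S v) \<le> H1_norm \<Omega> v" using sqrt_grad2_le_H1_norm by (rule order_trans)
qed

definition "A_inv f = (SOME x. x \<in> DA \<and> A x = f)"

lemma A_inv:
  assumes "f \<in> L2_on \<Omega>"
  shows "A_inv f \<in> DA" "A (A_inv f) = f"
proof -
  obtain x where "x \<in> DA" "A x = f"
    by (rule self_adjoint_op_surj[OF A_self_adjoint complete_L2_on[OF domain_\<Omega>(2)] lam A_coercive assms])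
  then have "A_inv f \<in> DA \<and> A (A_inv f) = f"
    unfolding A_inv_def by (intro someI[of "\<lambda>x. x \<in> DA \<and> A x = f" x] conjI)
  then show "A_inv f \<in> DA" "A (A_inv f) = f" by auto
qed

text \<open>Coercivity makes \<open>A\<close> injective; this is how the choice in
  \<open>A_inv\<close> becomes additive and homogeneous.\<close>

lemma A_inv_unique:
  assumes "x \<in> DA" "A x = f"
  shows "A_inv f = x"
proof -
  have f: "f \<in> L2_on \<Omega>" using assms self_adjoint_opD(4)[OF A_self_adjoint] by blast
  have d: "A_inv f - x \<in> DA"
    using subspace_diff[OF self_adjoint_opD(1)[OF A_self_adjoint] A_inv(1)[OF f] assms(1)] .
  have "A (A_inv f - x) = 0"
    using self_adjoint_op_diff[OF A_self_adjoint A_inv(1)[OF f] assms(1)] A_inv(2)[OF f] assms(2) by simp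
  then have "lam * (norm (A_inv f - x))\<^sup>2 \<le> 0" using A_coercive[OF d] by simp
  then show ?thesis using lam by (simp add: mult_le_0_iff)
qed

lemma A_inv_add:
  assumes "v \<in> L2_on \<Omega>" "w \<in> L2_on \<Omega>"
  shows "A_inv (v + w) = A_inv v + A_inv w"
proof (rule A_inv_unique)
  note v = A_inv[OF assms(1)] and w = A_inv[OF assms(2)]
  show "A_inv v + A_inv w \<in> DA"
    using subspace_add[OF self_adjoint_opD(1)[OF A_self_adjoint] v(1) w(1)] .
  show "A (A_inv v + A_inv w) = v + w"
    unfolding self_adjoint_opD(5)[OF A_self_adjoint v(1) w(1)] v(2) w(2) ..
qed

lemma A_inv_scale:
  assumes "v \<in> L2_on \<Omega>"
  shows "A_inv (c *\<^sub>R v) = c *\<^sub>R A_inv v"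
proof (rule A_inv_unique)
  note v = A_inv[OF assms]
  show "c *\<^sub>R A_inv v \<in> DA"
    using subspace_scale[OF self_adjoint_opD(1)[OF A_self_adjoint] v(1)] .
  show "A (c *\<^sub>R A_inv v) = c *\<^sub>R v"
    unfolding self_adjoint_opD(6)[OF A_self_adjoint v(1)] v(2) ..
qed

lemma S_A_inv:
  assumes v: "v \<in> H10 \<Omega>" and w: "w \<in> H10 \<Omega>"
  shows "inner (S (A_inv v)) (S w) = inner v w"
proof -
  have J: "A_inv v \<in> DA" "A (A_inv v) = v" using A_inv H10_L2_on[OF v] by auto
  then have "S (A_inv v) \<in> DS" "S (S (A_inv v)) = v" using S_sqrt by (auto simp: sqrt_op_def)
  then show ?thesis using self_adjoint_op_sym[OF S_self_adjoint _ H10_DS[OF w]] by metis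
qed

lemma at_within_nonneg: "t > 0 \<Longrightarrow> at t within {0..} = at (t::real)"
  by (intro at_within_interior) simp

text \<open>The time derivative of order \<open>k - 1\<close> takes the role of \<open>u\<close>, so
  the energy of order \<open>k\<close> becomes the basic one and the equation is that with
  \<open>j = k\<close>.\<close>

lemma variational_solution_trajectory:
  assumes sol: "variational_solution \<Omega> S \<alpha> \<beta> k u0 u1 u" and k: "1 \<le> k" and "\<alpha> \<ge> 0" "\<beta> \<ge> 0"
  shows "damped_trajectory (H10 \<Omega>) S A_inv \<alpha> \<beta> lam (tderiv (k - 1) u) (tderiv k u) (tderiv (k + 1) u)"
proof
  have reg: "time_regular \<Omega> k u" using sol by (simp add: variational_solution_def)
  have k': "k - 1 < k" "Suc (k - 1) = k" using k by auto
  define w where "w = tderiv (k - 1) u"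
  have w: "w t \<in> H10 \<Omega>" "H1_continuous_at \<Omega> w t" "(w has_vector_derivative tderiv k u t) (at t within {0..})"
    if "t \<ge> 0" for t
    using reg k' that unfolding time_regular_def w_def by metis+
  have wH1: "has_H1_deriv_at \<Omega> w (tderiv k u t) t" if "t > 0" for t
    using reg k' that unfolding time_regular_def w_def by metis
  have w1: "tderiv k u t \<in> H10 \<Omega>" "(tderiv k u has_vector_derivative tderiv (Suc k) u t) (at t within {0..})" if "t > 0" for t
    using reg that unfolding time_regular_def by auto
  show S_add: "S (v + w) = S v + S w" if "v \<in> H10 \<Omega>" "w \<in> H10 \<Omega>" for v w
    using that H10_DS self_adjoint_opD(5)[OF S_self_adjoint] by blast
  show S_scale: "S (c *\<^sub>R v) = c *\<^sub>R S v" if "v \<in> H10 \<Omega>" for v c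
    using that H10_DS self_adjoint_opD(6)[OF S_self_adjoint] by blast
  show "continuous_on {0..} (tderiv (k - 1) u)"
    unfolding w_def[symmetric] continuous_on_eq_continuous_within
    using has_vector_derivative_continuous[OF w(3)] by auto
  show "continuous_on {0..} (\<lambda>t. S (tderiv (k - 1) u t))"
    unfolding w_def[symmetric] continuous_on_def
  proof
    fix t :: real assume t: "t \<in> {0..}"
    have "((\<lambda>s. S (w s) - S (w t)) \<longlongrightarrow> 0) (at t within {0..})"
    proof (rule Lim_null_comparison)
      show "\<forall>\<^sub>F s in at t within {0..}. norm (S (w s) - S (w t)) \<le> H1_norm \<Omega> (w s - w t)"
        unfolding eventually_at_filter
      proof (intro always_eventually allI impI)
        fix s :: real assume "s \<in> {0..}"
        then have ws: "w s \<in> H10 \<Omega>" "w t \<in> H10 \<Omega>" using w(1) t by auto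
        then have "S (w s - w t) = S (w s) - S (w t)"
          using self_adjoint_op_diff[OF S_self_adjoint] H10_DS by blast
        then show "norm (S (w s) - S (w t)) \<le> H1_norm \<Omega> (w s - w t)"
          using norm_S_le[OF subspace_diff[OF subspace_H10 ws]] by simp
      qed
      show "((\<lambda>s. H1_norm \<Omega> (w s - w t)) \<longlongrightarrow> 0) (at t within {0..})"
        using w(2) t by (auto simp: H1_continuous_at_def)
    qed
    then show "((\<lambda>t. S (w t)) \<longlongrightarrow> S (w t)) (at t within {0..})" by (rule LIM_zero_cancel)
  qed
  show "continuous_on {0..} (tderiv k u)" using reg by (simp add: time_regular_def)
  fix t :: real assume t: "t > 0"
  show "(tderiv (k - 1) u has_vector_derivative tderiv k u t) (at t)"
    using w(3)[of t] t by (simp add: at_within_nonneg w_def)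
  show "(tderiv k u has_vector_derivative tderiv (k + 1) u t) (at t)"
    using w1(2)[OF t] t by (simp add: at_within_nonneg)
  \<comment> \<open>\<open>S\<close> is controlled by the H1 norm, hence the appeal to
    differentiability in that norm, available for \<open>t > 0\<close>.\<close>
  show "((\<lambda>t. S (tderiv (k - 1) u t)) has_vector_derivative S (tderiv k u t)) (at t)"
    unfolding w_def[symmetric]
  proof (rule has_vector_derivative_linear_on[OF subspace_H10 S_add S_scale, where c = 1 and n = "H1_norm \<Omega>"])
    have "\<forall>\<^sub>F s in at t. s > 0" using t by (intro order_tendstoD) (auto intro: tendsto_ident_at)
    then show "\<forall>\<^sub>F s in at t. w s \<in> H10 \<Omega>" by eventually_elim (simp add: w(1))
    show "((\<lambda>s. H1_norm \<Omega> ((w s - w t) /\<^sub>R (s - t) - tderiv k u t)) \<longlongrightarrow> 0) (at t)"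
      using wH1[OF t] t by (simp add: has_H1_deriv_at_def at_within_nonneg)
  qed (use norm_S_le w(1) w1(1) t in auto)
next
  fix t :: real and v assume "t > 0" "v \<in> H10 \<Omega>"
  then show "inner (tderiv (k + 1) u t) v + \<beta> * inner (S (tderiv k u t)) (S v) +
      \<alpha> * inner (tderiv k u t) v + inner (S (tderiv (k - 1) u t)) (S v) = 0"
    using sol k unfolding variational_solution_def by auto
next
  fix v w assume v: "v \<in> H10 \<Omega>" and w: "w \<in> H10 \<Omega>"
  show "A_inv v \<in> H10 \<Omega>" using A_inv(1)[OF H10_L2_on[OF v]] by simp
  show "lam * (norm v)\<^sup>2 \<le> (norm (S v))\<^sup>2" using v by (rule S_poincare)
  show "A_inv (v + w) = A_inv v + A_inv w" by (intro A_inv_add H10_L2_on v w)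
  show "A_inv (c *\<^sub>R v) = c *\<^sub>R A_inv v" for c by (intro A_inv_scale H10_L2_on v)
  show "inner (S (A_inv v)) (S w) = inner v w" using v w by (rule S_A_inv)
next
  fix t :: real
  show "tderiv (k - 1) u t \<in> H10 \<Omega>" if "t \<ge> 0"
    using sol k that by (simp add: variational_solution_def time_regular_def)
  show "tderiv k u t \<in> H10 \<Omega>" if "t > 0"
    using sol that by (simp add: variational_solution_def time_regular_def)
qed (rule lam assms(3,4) subspace_H10)+

end

theorem theorem2p2:
  fixes \<alpha> \<beta> lam1 :: real
  assumes damping: "(\<alpha> > 0 \<and> \<beta> \<ge> 0) \<or> (\<alpha> \<ge> 0 \<and> \<beta> > 0)"
    and lam1_pos: "lam1 > 0"
  shows "(\<exists>C>0. \<forall>(\<Omega> :: 'a::euclidean_space set) DS S. dirichlet_setting \<Omega> DS S lam1 \<longrightarrow>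
      (\<forall>\<delta> k. 0 < \<delta> \<and> \<delta> \<le> min ((\<alpha> + \<beta> * lam1) / 2) (lam1 / (\<alpha> + \<beta> * lam1)) \<and> 1 \<le> k \<and>
        (\<delta> < min ((\<alpha> + \<beta> * lam1) / 2) (lam1 / (\<alpha> + \<beta> * lam1)) \<or> \<delta> = (\<alpha> + \<beta> * lam1) / 2) \<longrightarrow>
        (\<forall>u0 u1 u. variational_solution \<Omega> S \<alpha> \<beta> k u0 u1 u \<longrightarrow>
          (\<forall>t\<ge>0. energy S k u t \<le> C * exp (- 2 * \<delta> * t) * energy S k u 0))))
    \<and>
    (\<forall>(\<Omega> :: 'a set) DS S. dirichlet_setting \<Omega> DS S lam1 \<longrightarrow>
      (\<forall>\<delta> k. 0 < \<delta> \<and> \<delta> \<le> min ((\<alpha> + \<beta> * lam1) / 2) (lam1 / (\<alpha> + \<beta> * lam1)) \<and> 1 \<le> k \<and>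
        \<delta> = lam1 / (\<alpha> + \<beta> * lam1) \<longrightarrow>
        (\<exists>C>0. \<forall>u0 u1 u. variational_solution \<Omega> S \<alpha> \<beta> k u0 u1 u \<longrightarrow>
          (\<forall>t\<ge>0. (norm (tderiv k u t))\<^sup>2 \<le> C * exp (- 2 * \<delta> * t) * energy S k u 0))))"
proof -
  let ?\<delta>0 = "min ((\<alpha> + \<beta> * lam1) / 2) (lam1 / (\<alpha> + \<beta> * lam1))"
  from uniform_energy_decay[OF damping lam1_pos, where 'h = "'a L2"]
  obtain C where C0: "C > 0 \<and> (\<forall>(V :: 'a L2 set) S J u u1 u2 t.
    damped_trajectory V S J \<alpha> \<beta> lam1 u u1 u2 \<longrightarrow> t \<ge> 0 \<longrightarrow>
      (norm (u1 t))\<^sup>2 + (norm (S (u t)))\<^sup>2 \<le>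
        C * exp (- 2 * ?\<delta>0 * t) * ((norm (u1 0))\<^sup>2 + (norm (S (u 0)))\<^sup>2))" ..
  note C = conjunct1[OF C0] conjunct2[OF C0]
  have decay: "energy S k u t \<le> C * exp (- 2 * \<delta> * t) * energy S k u 0"
    if "dirichlet_setting \<Omega> DS S lam1" "\<delta> \<le> ?\<delta>0" "1 \<le> k" "variational_solution \<Omega> S \<alpha> \<beta> k u0 u1 u" "t \<ge> 0"
    for \<Omega> :: "'a set" and DS S \<delta> k u0 u1 u t
  proof -
    interpret dirichlet \<Omega> DS S lam1 using that(1) lam1_pos by unfold_locales
    have "damped_trajectory (H10 \<Omega>) S A_inv \<alpha> \<beta> lam1 (tderiv (k - 1) u) (tderiv k u) (tderiv (k + 1) u)"
      using that damping by (intro variational_solution_trajectory) auto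
    from C(2)[THEN spec, THEN spec, THEN spec, THEN spec, THEN spec, THEN spec, THEN spec,
        THEN mp, THEN mp, OF this that(5)]
    have "energy S k u t \<le> C * exp (- 2 * ?\<delta>0 * t) * energy S k u 0"
      unfolding energy_def times_divide_eq_right by (rule divide_right_mono) simp
    \<comment> \<open>A smaller rate is weaker because \<open>t \<ge> 0\<close>; this keeps
      \<open>C\<close> independent of \<delta>.\<close>
    also have "\<dots> \<le> C * exp (- 2 * \<delta> * t) * energy S k u 0"
    proof (intro mult_right_mono mult_left_mono)
      have "\<delta> * t \<le> ?\<delta>0 * t" using that(2,5) by (rule mult_right_mono)
      then show "exp (- 2 * ?\<delta>0 * t) \<le> exp (- 2 * \<delta> * t)" by (simp only: exp_le_cancel_iff)
    qed (use C(1) in \<open>simp_all add: energy_def\<close>)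
    finally show ?thesis .
  qed
  have norm_le: "(norm (tderiv k u t))\<^sup>2 \<le> 2 * energy S k u t" for S :: "'a L2 \<Rightarrow> 'a L2" and k u t
    by (simp add: energy_def)
  show ?thesis
  proof (rule conjI, goal_cases)
    case 1
    show ?case
    proof (intro exI[of _ C] conjI C(1) allI impI)
      fix \<Omega> :: "'a set" and DS S and \<delta> :: real and k :: nat and u0 u1 u and t :: real
      assume "dirichlet_setting \<Omega> DS S lam1" "variational_solution \<Omega> S \<alpha> \<beta> k u0 u1 u" "t \<ge> 0"
        and "0 < \<delta> \<and> \<delta> \<le> ?\<delta>0 \<and> 1 \<le> k \<and> (\<delta> < ?\<delta>0 \<or> \<delta> = (\<alpha> + \<beta> * lam1) / 2)"
      then show "energy S k u t \<le> C * exp (- 2 * \<delta> * t) * energy S k u 0"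
        by (elim conjE) (rule decay)
    qed
  next
    case 2
    show ?case
    proof (intro allI impI)
      fix \<Omega> :: "'a set" and DS S and \<delta> :: real and k :: nat
      assume *: "dirichlet_setting \<Omega> DS S lam1"
        "0 < \<delta> \<and> \<delta> \<le> ?\<delta>0 \<and> 1 \<le> k \<and> \<delta> = lam1 / (\<alpha> + \<beta> * lam1)"
      show "\<exists>C>0. \<forall>u0 u1 u. variational_solution \<Omega> S \<alpha> \<beta> k u0 u1 u \<longrightarrow>
          (\<forall>t\<ge>0. (norm (tderiv k u t))\<^sup>2 \<le> C * exp (- 2 * \<delta> * t) * energy S k u 0)"
      \<comment> \<open>The factor 2 undoes the one half in the energy.\<close>
      proof (intro exI[of _ "2 * C"] conjI allI impI)
        show "2 * C > 0" using C(1) by simp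
        fix u0 u1 u and t :: real
        assume "variational_solution \<Omega> S \<alpha> \<beta> k u0 u1 u" "t \<ge> 0"
        then have "energy S k u t \<le> C * exp (- 2 * \<delta> * t) * energy S k u 0"
          using * by (elim conjE) (rule decay)
        then show "(norm (tderiv k u t))\<^sup>2 \<le> 2 * C * exp (- 2 * \<delta> * t) * energy S k u 0"
          using norm_le[of k u t S] by simp
      qed
    qed
  qed
qed

end
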